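(* Let $s,L>0$ be fixed, let all communication constraints be equal, $B^{(1)}=\dots=B^{(m)}=B>0$, and assume $\log_2 n\le m=O(n^{\frac{2s}{1+2s}}/\log^2 n)$ ($m$ and $B$ may depend on $n$). Write $$R_n=\inf_{\hat f\in\mathcal F_{dist}(B,\dots,B;B^s_{2,\infty}(L))}\ \sup_{f_0\in B^s_{2,\infty}(L)}\mathbb E_{f_0,T}\|\hat f-f_0\|_2^2 .$$ Then: (i) if $B\ge n^{1/(1+2s)}/\log_2 n$, then $R_n\gtrsim L^{\frac{2}{1+2s}}n^{-\frac{2s}{1+2s}}$; (ii) if $(n\log_2(n)/m^{2+2s})^{1/(1+2s)}\le B<n^{1/(1+2s)}/\log_2 n$, then $$R_n\gtrsim L^{\frac{2}{1+2s}}\Big(\frac{n^{1/(1+2s)}}{B\log_2 n}\Big)^{\frac{2s}{2+2s}}n^{-\frac{2s}{1+2s}};$$ (iii) if $(n\log_2(n)/m^{2+2s})^{1/(1+2s)}>B$, then $$R_n\gtrsim L^{\frac{2}{1+2s}}\Big(\frac{n\log_2 n}{m}\Big)^{-\frac{2s}{1+2s}} .$$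
   Context: Model. The total sample size is $n$ and there are $m=m_n$ local machines with $n/m\in\mathbb N$. Machine $i\in\{1,\dots,m\}$ observes pairs $(T^{(i)}_\ell,X^{(i)}_\ell)$, $\ell=1,\dots,n/m$, with $X^{(i)}_\ell=f_0(T^{(i)}_\ell)+\sigma\varepsilon^{(i)}_\ell$, where the $T^{(i)}_\ell$ are iid uniform on $(0,1)$, the $\varepsilon^{(i)}_\ell$ are iid $N(0,1)$, independent of the design, $\sigma>0$ is fixed and $f_0\in L_2[0,1]$ is unknown and common to all machines. $\mathbb E_{f_0,T}$ is expectation under the joint law of all data. Distributed estimators. Machine $i$ sends to a central machine a finite binary string $Y^{(i)}$ which is a measurable function of its local data; $l(Y)$ denotes the length of a string $Y$. For $\mathcal F\subset L_2[0,1]$, $\mathcal F_{dist}(B^{(1)},\dots,B^{(m)};\mathcal F)$ is the class of estimators $\hat f$ that are measurable functions of $(Y^{(1)},\dots,Y^{(m)})$ for such strings satisfying $\mathbb E_{f_0,T}[l(Y^{(i)})]\le B^{(i)}$ for all $f_0\in\mathcal F$ and all $i$. Besov balls. $\psi_{jk}$ ($j\ge 0$, $0\le k\le 2^j-1$) is a Cohen–Daubechies–Vial compactly supported orthonormal wavelet basis of $L_2[0,1]$ with $N>s$ vanishing moments (coarsest-level scaling functions included in the indexing), $f_{jk}=\langle f,\psi_{jk}\rangle$, $\|f\|_{B^s_{2,\infty}}^2=\sup_{j}2^{2js}\sum_{k=0}^{2^j-1}f_{jk}^2$ and $B^s_{2,\infty}(L)=\{f\in L_2[0,1]:\|f\|_{B^s_{2,\infty}}<L\}$.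 Notation. For positive sequences, $a_n\lesssim b_n$ (equivalently $b_n\gtrsim a_n$) means $a_n\le Cb_n$ for all sufficiently large $n$ with a constant $C>0$ not depending on $n$ (it may depend on fixed quantities such as $s,L,\sigma$, the wavelet basis and the implied constant in the condition on $m$). *)

theory Defs
  imports "HOL-Probability.Probability"
begin

text \<open>Elements are represented by Borel functions on the whole line; only their values on
  $[0,1]$ enter any of the notions below.\<close>

definition L2_01 :: "(real \<Rightarrow> real) set" where
  "L2_01 = {f \<in> borel_measurable borel. set_integrable lborel {0..1} (\<lambda>x. (f x)\<^sup>2)}"

definition inner01 :: "(real \<Rightarrow> real) \<Rightarrow> (real \<Rightarrow> real) \<Rightarrow> real" where
  "inner01 f g = (LINT x:{0..1}|lborel. f x * g x)"

definition dist01_sq :: "(real \<Rightarrow> real) \<Rightarrow> (real \<Rightarrow> real) \<Rightarrow> ennreal" where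
  "dist01_sq f g = (\<integral>\<^sup>+ x\<in>{0..1}. ennreal ((f x - g x)\<^sup>2) \<partial>lborel)"

definition orthonormal_basis01 :: "'i set \<Rightarrow> ('i \<Rightarrow> real \<Rightarrow> real) \<Rightarrow> bool" where
  "orthonormal_basis01 I e \<longleftrightarrow>
     (\<forall>i\<in>I. e i \<in> L2_01) \<and>
     (\<forall>i\<in>I. \<forall>j\<in>I. inner01 (e i) (e j) = of_bool (i = j)) \<and>
     (\<forall>f\<in>L2_01. (\<forall>i\<in>I. inner01 f (e i) = 0) \<longrightarrow> (AE x\<in>{0..1} in lborel. f x = 0))"

definition inner_line :: "(real \<Rightarrow> real) \<Rightarrow> (real \<Rightarrow> real) \<Rightarrow> real" where
  "inner_line f g = (LINT x|lborel. f x * g x)"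

text \<open>Daubechies father and mother wavelets with \<open>N\<close> vanishing moments, both supported in
  $[1-N,N]$. The minimal filter length $2N$ together with the \<open>N\<close> vanishing moments leaves only
  the choice of the spectral factor free. Boundedness and (for \<open>N \<ge> 2\<close>) continuity hold for all
  these wavelets and select a representative; for \<open>N = 1\<close> this is the Haar wavelet.\<close>

definition daubechies :: "nat \<Rightarrow> (real \<Rightarrow> real) \<Rightarrow> (real \<Rightarrow> real) \<Rightarrow> bool" where
  "daubechies N \<phi> \<psi> \<longleftrightarrow>
     1 \<le> N \<and>
     \<phi> \<in> borel_measurable borel \<and> bounded (range \<phi>) \<and> (2 \<le> N \<longrightarrow> continuous_on UNIV \<phi>) \<and>
     (\<forall>x. x \<notin> {1 - real N .. real N} \<longrightarrow> \<phi> x = 0) \<and>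
     (LINT x|lborel. \<phi> x) = 1 \<and>
     (\<forall>k::int. inner_line \<phi> (\<lambda>x. \<phi> (x - of_int k)) = of_bool (k = 0)) \<and>
     (\<exists>h :: int \<Rightarrow> real.
        (\<forall>x. \<phi> x = sqrt 2 * (\<Sum>n = 1 - int N..int N. h n * \<phi> (2 * x - of_int n))) \<and>
        (\<forall>x. \<psi> x = sqrt 2 * (\<Sum>n = 1 - int N..int N.
                 (-1) powi n * h (1 - n) * \<phi> (2 * x - of_int n)))) \<and>
     (\<forall>l<N. (LINT x|lborel. x ^ l * \<psi> x) = 0)"

text \<open>The functions that, together with $\varphi(\cdot-m)$ for $m\ge N$, reproduce the
  polynomials of degree less than \<open>N\<close> on the half-line $[0,\infty)$.\<close>

definition edge_tilde :: "nat \<Rightarrow> (real \<Rightarrow> real) \<Rightarrow> nat \<Rightarrow> real \<Rightarrow> real" where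
  "edge_tilde N \<phi> k x =
     (if 0 \<le> x then \<Sum>n = k..2 * N - 2. real (n choose k) * \<phi> (x + real n - real N + 1) else 0)"

text \<open>The \<open>N\<close> edge scaling functions \<open>\<phi>e k\<close> are obtained from \<^const>\<open>edge_tilde\<close> by
  Gram--Schmidt, started from the function with the smallest support; the \<open>N\<close> edge wavelets
  \<open>\<psi>e k\<close> complete the half-line wavelet spaces. Both \<open>\<phi>e k\<close> and \<open>\<psi>e k\<close> are supported in
  $[0,N+k]$.\<close>

definition cdv_edge ::
    "nat \<Rightarrow> (real \<Rightarrow> real) \<Rightarrow> (real \<Rightarrow> real) \<Rightarrow> (nat \<Rightarrow> real \<Rightarrow> real) \<Rightarrow> (nat \<Rightarrow> real \<Rightarrow> real) \<Rightarrow> bool" where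
  "cdv_edge N \<phi> \<psi> \<phi>e \<psi>e \<longleftrightarrow>
     (\<exists>c :: nat \<Rightarrow> nat \<Rightarrow> real. \<forall>k<N. \<forall>x. \<phi>e k x = (\<Sum>i\<le>k. c k i * edge_tilde N \<phi> (N - 1 - i) x)) \<and>
     (\<forall>k<N. \<forall>l<N. inner_line (\<phi>e k) (\<phi>e l) = of_bool (k = l)) \<and>
     (\<exists>G g :: nat \<Rightarrow> nat \<Rightarrow> real. \<forall>k<N. \<forall>x. \<psi>e k x =
        sqrt 2 * ((\<Sum>l<N. G k l * \<phi>e l (2 * x)) + (\<Sum>m = N..N + 2 * k. g k m * \<phi> (2 * x - real m)))) \<and>
     (\<forall>k<N. \<forall>l<N. inner_line (\<psi>e k) (\<psi>e l) = of_bool (k = l)) \<and>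
     (\<forall>k<N. \<forall>l<N. inner_line (\<psi>e k) (\<phi>e l) = 0) \<and>
     (\<forall>k<N. \<forall>m\<ge>N. inner_line (\<psi>e k) (\<lambda>x. \<phi> (x - real m)) = 0 \<and>
                      inner_line (\<psi>e k) (\<lambda>x. \<psi> (x - real m)) = 0)"

definition cdv_fun ::
    "nat \<Rightarrow> (real \<Rightarrow> real) \<Rightarrow> (nat \<Rightarrow> real \<Rightarrow> real) \<Rightarrow> (nat \<Rightarrow> real \<Rightarrow> real) \<Rightarrow> nat \<Rightarrow> nat \<Rightarrow> real \<Rightarrow> real" where
  "cdv_fun N \<phi> \<phi>L \<phi>R j k x = 2 powr (real j / 2) *
     (if k < N then \<phi>L k (2 ^ j * x)
      else if k < 2 ^ j - N then \<phi> (2 ^ j * x - real k)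
      else \<phi>R (2 ^ j - 1 - k) (2 ^ j * (1 - x)))"

datatype cdv_index = Scal nat | Wav nat nat

definition cdv_indices :: "nat \<Rightarrow> cdv_index set" where
  "cdv_indices J0 = {Scal k |k. k < 2 ^ J0} \<union> {Wav j k |j k. J0 \<le> j \<and> k < 2 ^ j}"

text \<open>The condition \<open>2 * N \<le> 2 ^ J0\<close> keeps the two edges from interacting. The right edge
  functions come from the reflected wavelets, whose filter is the reflected filter. That the
  system is an orthonormal basis is a theorem about the construction; it is recorded here as
  part of the notion.\<close>

definition cdv_basis :: "nat \<Rightarrow> nat \<Rightarrow> (cdv_index \<Rightarrow> real \<Rightarrow> real) \<Rightarrow> bool" where
  "cdv_basis N J0 \<psi> \<longleftrightarrow>
     2 * N \<le> 2 ^ J0 \<and>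
     (\<exists>father mother \<phi>L \<psi>L \<phi>R \<psi>R.
        daubechies N father mother \<and>
        cdv_edge N father mother \<phi>L \<psi>L \<and>
        cdv_edge N (\<lambda>x. father (1 - x)) (\<lambda>x. mother (1 - x)) \<phi>R \<psi>R \<and>
        (\<forall>k<2 ^ J0. \<psi> (Scal k) = cdv_fun N father \<phi>L \<phi>R J0 k) \<and>
        (\<forall>j\<ge>J0. \<forall>k<2 ^ j. \<psi> (Wav j k) = cdv_fun N mother \<psi>L \<psi>R j k)) \<and>
     orthonormal_basis01 (cdv_indices J0) \<psi>"

text \<open>The levels are the wavelet levels \<open>j \<ge> J0\<close> and the block of scaling functions, whose
  resolution is that of level \<open>J0\<close>.\<close>

definition besov_norm_sq ::
    "real \<Rightarrow> nat \<Rightarrow> (cdv_index \<Rightarrow> real \<Rightarrow> real) \<Rightarrow> (real \<Rightarrow> real) \<Rightarrow> ennreal" where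
  "besov_norm_sq s J0 \<psi> f =
     sup (ennreal (2 powr (2 * real J0 * s) * (\<Sum>k<2 ^ J0. (inner01 f (\<psi> (Scal k)))\<^sup>2)))
         (SUP j\<in>{J0..}. ennreal (2 powr (2 * real j * s) * (\<Sum>k<2 ^ j. (inner01 f (\<psi> (Wav j k)))\<^sup>2)))"

definition besov_ball ::
    "real \<Rightarrow> nat \<Rightarrow> (cdv_index \<Rightarrow> real \<Rightarrow> real) \<Rightarrow> real \<Rightarrow> (real \<Rightarrow> real) set" where
  "besov_ball s J0 \<psi> L = {f \<in> L2_01. besov_norm_sq s J0 \<psi> f < ennreal (L\<^sup>2)}"

definition obs_law :: "real \<Rightarrow> (real \<Rightarrow> real) \<Rightarrow> (real \<times> real) measure" where
  "obs_law \<sigma> f =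
     distr (uniform_measure lborel {0<..<1} \<Otimes>\<^sub>M density lborel (\<lambda>x. ennreal (std_normal_density x)))
       (borel \<Otimes>\<^sub>M borel) (\<lambda>(t, e). (t, f t + \<sigma> * e))"

definition local_law :: "real \<Rightarrow> nat \<Rightarrow> nat \<Rightarrow> (real \<Rightarrow> real) \<Rightarrow> (nat \<Rightarrow> real \<times> real) measure" where
  "local_law \<sigma> n m f = (\<Pi>\<^sub>M l\<in>{..<n div m}. obs_law \<sigma> f)"

definition data_law :: "real \<Rightarrow> nat \<Rightarrow> nat \<Rightarrow> (real \<Rightarrow> real) \<Rightarrow> (nat \<Rightarrow> nat \<Rightarrow> real \<times> real) measure" where
  "data_law \<sigma> n m f = (\<Pi>\<^sub>M i\<in>{..<m}. local_law \<sigma> n m f)"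

text \<open>Strings may be empty and need not form a prefix code. As the set of lists of strings
  is countable, every decoder \<open>dec\<close> is measurable.\<close>

definition F_dist ::
    "real \<Rightarrow> nat \<Rightarrow> nat \<Rightarrow> (nat \<Rightarrow> real) \<Rightarrow> (real \<Rightarrow> real) set
      \<Rightarrow> ((nat \<Rightarrow> nat \<Rightarrow> real \<times> real) \<Rightarrow> real \<Rightarrow> real) set" where
  "F_dist \<sigma> n m B F = {fhat. \<exists>(enc :: nat \<Rightarrow> (nat \<Rightarrow> real \<times> real) \<Rightarrow> bool list) dec.
     (\<forall>i<m. enc i \<in> (\<Pi>\<^sub>M l\<in>{..<n div m}. borel \<Otimes>\<^sub>M borel) \<rightarrow>\<^sub>M count_space UNIV) \<and>
     (\<forall>f\<in>F. \<forall>i<m. (\<integral>\<^sup>+ D. of_nat (length (enc i (D i))) \<partial>data_law \<sigma> n m f) \<le> ennreal (B i)) \<and>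
     (\<forall>y. dec y \<in> L2_01) \<and>
     fhat = (\<lambda>D. dec (map (\<lambda>i. enc i (D i)) [0..<m]))}"

definition minimax_risk :: "real \<Rightarrow> nat \<Rightarrow> nat \<Rightarrow> (nat \<Rightarrow> real) \<Rightarrow> (real \<Rightarrow> real) set \<Rightarrow> ennreal" where
  "minimax_risk \<sigma> n m B F =
     (INF fhat\<in>F_dist \<sigma> n m B F. SUP f\<in>F. \<integral>\<^sup>+ D. dist01_sq (fhat D) f \<partial>data_law \<sigma> n m f)"

end

theory Submission
  imports Defs "HOL-Real_Asymp.Real_Asymp"
begin

text \<open>The signals are $f_\theta = a \sum_r \theta_r \psi_r$ with $\theta \in [-1,1]^d$, where the
  $\psi_r$ are interior wavelets of one level $j$ with disjoint supports, $d$ is of order $2^j$ and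
  $a^2$ is of order $2^{-j(1+2s)}$. A van Trees inequality for the uniform prior, with the weight
  $1-\theta_k^2$, bounds the Bayes risk from below by a multiple of $a^2 d$, that is, of $2^{-2js}$,
  as soon as the Fisher information about $\theta$ in all messages together is at most a small
  multiple of $d$. The score of one machine is sub-Gaussian with variance proxy of order $a^2 n/m$
  once atypical designs are discarded; these are super-polynomially rare because $n/m$ exceeds $2^j$
  by a factor of order $\log^2 n$. By a level-one inequality a message $Y$ therefore carries
  information at most a multiple of $(a^2 n/m) E \log (1/r(Y))$ for every subprobability $r$ on
  strings, and a suitable $r$ makes the last factor of order $1/n + B \log n$. Summing over the
  machines gives the condition $a^2 n B \log n \lesssim 2^j$; the full data give the alternative
  condition $a^2 n \lesssim 1$. The three regimes correspond to the best choice of $j$.\<close>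

section \<open>Product measures and discrete conditional expectation\<close>

text \<open>The budget is assumed under every signal of the ball, so the information bound can be
  proved at one parameter at a time; the prior enters only in the final average. The Fisher
  information of the messages is not formed as such. Instead the total score is correlated with an
  arbitrary bounded function \<open>F\<close> of the messages, and Young's inequality splits the
  correlation into a multiple of the second moment of \<open>F\<close> and the squared norms of the
  scores projected on the single messages. With the weighted estimation error for \<open>F\<close>,
  the first part is controlled by the risk itself. The uniform prior has infinite Fisher information
  at its edges; the weight, which vanishes there, takes the place of a smooth prior density. The
  obstacle is the random design: too many design points in one bump make the conditional variance of
  its score too large for a sub-Gaussian bound. Truncation cures this, but a truncated score is not
  the derivative of a log-likelihood. Hence the van Trees identity keeps the true score, and the
  exchange for the truncated one happens only inside the correlation with \<open>F\<close>, where a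
  small L1 error suffices because \<open>F\<close> is bounded.\<close>

lemma PiM_density:
  fixes M :: "'i \<Rightarrow> 'a measure"
  assumes "product_sigma_finite M" and "finite I"
    and f[measurable]: "\<And>i. f i \<in> borel_measurable (M i)"
    and sf: "product_sigma_finite (\<lambda>i. density (M i) (f i))"
  shows "(\<Pi>\<^sub>M i\<in>I. density (M i) (f i)) = density (Pi\<^sub>M I M) (\<lambda>x. \<Prod>i\<in>I. f i (x i))"
proof -
  interpret M: product_sigma_finite M by fact
  interpret D: product_sigma_finite "\<lambda>i. density (M i) (f i)" by fact
  have sets_eq: "sets (Pi\<^sub>M I M) = sets (\<Pi>\<^sub>M i\<in>I. density (M i) (f i))"
    by (intro sets_PiM_cong) auto
  have meas: "(\<lambda>x. \<Prod>i\<in>I. f i (x i)) \<in> borel_measurable (Pi\<^sub>M I M)"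
    by measurable
  \<comment> \<open>A product measure is determined by its values on boxes; on a box the indicator
    is a product too, and the integral factorises.\<close>
  have "density (Pi\<^sub>M I M) (\<lambda>x. \<Prod>i\<in>I. f i (x i)) = (\<Pi>\<^sub>M i\<in>I. density (M i) (f i))"
  proof (rule D.PiM_eqI)
    fix A assume A: "\<And>i. i \<in> I \<Longrightarrow> A i \<in> sets (density (M i) (f i))"
    then have A': "A i \<in> sets (M i)" if "i \<in> I" for i using that by simp
    have PA: "Pi\<^sub>E I A \<in> sets (Pi\<^sub>M I M)" using A' \<open>finite I\<close> by (intro sets_PiM_I_finite) auto
    have ind: "indicator (Pi\<^sub>E I A) x = (\<Prod>i\<in>I. indicator (A i) (x i) :: ennreal)"
      if xM: "x \<in> space (Pi\<^sub>M I M)" for x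
    proof (cases "x \<in> Pi\<^sub>E I A")
      case True
      then have "(\<Prod>i\<in>I. indicator (A i) (x i) :: ennreal) = 1"
        using PiE_mem[OF True] by (intro prod.neutral ballI) simp
      then show ?thesis using True by simp
    next
      case False
      then obtain i where "i \<in> I" "x i \<notin> A i"
        using xM unfolding space_PiM PiE_iff by blast
      then have "(\<Prod>i\<in>I. indicator (A i) (x i) :: ennreal) = 0"
        using \<open>finite I\<close> by (intro prod_zero bexI[of _ i]) auto
      then show ?thesis using False by simp
    qed
    have "emeasure (density (Pi\<^sub>M I M) (\<lambda>x. \<Prod>i\<in>I. f i (x i))) (Pi\<^sub>E I A)
        = (\<integral>\<^sup>+ x. (\<Prod>i\<in>I. f i (x i) * indicator (A i) (x i)) \<partial>Pi\<^sub>M I M)"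
      by (subst emeasure_density[OF meas PA], intro nn_integral_cong) (simp add: ind prod.distrib)
    also have "\<dots> = (\<Prod>i\<in>I. \<integral>\<^sup>+ x. f i x * indicator (A i) x \<partial>M i)"
      using \<open>finite I\<close> A' by (intro M.product_nn_integral_prod) auto
    also have "\<dots> = (\<Prod>i\<in>I. emeasure (density (M i) (f i)) (A i))"
      using A' by (intro prod.cong) (auto simp: emeasure_density)
    finally show "emeasure (density (Pi\<^sub>M I M) (\<lambda>x. \<Prod>i\<in>I. f i (x i))) (Pi\<^sub>E I A)
        = (\<Prod>i\<in>I. emeasure (density (M i) (f i)) (A i))" .
  qed (use \<open>finite I\<close> sets_eq in auto)
  then show ?thesis ..
qed

lemma integrable_PiM_component:
  fixes g :: "'a \<Rightarrow> real"
  assumes "\<And>i. i \<in> I \<Longrightarrow> prob_space (M i)" "i \<in> I" "integrable (M i) g"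
  shows "integrable (Pi\<^sub>M I M) (\<lambda>x. g (x i))" "(\<integral>x. g (x i) \<partial>Pi\<^sub>M I M) = (\<integral>x. g x \<partial>M i)"
proof -
  have d: "distr (Pi\<^sub>M I M) (M i) (\<lambda>x. x i) = M i"
    by (rule distr_PiM_component) (use assms in auto)
  have m: "(\<lambda>x. x i) \<in> measurable (Pi\<^sub>M I M) (M i)" using assms by (intro measurable_component_singleton)
  show "integrable (Pi\<^sub>M I M) (\<lambda>x. g (x i))"
    using integrable_distr[OF m, unfolded d, OF assms(3)] .
  have "(\<integral>x. g x \<partial>M i) = (\<integral>x. g x \<partial>distr (Pi\<^sub>M I M) (M i) (\<lambda>x. x i))" by (simp add: d)
  also have "\<dots> = (\<integral>x. g (x i) \<partial>Pi\<^sub>M I M)"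
    using assms(3) by (subst integral_distr[OF m]) auto
  finally show "(\<integral>x. g (x i) \<partial>Pi\<^sub>M I M) = (\<integral>x. g x \<partial>M i)" ..
qed

lemma integrable_mult_of_squares:
  fixes f g :: "'a \<Rightarrow> real"
  assumes "f \<in> borel_measurable M" "g \<in> borel_measurable M"
    "integrable M (\<lambda>x. (f x)\<^sup>2)" "integrable M (\<lambda>x. (g x)\<^sup>2)"
  shows "integrable M (\<lambda>x. f x * g x)"
proof (rule Bochner_Integration.integrable_bound[where f="\<lambda>x. (f x)\<^sup>2 + (g x)\<^sup>2"])
  have "\<bar>a * b\<bar> \<le> a\<^sup>2 + b\<^sup>2" for a b :: real
  proof -
    have "2 * \<bar>a\<bar> * \<bar>b\<bar> \<le> a\<^sup>2 + b\<^sup>2" using sum_squares_bound[of "\<bar>a\<bar>" "\<bar>b\<bar>"] by simp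
    moreover have "0 \<le> \<bar>a\<bar> * \<bar>b\<bar>" by simp
    ultimately show ?thesis unfolding abs_mult by linarith
  qed
  then show "AE x in M. norm (f x * g x) \<le> norm ((f x)\<^sup>2 + (g x)\<^sup>2)" by auto
qed (use assms in auto)

text \<open>The function \<open>c \<circ> E\<close> is the conditional expectation of \<open>S\<close> given the discrete variable \<open>E\<close>.\<close>

lemma cond_exp_discrete:
  fixes E :: "'a \<Rightarrow> 'b::countable" and S :: "'a \<Rightarrow> real"
  assumes "prob_space P" and E[measurable]: "E \<in> measurable P (count_space UNIV)"
    and S[measurable]: "S \<in> borel_measurable P" and S2: "integrable P (\<lambda>x. (S x)\<^sup>2)"
  obtains c :: "'b \<Rightarrow> real" where "integrable P (\<lambda>x. (c (E x))\<^sup>2)"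
    and "\<And>h. integrable P (\<lambda>x. h (E x) * S x) \<Longrightarrow>
          integrable P (\<lambda>x. h (E x) * c (E x)) \<and> (\<integral>x. h (E x) * c (E x) \<partial>P) = (\<integral>x. h (E x) * S x \<partial>P)"
proof -
  interpret prob_space P by fact
  define F where "F = vimage_algebra (space P) E (count_space UNIV)"
  have sub: "subalgebra P F"
    unfolding subalgebra_def F_def
    by (auto simp: sets_vimage_algebra2 intro!: measurable_sets[OF E])
  interpret finite_measure_subalgebra P F by standard (use sub in auto)
  have iS: "integrable P S" by (rule square_integrable_imp_integrable[OF S S2])
  define g where "g = real_cond_exp P F S"
  have g[measurable]: "g \<in> borel_measurable F" "g \<in> borel_measurable P"
    unfolding g_def by auto
  have EF: "E \<in> measurable F (count_space UNIV)"
    unfolding F_def by (rule measurable_vimage_algebra1) auto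
  \<comment> \<open>\<open>g\<close> is measurable for the sigma-algebra generated by
    \<open>E\<close>, so its level set through \<open>x\<close> is the preimage of a set of messages
    and contains the whole fibre of \<open>x\<close>.\<close>
  have const: "g x = g y" if "x \<in> space P" "y \<in> space P" "E x = E y" for x y
  proof -
    have "g -` {g x} \<inter> space F \<in> sets F" by (intro measurable_sets[OF g(1)]) auto
    then obtain A where "g -` {g x} \<inter> space P = E -` A \<inter> space P"
      unfolding F_def by (auto simp: sets_vimage_algebra2)
    note A = this
    have "x \<in> g -` {g x} \<inter> space P" using that by simp
    then have "x \<in> E -` A" unfolding A by simp
    then have "y \<in> E -` A \<inter> space P" using that by simp
    then show ?thesis unfolding A[symmetric] by simp
  qed
  define c where "c y = g (SOME x. x \<in> space P \<and> E x = y)" for y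
  have cg: "c (E x) = g x" if x: "x \<in> space P" for x
  proof -
    have "(SOME z. z \<in> space P \<and> E z = E x) \<in> space P \<and> E (SOME z. z \<in> space P \<and> E z = E x) = E x"
      by (rule someI[of "\<lambda>z. z \<in> space P \<and> E z = E x" x]) (use x in auto)
    then show ?thesis unfolding c_def using const x by metis
  qed
  have sq: "AE x in P. (g x)\<^sup>2 \<le> real_cond_exp P F (\<lambda>x. (S x)\<^sup>2) x"
    unfolding g_def
    by (rule real_cond_exp_jensens_inequality(2)[where I=UNIV and q="\<lambda>x. x\<^sup>2"])
       (use iS S2 convex_power2 in auto)
  have "integrable P (\<lambda>x. (g x)\<^sup>2)"
    by (rule Bochner_Integration.integrable_bound[OF real_cond_exp_int(1)[OF S2]])
       (use sq in \<open>auto elim!: eventually_mono\<close>)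
  then have 1: "integrable P (\<lambda>x. (c (E x))\<^sup>2)"
    by (subst Bochner_Integration.integrable_cong[OF refl]) (auto simp: cg)
  have 2: "integrable P (\<lambda>x. h (E x) * c (E x)) \<and> (\<integral>x. h (E x) * c (E x) \<partial>P) = (\<integral>x. h (E x) * S x \<partial>P)"
    if "integrable P (\<lambda>x. h (E x) * S x)" for h :: "'b \<Rightarrow> real"
  proof -
    have hF: "(\<lambda>x. h (E x)) \<in> borel_measurable F" using EF by measurable
    have "integrable P (\<lambda>x. h (E x) * g x)" "(\<integral>x. h (E x) * g x \<partial>P) = (\<integral>x. h (E x) * S x \<partial>P)"
      unfolding g_def using real_cond_exp_intg[OF that hF S] by auto
    moreover have "integrable P (\<lambda>x. h (E x) * c (E x)) = integrable P (\<lambda>x. h (E x) * g x)"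
      by (intro Bochner_Integration.integrable_cong) (auto simp: cg)
    moreover have "(\<integral>x. h (E x) * c (E x) \<partial>P) = (\<integral>x. h (E x) * g x \<partial>P)"
      by (intro Bochner_Integration.integral_cong) (auto simp: cg)
    ultimately show ?thesis by simp
  qed
  show thesis using that[OF 1 2] .
qed

text \<open>The proof applies \<open>1 + x \<le> exp x\<close> to the tilted exponent \<open>Z\<close> below, whose exponential moment is at
  most \<open>1\<close>: for each fixed message the sub-Gaussian bound holds, and the weights \<open>r\<close> pay for the union over
  all messages.\<close>

lemma level_one_inequality:
  fixes E :: "'a \<Rightarrow> 'b::countable" and S :: "'k \<Rightarrow> 'a \<Rightarrow> real" and c :: "'k \<Rightarrow> 'b \<Rightarrow> real"
  assumes "prob_space P" and E[measurable]: "E \<in> measurable P (count_space UNIV)"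
    and S[measurable]: "\<And>k. k \<in> K \<Longrightarrow> S k \<in> borel_measurable P" and "finite K" and "\<epsilon> > 0"
    and c2: "\<And>k. k \<in> K \<Longrightarrow> integrable P (\<lambda>x. (c k (E x))\<^sup>2)"
    and cS: "\<And>k. k \<in> K \<Longrightarrow> integrable P (\<lambda>x. c k (E x) * S k x)"
    and eq: "\<And>k. k \<in> K \<Longrightarrow> (\<integral>x. c k (E x) * S k x \<partial>P) = (\<integral>x. (c k (E x))\<^sup>2 \<partial>P)"
    and mgf: "\<And>v. (\<integral>\<^sup>+x. ennreal (exp (\<Sum>k\<in>K. v k * S k x)) \<partial>P) \<le> ennreal (exp (\<epsilon> / 2 * (\<Sum>k\<in>K. (v k)\<^sup>2)))"
    and r: "\<And>y. r y > 0" "(\<integral>\<^sup>+y. ennreal (r y) \<partial>count_space UNIV) \<le> 1"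
    and ir: "integrable P (\<lambda>x. ln (r (E x)))"
  shows "(\<Sum>k\<in>K. \<integral>x. (c k (E x))\<^sup>2 \<partial>P) \<le> 2 * \<epsilon> * (\<integral>x. - ln (r (E x)) \<partial>P)"
proof -
  interpret prob_space P by fact
  \<comment> \<open>The factor \<open>1 / \<epsilon>\<close> is the optimal tilt:
    \<open>v = c / \<epsilon>\<close> maximises \<open>v * c - \<epsilon> / 2 * v^2\<close>, with
    value \<open>c^2 / (2 * \<epsilon>)\<close>.\<close>
  define W where "W y x = (\<Sum>k\<in>K. c k y / \<epsilon> * S k x) - (\<Sum>k\<in>K. (c k y)\<^sup>2 / (2 * \<epsilon>)) + ln (r y)" for y x
  define Z where "Z x = W (E x) x" for x
  have W[measurable]: "W y \<in> borel_measurable P" for y unfolding W_def by measurable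
  have iZ: "integrable P Z"
  proof -
    have "integrable P (\<lambda>x. (\<Sum>k\<in>K. (c k (E x) * S k x) / \<epsilon>) - (\<Sum>k\<in>K. (c k (E x))\<^sup>2 / (2 * \<epsilon>)) + ln (r (E x)))"
      by (intro Bochner_Integration.integrable_add Bochner_Integration.integrable_diff
          Bochner_Integration.integrable_sum integrable_divide_zero cS c2 ir)
    then show ?thesis unfolding Z_def W_def by simp
  qed
  \<comment> \<open>By \<open>eq\<close> the linear term contributes
    \<open>c^2 / \<epsilon>\<close>, of which half survives the quadratic correction.\<close>
  have intZ: "(\<integral>x. Z x \<partial>P) = (\<Sum>k\<in>K. \<integral>x. (c k (E x))\<^sup>2 \<partial>P) / (2 * \<epsilon>) + (\<integral>x. ln (r (E x)) \<partial>P)"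
  proof -
    have "(\<integral>x. Z x \<partial>P) = (\<integral>x. (\<Sum>k\<in>K. (c k (E x) * S k x) / \<epsilon>) - (\<Sum>k\<in>K. (c k (E x))\<^sup>2 / (2 * \<epsilon>)) + ln (r (E x)) \<partial>P)"
      unfolding Z_def W_def by simp
    also have "\<dots> = (\<integral>x. (\<Sum>k\<in>K. (c k (E x) * S k x) / \<epsilon>) - (\<Sum>k\<in>K. (c k (E x))\<^sup>2 / (2 * \<epsilon>)) \<partial>P) + (\<integral>x. ln (r (E x)) \<partial>P)"
      by (intro Bochner_Integration.integral_add Bochner_Integration.integrable_diff
          Bochner_Integration.integrable_sum integrable_divide_zero cS c2 ir)
    also have "(\<integral>x. (\<Sum>k\<in>K. (c k (E x) * S k x) / \<epsilon>) - (\<Sum>k\<in>K. (c k (E x))\<^sup>2 / (2 * \<epsilon>)) \<partial>P)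
       = (\<integral>x. (\<Sum>k\<in>K. (c k (E x) * S k x) / \<epsilon>) \<partial>P) - (\<integral>x. (\<Sum>k\<in>K. (c k (E x))\<^sup>2 / (2 * \<epsilon>)) \<partial>P)"
      by (intro Bochner_Integration.integral_diff
          Bochner_Integration.integrable_sum integrable_divide_zero cS c2 ir)
    also have "(\<integral>x. (\<Sum>k\<in>K. (c k (E x) * S k x) / \<epsilon>) \<partial>P) = (\<Sum>k\<in>K. (\<integral>x. (c k (E x))\<^sup>2 \<partial>P) / \<epsilon>)"
      by (subst Bochner_Integration.integral_sum) (auto intro!: cS sum.cong simp: eq)
    also have "(\<integral>x. (\<Sum>k\<in>K. (c k (E x))\<^sup>2 / (2 * \<epsilon>)) \<partial>P) = (\<Sum>k\<in>K. (\<integral>x. (c k (E x))\<^sup>2 \<partial>P) / (2*\<epsilon>))"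
      by (subst Bochner_Integration.integral_sum) (auto intro!: c2 sum.cong)
    finally show ?thesis using \<open>\<epsilon> > 0\<close>
      by (simp add: sum_divide_distrib[symmetric] field_simps)
  qed
  have sigc: "sigma_finite_measure (count_space (UNIV::'b set))"
    by (rule sigma_finite_measure_count_space_countable) auto
  interpret Q: pair_sigma_finite "count_space (UNIV::'b set)" P
    using sigc by (simp add: pair_sigma_finite.intro sigma_finite_measure_axioms)
  have m2: "(\<lambda>(y, x). ennreal (exp (W y x))) \<in> borel_measurable (count_space UNIV \<Otimes>\<^sub>M P)"
    by (rule measurable_pair_measure_countable1) auto
  \<comment> \<open>In \<open>Z\<close> the tilt depends on the message that is sent. Summing over
    all messages makes each tilt deterministic, as \<open>mgf\<close> requires.\<close>
  have "(\<integral>\<^sup>+x. ennreal (exp (Z x)) \<partial>P) \<le> (\<integral>\<^sup>+x. (\<integral>\<^sup>+y. ennreal (exp (W y x)) \<partial>count_space UNIV) \<partial>P)"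
  proof (rule nn_integral_mono)
    fix x
    have "ennreal (exp (Z x)) = (\<integral>\<^sup>+y. ennreal (exp (W y x)) * indicator {E x} y \<partial>count_space UNIV)"
      by (simp add: Z_def)
    also have "\<dots> \<le> (\<integral>\<^sup>+y. ennreal (exp (W y x)) \<partial>count_space UNIV)"
      by (intro nn_integral_mono) (auto simp: indicator_def)
    finally show "ennreal (exp (Z x)) \<le> (\<integral>\<^sup>+y. ennreal (exp (W y x)) \<partial>count_space UNIV)" .
  qed
  also have "\<dots> = (\<integral>\<^sup>+y. (\<integral>\<^sup>+x. ennreal (exp (W y x)) \<partial>P) \<partial>count_space UNIV)"
    using Q.Fubini'[OF m2] by simp
  also have "\<dots> \<le> (\<integral>\<^sup>+y. ennreal (r y) \<partial>count_space UNIV)"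
  proof (rule nn_integral_mono)
    fix y
    define b where "b = (\<Sum>k\<in>K. (c k y)\<^sup>2 / (2 * \<epsilon>))"
    have me: "(\<lambda>x. ennreal (exp (\<Sum>k\<in>K. (c k y / \<epsilon>) * S k x))) \<in> borel_measurable P"
      by measurable
    have "(\<integral>\<^sup>+x. ennreal (exp (W y x)) \<partial>P)
        = (\<integral>\<^sup>+x. ennreal (exp (- b) * r y) * ennreal (exp (\<Sum>k\<in>K. (c k y / \<epsilon>) * S k x)) \<partial>P)"
    proof (rule nn_integral_cong)
      fix x
      have "exp (W y x) = exp (- b) * r y * exp (\<Sum>k\<in>K. (c k y / \<epsilon>) * S k x)"
        unfolding W_def b_def[symmetric] using r(1)[of y]
        by (simp only: exp_add exp_diff exp_minus exp_ln divide_inverse mult_ac)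
      then show "ennreal (exp (W y x)) = ennreal (exp (- b) * r y) * ennreal (exp (\<Sum>k\<in>K. (c k y / \<epsilon>) * S k x))"
        using r(1)[of y] by (simp only:) (rule ennreal_mult, auto)
    qed
    also have "\<dots> = ennreal (exp (- b) * r y) * (\<integral>\<^sup>+x. ennreal (exp (\<Sum>k\<in>K. (c k y / \<epsilon>) * S k x)) \<partial>P)"
      by (rule nn_integral_cmult[OF me])
    also have "\<dots> \<le> ennreal (exp (- b) * r y) * ennreal (exp (\<epsilon> / 2 * (\<Sum>k\<in>K. (c k y / \<epsilon>)\<^sup>2)))"
      by (rule mult_left_mono[OF mgf[of "\<lambda>k. c k y / \<epsilon>"]]) simp
    also have "\<epsilon> / 2 * (\<Sum>k\<in>K. (c k y / \<epsilon>)\<^sup>2) = b"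
      unfolding b_def sum_distrib_left using \<open>\<epsilon> > 0\<close>
      by (intro sum.cong) (auto simp: power2_eq_square)
    also have "ennreal (exp (- b) * r y) * ennreal (exp b) = ennreal (r y)"
      using r(1)[of y] by (subst ennreal_mult'[symmetric]) (auto simp: exp_minus)
    finally show "(\<integral>\<^sup>+x. ennreal (exp (W y x)) \<partial>P) \<le> ennreal (r y)" .
  qed
  also have "\<dots> \<le> 1" by (rule r)
  finally have le1: "(\<integral>\<^sup>+x. ennreal (exp (Z x)) \<partial>P) \<le> 1" .
  have Zm[measurable]: "Z \<in> borel_measurable P" using iZ by auto
  have ie: "integrable P (\<lambda>x. exp (Z x))"
    by (rule integrableI_nonneg) (use le1 in \<open>auto intro: le_less_trans\<close>)
  have "ennreal (\<integral>x. exp (Z x) \<partial>P) \<le> ennreal 1"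
    using le1 by (subst nn_integral_eq_integral[OF ie, symmetric]) auto
  then have "(\<integral>x. exp (Z x) \<partial>P) \<le> 1" by simp
  moreover have "(\<integral>x. Z x \<partial>P) + 1 = (\<integral>x. 1 + Z x \<partial>P)"
    using iZ by (simp add: prob_space)
  moreover have "(\<integral>x. 1 + Z x \<partial>P) \<le> (\<integral>x. exp (Z x) \<partial>P)"
    using iZ ie by (intro integral_mono) auto
  ultimately have "(\<integral>x. Z x \<partial>P) \<le> 0" by simp
  with intZ have "(\<Sum>k\<in>K. \<integral>x. (c k (E x))\<^sup>2 \<partial>P) / (2 * \<epsilon>) \<le> (\<integral>x. - ln (r (E x)) \<partial>P)"
    by simp
  then show ?thesis using \<open>\<epsilon> > 0\<close> by (simp add: pos_divide_le_eq mult_ac)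
qed

section \<open>Independent machines: correlation of scores with functions of the messages\<close>

lemma integral_square_sum_indep:
  fixes g :: "'i \<Rightarrow> 'a \<Rightarrow> real"
  assumes M: "\<And>i. prob_space (M i)" and "finite I"
    and g: "\<And>i. i \<in> I \<Longrightarrow> g i \<in> borel_measurable (M i)"
    and g2: "\<And>i. i \<in> I \<Longrightarrow> integrable (M i) (\<lambda>x. (g i x)\<^sup>2)"
    and g0: "\<And>i. i \<in> I \<Longrightarrow> (\<integral>x. g i x \<partial>M i) = 0"
  shows "integrable (Pi\<^sub>M I M) (\<lambda>x. (\<Sum>i\<in>I. g i (x i))\<^sup>2)"
    and "(\<integral>x. (\<Sum>i\<in>I. g i (x i))\<^sup>2 \<partial>Pi\<^sub>M I M) = (\<Sum>i\<in>I. \<integral>x. (g i x)\<^sup>2 \<partial>M i)"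
proof -
  interpret product_prob_space M I
    by (rule product_prob_spaceI[OF M])
  have ig: "integrable (M i) (g i)" if "i \<in> I" for i
    using finite_measure.square_integrable_imp_integrable[OF _ g[OF that] g2[OF that]] M
    by (simp add: prob_space.finite_measure)
  have pr: "integrable (Pi\<^sub>M I M) (\<lambda>x. g i (x i) * g j (x j)) \<and>
     (\<integral>x. g i (x i) * g j (x j) \<partial>Pi\<^sub>M I M) = (if i = j then \<integral>x. (g i x)\<^sup>2 \<partial>M i else 0)"
    if ij: "i \<in> I" "j \<in> I" for i j
  proof (cases "i = j")
    case True
    then show ?thesis using integrable_PiM_component[of I M i "\<lambda>x. (g i x)\<^sup>2"] M ij g2
      by (simp add: power2_eq_square)
  next
    case False
    \<comment> \<open>Padding with the constant 1 writes the cross term as a product over all of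
      \<open>I\<close>; it factorises, and the factor at \<open>i\<close> has mean zero.\<close>
    define h where "h l = (if l = i then g i else if l = j then g j else (\<lambda>_. 1))" for l
    have hl: "integrable (M l) (h l)" if "l \<in> I" for l
      using ig ij prob_space.finite_measure[OF M, of l] by (auto simp: h_def finite_measure.integrable_const)
    have *: "(\<Prod>l\<in>I. h l (x l)) = g i (x i) * g j (x j)" for x
    proof -
      have "(\<Prod>l\<in>I. h l (x l)) = h i (x i) * (h j (x j) * (\<Prod>l\<in>I - {i} - {j}. h l (x l)))"
        using ij False \<open>finite I\<close>
        by (subst prod.remove[of I i], simp, simp, subst prod.remove[of "I - {i}" j]) auto
      also have "(\<Prod>l\<in>I - {i} - {j}. h l (x l)) = 1"
        by (intro prod.neutral) (auto simp: h_def)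
      finally show ?thesis using False by (simp add: h_def)
    qed
    have "integral\<^sup>L (M i) (h i) = 0" using g0 ij by (simp add: h_def)
    then have "(\<Prod>l\<in>I. integral\<^sup>L (M l) (h l)) = 0"
      using ij \<open>finite I\<close> by (intro prod_zero bexI[of _ i]) auto
    then show ?thesis
      using product_integrable_prod[of I h] product_integral_prod[of I h] hl \<open>finite I\<close> False
      unfolding * by simp
  qed
  have sq: "(\<Sum>i\<in>I. g i (x i))\<^sup>2 = (\<Sum>i\<in>I. \<Sum>j\<in>I. g i (x i) * g j (x j))" for x
    by (simp add: power2_eq_square sum_product)
  show "integrable (Pi\<^sub>M I M) (\<lambda>x. (\<Sum>i\<in>I. g i (x i))\<^sup>2)"
    unfolding sq using pr by (intro Bochner_Integration.integrable_sum) auto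
  have "(\<integral>x. (\<Sum>i\<in>I. g i (x i))\<^sup>2 \<partial>Pi\<^sub>M I M) = (\<Sum>i\<in>I. \<Sum>j\<in>I. \<integral>x. g i (x i) * g j (x j) \<partial>Pi\<^sub>M I M)"
    unfolding sq using pr
    by (subst Bochner_Integration.integral_sum, intro Bochner_Integration.integrable_sum, simp,
        intro sum.cong refl Bochner_Integration.integral_sum) auto
  also have "\<dots> = (\<Sum>i\<in>I. \<Sum>j\<in>I. if i = j then \<integral>x. (g i x)\<^sup>2 \<partial>M i else 0)"
    using pr by (intro sum.cong) auto
  also have "\<dots> = (\<Sum>i\<in>I. \<integral>x. (g i x)\<^sup>2 \<partial>M i)" using \<open>finite I\<close> by (simp add: sum.delta)
  finally show "(\<integral>x. (\<Sum>i\<in>I. g i (x i))\<^sup>2 \<partial>Pi\<^sub>M I M) = (\<Sum>i\<in>I. \<integral>x. (g i x)\<^sup>2 \<partial>M i)" .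
qed

text \<open>With the data of the other machines frozen, \<open>F\<close> depends on the data of
  machine \<open>i\<close> only through its message, so \<open>S\<close> may be replaced by its
  conditional expectation given that message. Fubini then integrates over the other
  machines.\<close>

lemma integral_message_cond_exp:
  fixes E :: "'i \<Rightarrow> 'a \<Rightarrow> 'b::countable" and S :: "'a \<Rightarrow> real" and F :: "('i \<Rightarrow> 'a) \<Rightarrow> real"
  assumes M: "\<And>i. prob_space (M i)" and "finite I" and i: "i \<in> I"
    and F: "F \<in> borel_measurable (Pi\<^sub>M I M)" and Fb: "\<And>x. \<bar>F x\<bar> \<le> b"
    and dep: "\<And>x y. x \<in> space (Pi\<^sub>M I M) \<Longrightarrow> y \<in> space (Pi\<^sub>M I M) \<Longrightarrow>
                 (\<And>i. i \<in> I \<Longrightarrow> E i (x i) = E i (y i)) \<Longrightarrow> F x = F y"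
    and E[measurable]: "E i \<in> measurable (M i) (count_space UNIV)"
    and iS: "integrable (M i) S" and ic: "integrable (M i) (\<lambda>x. c (E i x))"
    and c: "\<And>h. integrable (M i) (\<lambda>x. h (E i x) * S x) \<Longrightarrow>
              (\<integral>x. h (E i x) * c (E i x) \<partial>M i) = (\<integral>x. h (E i x) * S x \<partial>M i)"
  shows "(\<integral>x. F x * S (x i) \<partial>Pi\<^sub>M I M) = (\<integral>x. F x * c (E i (x i)) \<partial>Pi\<^sub>M I M)"
proof -
  interpret product_prob_space M I
    by (rule product_prob_spaceI[OF M])
  define J where "J = I - {i}"
  have IJ: "I = insert i J" "finite J" "i \<notin> J" using i \<open>finite I\<close> by (auto simp: J_def)
  have bd: "integrable (Pi\<^sub>M I M) (\<lambda>x. F x * T (x i))" if T: "integrable (M i) T" for T :: "'a \<Rightarrow> real"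
  proof (rule Bochner_Integration.integrable_bound)
    show "integrable (Pi\<^sub>M I M) (\<lambda>x. b * \<bar>T (x i)\<bar>)"
      using integrable_PiM_component(1)[of I M i "\<lambda>x. b * \<bar>T x\<bar>"] M i T by simp
    show "(\<lambda>x. F x * T (x i)) \<in> borel_measurable (Pi\<^sub>M I M)"
      using F integrable_PiM_component(1)[of I M i T] M i T by auto
    show "AE x in Pi\<^sub>M I M. norm (F x * T (x i)) \<le> norm (b * \<bar>T (x i)\<bar>)"
    proof (rule AE_I2)
      fix x
      have "\<bar>F x\<bar> * \<bar>T (x i)\<bar> \<le> \<bar>b\<bar> * \<bar>T (x i)\<bar>"
        by (intro mult_right_mono order_trans[OF Fb abs_ge_self]) auto
      then show "norm (F x * T (x i)) \<le> norm (b * \<bar>T (x i)\<bar>)" by (simp add: abs_mult) 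
    qed
  qed
  have inner: "(\<integral>y. F (x(i := y)) * S ((x(i := y)) i) \<partial>M i) = (\<integral>y. F (x(i := y)) * c (E i ((x(i := y)) i)) \<partial>M i)"
    if x: "x \<in> space (Pi\<^sub>M J M)" for x
  proof -
    have xy: "x(i := y) \<in> space (Pi\<^sub>M I M)" if "y \<in> space (M i)" for y
      using x that by (auto simp: IJ space_PiM PiE_def extensional_def)
    \<comment> \<open>\<open>F\<close> as a function of the message of machine \<open>i\<close>,
      evaluated at some data point that produces this message.\<close>
    define H where "H z = F (x(i := (SOME y. y \<in> space (M i) \<and> E i y = z)))" for z
    have H: "F (x(i := y)) = H (E i y)" if y: "y \<in> space (M i)" for y
    proof -
      have "(SOME z. z \<in> space (M i) \<and> E i z = E i y) \<in> space (M i) \<and> E i (SOME z. z \<in> space (M i) \<and> E i z = E i y) = E i y"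
        by (rule someI[of "\<lambda>z. z \<in> space (M i) \<and> E i z = E i y" y]) (use y in auto)
      then show ?thesis unfolding H_def by (intro dep xy y) auto
    qed
    have Hm: "(\<lambda>y. H (E i y)) \<in> borel_measurable (M i)" by measurable
    have iH: "integrable (M i) (\<lambda>y. H (E i y) * S y)"
      by (rule Bochner_Integration.integrable_bound[of _ "\<lambda>y. b * S y"])
         (use iS Hm Fb in \<open>auto simp: H_def abs_mult intro!: mult_right_mono order_trans[OF Fb abs_ge_self]\<close>)
    have "(\<integral>y. F (x(i := y)) * S ((x(i := y)) i) \<partial>M i) = (\<integral>y. H (E i y) * S y \<partial>M i)"
      by (intro Bochner_Integration.integral_cong) (auto simp: H)
    also have "\<dots> = (\<integral>y. H (E i y) * c (E i y) \<partial>M i)" using c[OF iH] by simp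
    also have "\<dots> = (\<integral>y. F (x(i := y)) * c (E i ((x(i := y)) i)) \<partial>M i)"
      by (intro Bochner_Integration.integral_cong) (auto simp: H)
    finally show ?thesis .
  qed
  have "(\<integral>x. F x * S (x i) \<partial>Pi\<^sub>M I M) = (\<integral>x. (\<integral>y. F (x(i := y)) * S ((x(i := y)) i) \<partial>M i) \<partial>Pi\<^sub>M J M)"
    using product_integral_insert[OF IJ(2,3), of "\<lambda>x. F x * S (x i)"] bd[OF iS] by (simp only: IJ(1))
  also have "\<dots> = (\<integral>x. (\<integral>y. F (x(i := y)) * c (E i ((x(i := y)) i)) \<partial>M i) \<partial>Pi\<^sub>M J M)"
    by (intro Bochner_Integration.integral_cong refl inner)
  also have "\<dots> = (\<integral>x. F x * c (E i (x i)) \<partial>Pi\<^sub>M I M)"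
    using product_integral_insert[OF IJ(2,3), of "\<lambda>x. F x * c (E i (x i))"] bd[OF ic] by (simp only: IJ(1))
  finally show ?thesis .
qed

lemma mult_le_weighted_squares:
  fixes x y :: real
  assumes "\<alpha> > 0"
  shows "x * y \<le> \<alpha> / 2 * x\<^sup>2 + y\<^sup>2 / (2 * \<alpha>)"
proof -
  have "0 \<le> (\<alpha> * x - y)\<^sup>2 / (2 * \<alpha>)" using assms by simp
  also have "(\<alpha> * x - y)\<^sup>2 / (2 * \<alpha>) = \<alpha> / 2 * x\<^sup>2 + y\<^sup>2 / (2 * \<alpha>) - x * y"
    using assms by (simp add: power2_eq_square field_simps)
  finally show ?thesis by simp
qed

text \<open>Projection on the messages lowers the second moment of each score to the information
  that its message carries. The projected scores are still independent and centred, so these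
  informations add up over the machines; Young's inequality with parameter \<open>\<alpha>\<close>
  does the rest.\<close>

lemma message_correlation_bound:
  fixes E :: "'i \<Rightarrow> 'a \<Rightarrow> 'b::countable" and S :: "'i \<Rightarrow> 'a \<Rightarrow> real" and F :: "('i \<Rightarrow> 'a) \<Rightarrow> real"
  assumes M: "\<And>i. prob_space (M i)" and I: "finite I"
    and F: "F \<in> borel_measurable (Pi\<^sub>M I M)" and Fb: "\<And>x. \<bar>F x\<bar> \<le> b"
    and dep: "\<And>x y. x \<in> space (Pi\<^sub>M I M) \<Longrightarrow> y \<in> space (Pi\<^sub>M I M) \<Longrightarrow>
                 (\<And>i. i \<in> I \<Longrightarrow> E i (x i) = E i (y i)) \<Longrightarrow> F x = F y"
    and E[measurable]: "\<And>i. i \<in> I \<Longrightarrow> E i \<in> measurable (M i) (count_space UNIV)"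
    and S: "\<And>i. i \<in> I \<Longrightarrow> integrable (M i) (S i)" and S0: "\<And>i. i \<in> I \<Longrightarrow> (\<integral>x. S i x \<partial>M i) = 0"
    and c2: "\<And>i. i \<in> I \<Longrightarrow> integrable (M i) (\<lambda>x. (c i (E i x))\<^sup>2)"
    and c: "\<And>i h. i \<in> I \<Longrightarrow> integrable (M i) (\<lambda>x. h (E i x) * S i x) \<Longrightarrow>
              (\<integral>x. h (E i x) * c i (E i x) \<partial>M i) = (\<integral>x. h (E i x) * S i x \<partial>M i)"
    and "\<alpha> > 0"
  shows "(\<integral>x. F x * (\<Sum>i\<in>I. S i (x i)) \<partial>Pi\<^sub>M I M)
     \<le> \<alpha> / 2 * (\<integral>x. (F x)\<^sup>2 \<partial>Pi\<^sub>M I M) + (\<Sum>i\<in>I. \<integral>x. (c i (E i x))\<^sup>2 \<partial>M i) / (2 * \<alpha>)"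
proof -
  interpret product_prob_space M I
    by (rule product_prob_spaceI[OF M])
  interpret P: prob_space "Pi\<^sub>M I M" by (rule prob_space_PiM) (use M in auto)
  have cm: "(\<lambda>x. c i (E i x)) \<in> borel_measurable (M i)" if "i \<in> I" for i
    using E[OF that] by measurable
  have ic: "integrable (M i) (\<lambda>x. c i (E i x))" if "i \<in> I" for i
    using finite_measure.square_integrable_imp_integrable[OF _ cm[OF that] c2[OF that]] M
    by (simp add: prob_space.finite_measure)
  have bd: "integrable (Pi\<^sub>M I M) (\<lambda>x. F x * T (x i))" if "i \<in> I" and T: "integrable (M i) T" for T :: "'a \<Rightarrow> real" and i
  proof (rule Bochner_Integration.integrable_bound)
    show "integrable (Pi\<^sub>M I M) (\<lambda>x. b * \<bar>T (x i)\<bar>)"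
      using integrable_PiM_component(1)[of I M i "\<lambda>x. b * \<bar>T x\<bar>"] M that by simp
    show "(\<lambda>x. F x * T (x i)) \<in> borel_measurable (Pi\<^sub>M I M)"
      using F integrable_PiM_component(1)[of I M i T] M that by auto
    show "AE x in Pi\<^sub>M I M. norm (F x * T (x i)) \<le> norm (b * \<bar>T (x i)\<bar>)"
    proof (rule AE_I2)
      fix x
      have "\<bar>F x\<bar> * \<bar>T (x i)\<bar> \<le> \<bar>b\<bar> * \<bar>T (x i)\<bar>"
        by (intro mult_right_mono order_trans[OF Fb abs_ge_self]) auto
      then show "norm (F x * T (x i)) \<le> norm (b * \<bar>T (x i)\<bar>)" by (simp add: abs_mult) 
    qed
  qed
  have c0: "(\<integral>x. c i (E i x) \<partial>M i) = 0" if "i \<in> I" for i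
    using c[OF that, of "\<lambda>_. 1"] S[OF that] S0[OF that] by simp
  note orth = integral_square_sum_indep[where g="\<lambda>i x. c i (E i x)", OF M I cm c2 c0]
  have iF2: "integrable (Pi\<^sub>M I M) (\<lambda>x. (F x)\<^sup>2)"
    by (rule P.integrable_const_bound[of _ "b\<^sup>2"])
       (use F Fb in \<open>auto intro!: power_mono simp: abs_le_square_iff[symmetric] order_trans[OF Fb abs_ge_self]\<close>)
  have "(\<integral>x. F x * (\<Sum>i\<in>I. S i (x i)) \<partial>Pi\<^sub>M I M) = (\<Sum>i\<in>I. \<integral>x. F x * S i (x i) \<partial>Pi\<^sub>M I M)"
    unfolding sum_distrib_left by (rule Bochner_Integration.integral_sum) (intro bd S)
  also have "\<dots> = (\<Sum>i\<in>I. \<integral>x. F x * c i (E i (x i)) \<partial>Pi\<^sub>M I M)"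
    by (intro sum.cong refl integral_message_cond_exp[OF M I _ F Fb dep E S ic c])
  also have "\<dots> = (\<integral>x. F x * (\<Sum>i\<in>I. c i (E i (x i))) \<partial>Pi\<^sub>M I M)"
    unfolding sum_distrib_left by (rule Bochner_Integration.integral_sum[symmetric]) (intro bd ic)
  also have "\<dots> \<le> (\<integral>x. \<alpha> / 2 * (F x)\<^sup>2 + (\<Sum>i\<in>I. c i (E i (x i)))\<^sup>2 / (2 * \<alpha>) \<partial>Pi\<^sub>M I M)"
  proof (rule integral_mono)
    show "integrable (Pi\<^sub>M I M) (\<lambda>x. F x * (\<Sum>i\<in>I. c i (E i (x i))))"
      unfolding sum_distrib_left by (intro Bochner_Integration.integrable_sum bd ic)
    show "integrable (Pi\<^sub>M I M) (\<lambda>x. \<alpha> / 2 * (F x)\<^sup>2 + (\<Sum>i\<in>I. c i (E i (x i)))\<^sup>2 / (2 * \<alpha>))"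
      using iF2 orth(1) by auto
  qed (rule mult_le_weighted_squares[OF \<open>\<alpha> > 0\<close>])
  also have "\<dots> = \<alpha> / 2 * (\<integral>x. (F x)\<^sup>2 \<partial>Pi\<^sub>M I M) + (\<Sum>i\<in>I. \<integral>x. (c i (E i x))\<^sup>2 \<partial>M i) / (2 * \<alpha>)"
    using iF2 orth by simp
  finally show ?thesis .
qed

section \<open>Samples as images of uniform and Gaussian vectors\<close>

abbreviation unif01 :: "real measure" where
  "unif01 \<equiv> uniform_measure lborel {0<..<1}"

abbreviation std_gauss :: "real measure" where
  "std_gauss \<equiv> density lborel (\<lambda>x. ennreal (std_normal_density x))"

lemma prob_space_unif01: "prob_space unif01"
  by (rule prob_space_uniform_measure) auto

lemma prob_space_std_gauss: "prob_space std_gauss"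
  by (rule prob_space_normal_density) simp

lemma std_gauss_integrals:
  shows "integrable std_gauss (\<lambda>x. x)" "(\<integral>x. x \<partial>std_gauss) = 0"
    "integrable std_gauss (\<lambda>x. x\<^sup>2)" "(\<integral>x. x\<^sup>2 \<partial>std_gauss) = 1"
  using integrable_std_normal_moment[of 1] integral_std_normal_moment_odd[of 0]
    integrable_std_normal_moment[of 2] integral_std_normal_moment_even[of 1]
  by (auto simp: integrable_density integral_density)

lemma std_gauss_mgf: "(\<integral>\<^sup>+x. ennreal (exp (c * x)) \<partial>std_gauss) = ennreal (exp (c\<^sup>2 / 2))"
proof -
  interpret G: prob_space "density lborel (normal_density c 1)"
    by (rule prob_space_normal_density) simp
  have eq: "std_normal_density x * exp (c * x) = exp (c\<^sup>2 / 2) * normal_density c 1 x" for x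
  proof -
    have "- x\<^sup>2 / 2 + c * x = c\<^sup>2 / 2 + - (x - c)\<^sup>2 / 2"
      by (simp add: power2_eq_square field_simps)
    then have "exp (- x\<^sup>2 / 2) * exp (c * x) = exp (c\<^sup>2 / 2) * exp (- (x - c)\<^sup>2 / 2)"
      by (simp only: exp_add[symmetric])
    then show ?thesis unfolding std_normal_density_def normal_density_def by simp
  qed
  have "(\<integral>\<^sup>+x. ennreal (exp (c * x)) \<partial>std_gauss) = (\<integral>\<^sup>+x. ennreal (std_normal_density x) * ennreal (exp (c * x)) \<partial>lborel)"
    by (rule nn_integral_density) auto
  also have "\<dots> = (\<integral>\<^sup>+x. ennreal (exp (c\<^sup>2 / 2)) * ennreal (normal_density c 1 x) \<partial>lborel)"
    by (intro nn_integral_cong) (simp only: ennreal_mult[symmetric] eq normal_density_nonneg exp_ge_zero)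
  also have "\<dots> = ennreal (exp (c\<^sup>2 / 2)) * (\<integral>\<^sup>+x. ennreal (normal_density c 1 x) \<partial>lborel)"
    by (rule nn_integral_cmult) auto
  also have "(\<integral>\<^sup>+x. ennreal (normal_density c 1 x) \<partial>lborel) = 1"
    using G.emeasure_space_1 by (simp add: emeasure_density)
  finally show ?thesis by simp
qed

section \<open>Linear forms in Gaussian noise\<close>

definition gauss_vec :: "nat \<Rightarrow> (nat \<Rightarrow> real) measure" where
  "gauss_vec q = (\<Pi>\<^sub>M l\<in>{..<q}. std_gauss)"

definition unif_vec :: "nat \<Rightarrow> (nat \<Rightarrow> real) measure" where
  "unif_vec q = (\<Pi>\<^sub>M l\<in>{..<q}. unif01)"

lemma prob_space_gauss_vec: "prob_space (gauss_vec q)"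
  unfolding gauss_vec_def by (intro prob_space_PiM prob_space_std_gauss)

lemma prob_space_unif_vec: "prob_space (unif_vec q)"
  unfolding unif_vec_def by (intro prob_space_PiM prob_space_unif01)

lemma sets_gauss_vec [measurable_cong, simp]: "sets (gauss_vec q) = sets (\<Pi>\<^sub>M l\<in>{..<q}. borel)"
  unfolding gauss_vec_def by (intro sets_PiM_cong) auto

lemma sets_unif_vec [measurable_cong, simp]: "sets (unif_vec q) = sets (\<Pi>\<^sub>M l\<in>{..<q}. borel)"
  unfolding unif_vec_def by (intro sets_PiM_cong) auto

lemma gauss_vec_mgf: "(\<integral>\<^sup>+e. ennreal (exp (\<Sum>l<q. c l * e l)) \<partial>gauss_vec q) = ennreal (exp ((\<Sum>l<q. (c l)\<^sup>2) / 2))"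
proof -
  interpret product_prob_space "\<lambda>_. std_gauss" "{..<q}"
    by (rule product_prob_spaceI[OF prob_space_std_gauss])
  have "(\<integral>\<^sup>+e. ennreal (exp (\<Sum>l<q. c l * e l)) \<partial>gauss_vec q) = (\<integral>\<^sup>+e. (\<Prod>l<q. ennreal (exp (c l * e l))) \<partial>gauss_vec q)"
    by (simp add: exp_sum prod_ennreal)
  also have "\<dots> = (\<Prod>l<q. \<integral>\<^sup>+e. ennreal (exp (c l * e)) \<partial>std_gauss)"
    unfolding gauss_vec_def by (intro product_nn_integral_prod) auto
  also have "\<dots> = ennreal (exp ((\<Sum>l<q. (c l)\<^sup>2) / 2))"
    by (simp add: std_gauss_mgf prod_ennreal exp_sum[symmetric] sum_divide_distrib)
  finally show ?thesis .
qed

lemma gauss_vec_moments: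
  shows "integrable (gauss_vec q) (\<lambda>e. \<Sum>l<q. c l * e l)" "(\<integral>e. (\<Sum>l<q. c l * e l) \<partial>gauss_vec q) = 0"
    "integrable (gauss_vec q) (\<lambda>e. (\<Sum>l<q. c l * e l)\<^sup>2)"
    "(\<integral>e. (\<Sum>l<q. c l * e l)\<^sup>2 \<partial>gauss_vec q) = (\<Sum>l<q. (c l)\<^sup>2)"
proof -
  have i: "integrable (gauss_vec q) (\<lambda>e. c l * e l)" "(\<integral>e. c l * e l \<partial>gauss_vec q) = 0" if "l < q" for l
    using integrable_PiM_component[of "{..<q}" "\<lambda>_. std_gauss" l "\<lambda>x. x"] that
      prob_space_std_gauss std_gauss_integrals unfolding gauss_vec_def by auto
  show "integrable (gauss_vec q) (\<lambda>e. \<Sum>l<q. c l * e l)"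
    by (rule Bochner_Integration.integrable_sum, rule i(1), simp only: lessThan_iff)
  have "(\<integral>e. (\<Sum>l<q. c l * e l) \<partial>gauss_vec q) = (\<Sum>l<q. \<integral>e. c l * e l \<partial>gauss_vec q)"
    by (rule Bochner_Integration.integral_sum, rule i(1), simp only: lessThan_iff)
  also have "\<dots> = 0"
    by (rule sum.neutral, rule ballI, rule i(2), simp only: lessThan_iff)
  finally show "(\<integral>e. (\<Sum>l<q. c l * e l) \<partial>gauss_vec q) = 0" .
  have sq: "integrable std_gauss (\<lambda>x. (c l * x)\<^sup>2)" "(\<integral>x. (c l * x)\<^sup>2 \<partial>std_gauss) = (c l)\<^sup>2" for l
    using std_gauss_integrals by (auto simp: power_mult_distrib)
  have z: "(\<integral>x. c l * x \<partial>std_gauss) = 0" for l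
    using std_gauss_integrals by simp
  note s = integral_square_sum_indep[of "\<lambda>_. std_gauss" "{..<q}" "\<lambda>l x. c l * x", OF prob_space_std_gauss _ _ sq(1) z]
  show "integrable (gauss_vec q) (\<lambda>e. (\<Sum>l<q. c l * e l)\<^sup>2)"
    "(\<integral>e. (\<Sum>l<q. c l * e l)\<^sup>2 \<partial>gauss_vec q) = (\<Sum>l<q. (c l)\<^sup>2)"
    unfolding gauss_vec_def using s by (auto simp: sq)
qed

section \<open>Samples built from design and noise\<close>

definition sample_map :: "real \<Rightarrow> (real \<Rightarrow> real) \<Rightarrow> nat \<Rightarrow> (nat \<Rightarrow> real) \<times> (nat \<Rightarrow> real) \<Rightarrow> nat \<Rightarrow> real \<times> real" where
  "sample_map \<sigma> f q = (\<lambda>(T, e). \<lambda>l\<in>{..<q}. (T l, f (T l) + \<sigma> * e l))"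

lemma measurable_sample_map:
  assumes [measurable]: "f \<in> borel_measurable borel"
  shows "sample_map \<sigma> f q \<in> measurable (unif_vec q \<Otimes>\<^sub>M gauss_vec q) (\<Pi>\<^sub>M l\<in>{..<q}. borel \<Otimes>\<^sub>M borel)"
  unfolding sample_map_def split_beta' by measurable

lemma prob_space_obs_law:
  assumes [measurable]: "f \<in> borel_measurable borel"
  shows "prob_space (obs_law \<sigma> f)"
proof -
  interpret pair_prob_space unif01 std_gauss
    unfolding pair_prob_space_def pair_sigma_finite_def
    using prob_space_unif01 prob_space_std_gauss prob_space_imp_sigma_finite by auto
  show ?thesis unfolding obs_law_def by (rule prob_space_distr) measurable
qed

lemma sets_obs_law [measurable_cong, simp]: "sets (obs_law \<sigma> f) = sets (borel \<Otimes>\<^sub>M borel)"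
  unfolding obs_law_def by simp

text \<open>Regrouping the pairs of design and noise into two independent vectors turns conditioning
  on the design into Fubini. The two measures are compared on boxes, where the inner integral over
  the noise and the outer one over the design both factorise.\<close>

lemma PiM_obs_law_eq_distr:
  assumes f[measurable]: "f \<in> borel_measurable borel"
  shows "(\<Pi>\<^sub>M l\<in>{..<q}. obs_law \<sigma> f)
    = distr (unif_vec q \<Otimes>\<^sub>M gauss_vec q) (\<Pi>\<^sub>M l\<in>{..<q}. borel \<Otimes>\<^sub>M borel) (sample_map \<sigma> f q)"
proof -
  interpret U: product_prob_space "\<lambda>_. unif01" "{..<q}" by (rule product_prob_spaceI[OF prob_space_unif01])
  interpret G: product_prob_space "\<lambda>_. std_gauss" "{..<q}" by (rule product_prob_spaceI[OF prob_space_std_gauss])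
  interpret O: product_prob_space "\<lambda>_. obs_law \<sigma> f" "{..<q}"
    by (rule product_prob_spaceI[OF prob_space_obs_law[OF f]])
  interpret gv: prob_space "gauss_vec q" by (rule prob_space_gauss_vec)
  note sm[measurable] = measurable_sample_map[OF f, of \<sigma> q]
  have "distr (unif_vec q \<Otimes>\<^sub>M gauss_vec q) (\<Pi>\<^sub>M l\<in>{..<q}. borel \<Otimes>\<^sub>M borel) (sample_map \<sigma> f q)
     = (\<Pi>\<^sub>M l\<in>{..<q}. obs_law \<sigma> f)"
  proof (rule O.PiM_eqI)
    show "sets (distr (unif_vec q \<Otimes>\<^sub>M gauss_vec q) (\<Pi>\<^sub>M l\<in>{..<q}. borel \<Otimes>\<^sub>M borel) (sample_map \<sigma> f q))
      = sets (\<Pi>\<^sub>M l\<in>{..<q}. obs_law \<sigma> f)"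
      by (simp, intro sets_PiM_cong) auto
    fix A assume "\<And>l. l \<in> {..<q} \<Longrightarrow> A l \<in> sets (obs_law \<sigma> f)"
    then have A[measurable]: "A l \<in> sets (borel \<Otimes>\<^sub>M borel)" if "l < q" for l using that by simp
    have PA[measurable]: "Pi\<^sub>E {..<q} A \<in> sets (\<Pi>\<^sub>M l\<in>{..<q}. borel \<Otimes>\<^sub>M borel)"
      using A by (intro sets_PiM_I_finite) auto
    have ind: "indicator (Pi\<^sub>E {..<q} A) (sample_map \<sigma> f q (T, e))
      = (\<Prod>l<q. indicator (A l) (T l, f (T l) + \<sigma> * e l) :: ennreal)" for T e
    proof (cases "\<forall>l<q. (T l, f (T l) + \<sigma> * e l) \<in> A l")
      case True
      then have "sample_map \<sigma> f q (T, e) \<in> Pi\<^sub>E {..<q} A" by (auto simp: sample_map_def)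
      with True show ?thesis by simp
    next
      case False
      then obtain l where l: "l < q" "(T l, f (T l) + \<sigma> * e l) \<notin> A l" by auto
      then have "sample_map \<sigma> f q (T, e) \<notin> Pi\<^sub>E {..<q} A" by (auto simp: sample_map_def PiE_iff)
      moreover have "(\<Prod>l<q. indicator (A l) (T l, f (T l) + \<sigma> * e l) :: ennreal) = 0"
        using l by (intro prod_zero bexI[of _ l]) auto
      ultimately show ?thesis by simp
    qed
    define h where "h l t = (\<integral>\<^sup>+e. indicator (A l) (t, f t + \<sigma> * e) \<partial>std_gauss)" for l t
    have "emeasure (distr (unif_vec q \<Otimes>\<^sub>M gauss_vec q) (\<Pi>\<^sub>M l\<in>{..<q}. borel \<Otimes>\<^sub>M borel) (sample_map \<sigma> f q)) (Pi\<^sub>E {..<q} A)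
      = (\<integral>\<^sup>+p. indicator (Pi\<^sub>E {..<q} A) (sample_map \<sigma> f q p) \<partial>(unif_vec q \<Otimes>\<^sub>M gauss_vec q))"
      using nn_integral_distr[OF sm, of "indicator (Pi\<^sub>E {..<q} A)"] PA by simp
    also have "\<dots> = (\<integral>\<^sup>+T. \<integral>\<^sup>+e. indicator (Pi\<^sub>E {..<q} A) (sample_map \<sigma> f q (T, e)) \<partial>gauss_vec q \<partial>unif_vec q)"
      by (rule gv.nn_integral_fst[symmetric]) measurable
    also have "\<dots> = (\<integral>\<^sup>+T. \<integral>\<^sup>+e. (\<Prod>l<q. indicator (A l) (T l, f (T l) + \<sigma> * e l)) \<partial>gauss_vec q \<partial>unif_vec q)"
      by (simp only: ind)
    also have "\<dots> = (\<integral>\<^sup>+T. (\<Prod>l<q. h l (T l)) \<partial>unif_vec q)"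
      unfolding h_def gauss_vec_def
      by (intro nn_integral_cong G.product_nn_integral_prod) auto
    also have "\<dots> = (\<Prod>l<q. \<integral>\<^sup>+t. h l t \<partial>unif01)"
      unfolding unif_vec_def h_def
      by (intro U.product_nn_integral_prod) auto
    also have "\<dots> = (\<Prod>l<q. emeasure (obs_law \<sigma> f) (A l))"
    proof (intro prod.cong refl)
      fix l assume "l \<in> {..<q}"
      then have [measurable]: "A l \<in> sets (borel \<Otimes>\<^sub>M borel)" using A by simp
      have m: "(\<lambda>(t, e). (t, f t + \<sigma> * e)) \<in> measurable (unif01 \<Otimes>\<^sub>M std_gauss) (borel \<Otimes>\<^sub>M borel)"
        by measurable
      have "emeasure (obs_law \<sigma> f) (A l) = (\<integral>\<^sup>+p. indicator (A l) (case p of (t, e) \<Rightarrow> (t, f t + \<sigma> * e)) \<partial>(unif01 \<Otimes>\<^sub>M std_gauss))"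
        unfolding obs_law_def using nn_integral_distr[OF m, of "indicator (A l)"] by simp
      also have "\<dots> = (\<integral>\<^sup>+t. h l t \<partial>unif01)"
        unfolding h_def using sigma_finite_measure.nn_integral_fst[OF prob_space_imp_sigma_finite[OF prob_space_std_gauss], of "\<lambda>p. indicator (A l) (case p of (t, e) \<Rightarrow> (t, f t + \<sigma> * e))" unif01]
        by simp
      finally show "(\<integral>\<^sup>+t. h l t \<partial>unif01) = emeasure (obs_law \<sigma> f) (A l)" ..
    qed
    finally show "emeasure (distr (unif_vec q \<Otimes>\<^sub>M gauss_vec q) (\<Pi>\<^sub>M l\<in>{..<q}. borel \<Otimes>\<^sub>M borel) (sample_map \<sigma> f q)) (Pi\<^sub>E {..<q} A)
      = (\<Prod>l\<in>{..<q}. emeasure (obs_law \<sigma> f) (A l))" .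
  qed auto
  then show ?thesis ..
qed

section \<open>Scores of a family of disjoint bumps\<close>

lemma exp_le_one_plus_two_times:
  fixes x :: real
  assumes "0 \<le> x" "x \<le> 1"
  shows "exp x \<le> 1 + 2 * x"
  using exp_bound[OF assms] mult_left_le_one_le[of x x] assms by (simp add: power2_eq_square)

lemma square_sum_disjoint:
  fixes x :: "'k \<Rightarrow> real"
  assumes "finite K" "\<And>i j. i \<in> K \<Longrightarrow> j \<in> K \<Longrightarrow> i \<noteq> j \<Longrightarrow> x i * x j = 0"
  shows "(\<Sum>i\<in>K. x i)\<^sup>2 = (\<Sum>i\<in>K. (x i)\<^sup>2)"
proof -
  have "(\<Sum>i\<in>K. x i)\<^sup>2 = (\<Sum>i\<in>K. \<Sum>j\<in>K. x i * x j)" by (simp add: power2_eq_square sum_product)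
  also have "\<dots> = (\<Sum>i\<in>K. \<Sum>j\<in>K. if i = j then (x i)\<^sup>2 else 0)"
    using assms(2) by (intro sum.cong refl) (auto simp: power2_eq_square)
  also have "\<dots> = (\<Sum>i\<in>K. (x i)\<^sup>2)" using assms(1) by (simp add: sum.delta)
  finally show ?thesis .
qed

section \<open>Linear forms in the noise with weights depending on the design\<close>

context
  fixes q :: nat and w :: "(nat \<Rightarrow> real) \<Rightarrow> nat \<Rightarrow> real"
  assumes w[measurable]: "\<And>l. l < q \<Longrightarrow> (\<lambda>T. w T l) \<in> borel_measurable (\<Pi>\<^sub>M l\<in>{..<q}. borel)"
begin

lemma weighted_noise_measurable [measurable]:
  "(\<lambda>(T, e). \<Sum>l<q. w T l * e l) \<in> borel_measurable (unif_vec q \<Otimes>\<^sub>M gauss_vec q)"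
  unfolding split_beta' by measurable

text \<open>For a fixed design the sum is a centred Gaussian variable whose variance is the sum of
  the squared weights.\<close>

lemma weighted_noise_mgf:
  "(\<integral>\<^sup>+(T, e). ennreal (exp (\<Sum>l<q. w T l * e l)) \<partial>(unif_vec q \<Otimes>\<^sub>M gauss_vec q))
    = (\<integral>\<^sup>+T. ennreal (exp ((\<Sum>l<q. (w T l)\<^sup>2) / 2)) \<partial>unif_vec q)"
proof -
  interpret gv: prob_space "gauss_vec q" by (rule prob_space_gauss_vec)
  have m: "(\<lambda>(T, e). ennreal (exp (\<Sum>l<q. w T l * e l))) \<in> borel_measurable (unif_vec q \<Otimes>\<^sub>M gauss_vec q)"
    using weighted_noise_measurable unfolding split_beta' by measurable
  show ?thesis
    using gv.nn_integral_fst[OF m] by (simp add: gauss_vec_mgf)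
qed

lemma weighted_noise_square:
  "(\<integral>\<^sup>+(T, e). ennreal ((\<Sum>l<q. w T l * e l)\<^sup>2) \<partial>(unif_vec q \<Otimes>\<^sub>M gauss_vec q))
    = (\<integral>\<^sup>+T. ennreal (\<Sum>l<q. (w T l)\<^sup>2) \<partial>unif_vec q)"
proof -
  interpret gv: prob_space "gauss_vec q" by (rule prob_space_gauss_vec)
  have m: "(\<lambda>(T, e). ennreal ((\<Sum>l<q. w T l * e l)\<^sup>2)) \<in> borel_measurable (unif_vec q \<Otimes>\<^sub>M gauss_vec q)"
    using weighted_noise_measurable unfolding split_beta' by measurable
  have "(\<integral>\<^sup>+e. ennreal ((\<Sum>l<q. c l * e l)\<^sup>2) \<partial>gauss_vec q) = ennreal (\<Sum>l<q. (c l)\<^sup>2)" for c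
    by (subst nn_integral_eq_integral) (auto simp: gauss_vec_moments)
  then show ?thesis
    using gv.nn_integral_fst[OF m] by simp
qed

lemma weighted_noise_mean:
  assumes "\<And>T. (\<Sum>l<q. (w T l)\<^sup>2) \<le> C"
  shows "integrable (unif_vec q \<Otimes>\<^sub>M gauss_vec q) (\<lambda>(T, e). (\<Sum>l<q. w T l * e l)\<^sup>2)"
    and "integrable (unif_vec q \<Otimes>\<^sub>M gauss_vec q) (\<lambda>(T, e). \<Sum>l<q. w T l * e l)"
    and "(\<integral>(T, e). (\<Sum>l<q. w T l * e l) \<partial>(unif_vec q \<Otimes>\<^sub>M gauss_vec q)) = 0"
proof -
  interpret uv: prob_space "unif_vec q" by (rule prob_space_unif_vec)
  interpret gv: prob_space "gauss_vec q" by (rule prob_space_gauss_vec)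
  interpret P: pair_prob_space "unif_vec q" "gauss_vec q" ..
  show i2: "integrable (unif_vec q \<Otimes>\<^sub>M gauss_vec q) (\<lambda>(T, e). (\<Sum>l<q. w T l * e l)\<^sup>2)"
  proof (rule integrableI_nonneg)
    show "(\<lambda>(T, e). (\<Sum>l<q. w T l * e l)\<^sup>2) \<in> borel_measurable (unif_vec q \<Otimes>\<^sub>M gauss_vec q)"
      using weighted_noise_measurable unfolding split_beta' by measurable
    have "(\<integral>\<^sup>+p. ennreal (case p of (T, e) \<Rightarrow> (\<Sum>l<q. w T l * e l)\<^sup>2) \<partial>(unif_vec q \<Otimes>\<^sub>M gauss_vec q))
       = (\<integral>\<^sup>+T. ennreal (\<Sum>l<q. (w T l)\<^sup>2) \<partial>unif_vec q)"
      unfolding weighted_noise_square[symmetric] by (simp add: split_beta')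
    also have "\<dots> \<le> (\<integral>\<^sup>+T. ennreal C \<partial>unif_vec q)"
      using assms by (intro nn_integral_mono) (auto intro: ennreal_leI)
    also have "\<dots> < \<infinity>" by (simp add: uv.emeasure_space_1)
    finally show "(\<integral>\<^sup>+p. ennreal (case p of (T, e) \<Rightarrow> (\<Sum>l<q. w T l * e l)\<^sup>2) \<partial>(unif_vec q \<Otimes>\<^sub>M gauss_vec q)) < \<infinity>" .
  qed auto
  show i1: "integrable (unif_vec q \<Otimes>\<^sub>M gauss_vec q) (\<lambda>(T, e). \<Sum>l<q. w T l * e l)"
    using P.square_integrable_imp_integrable[OF weighted_noise_measurable] i2 by (simp add: split_beta')
  show "(\<integral>(T, e). (\<Sum>l<q. w T l * e l) \<partial>(unif_vec q \<Otimes>\<^sub>M gauss_vec q)) = 0"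
    using P.integral_fst'[OF i1] by (simp add: gauss_vec_moments)
qed

text \<open>The event concerns the design alone, so the noise can be integrated first, with
  \<bar>x\<bar> \<le> (1 + x^2) / 2 in place of the absolute value.\<close>

lemma weighted_noise_restricted_abs:
  assumes A[measurable]: "A \<in> sets (\<Pi>\<^sub>M l\<in>{..<q}. borel)"
    and C: "\<And>T. (\<Sum>l<q. (w T l)\<^sup>2) \<le> C"
  shows "(\<integral>\<^sup>+(T, e). ennreal (\<bar>\<Sum>l<q. w T l * e l\<bar> * indicator A T) \<partial>(unif_vec q \<Otimes>\<^sub>M gauss_vec q))
    \<le> ennreal ((1 + C) / 2) * emeasure (unif_vec q) A"
proof -
  interpret gv: prob_space "gauss_vec q" by (rule prob_space_gauss_vec)
  have [measurable]: "A \<in> sets (unif_vec q)" by simp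
  have m: "(\<lambda>(T, e). ennreal (\<bar>\<Sum>l<q. w T l * e l\<bar> * indicator A T)) \<in> borel_measurable (unif_vec q \<Otimes>\<^sub>M gauss_vec q)"
    using weighted_noise_measurable unfolding split_beta' by measurable
  have *: "(\<integral>\<^sup>+e. ennreal (\<bar>\<Sum>l<q. w T l * e l\<bar> * indicator A T) \<partial>gauss_vec q) \<le> ennreal ((1 + C) / 2) * indicator A T" for T
  proof (cases "T \<in> A")
    case True
    have "(\<integral>\<^sup>+e. ennreal (\<bar>\<Sum>l<q. w T l * e l\<bar> * indicator A T) \<partial>gauss_vec q)
       \<le> (\<integral>\<^sup>+e. ennreal ((1 + (\<Sum>l<q. w T l * e l)\<^sup>2) / 2) \<partial>gauss_vec q)"
    proof (intro nn_integral_mono ennreal_leI)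
      fix e
      have "0 \<le> (\<bar>\<Sum>l<q. w T l * e l\<bar> - 1)\<^sup>2" by simp
      then show "\<bar>\<Sum>l<q. w T l * e l\<bar> * indicator A T \<le> (1 + (\<Sum>l<q. w T l * e l)\<^sup>2) / 2"
        using True by (simp add: power2_eq_square algebra_simps)
    qed
    also have "\<dots> = ennreal (\<integral>e. (1 + (\<Sum>l<q. w T l * e l)\<^sup>2) / 2 \<partial>gauss_vec q)"
      by (rule nn_integral_eq_integral) (auto simp: gauss_vec_moments)
    also have "(\<integral>e. (1 + (\<Sum>l<q. w T l * e l)\<^sup>2) / 2 \<partial>gauss_vec q) = (1 + (\<Sum>l<q. (w T l)\<^sup>2)) / 2"
      by (simp add: gauss_vec_moments gv.prob_space)
    also have "ennreal \<dots> \<le> ennreal ((1 + C) / 2)" using C by (intro ennreal_leI) auto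
    finally show ?thesis using True by simp
  qed simp
  have "(\<integral>\<^sup>+(T, e). ennreal (\<bar>\<Sum>l<q. w T l * e l\<bar> * indicator A T) \<partial>(unif_vec q \<Otimes>\<^sub>M gauss_vec q))
     = (\<integral>\<^sup>+T. \<integral>\<^sup>+e. ennreal (\<bar>\<Sum>l<q. w T l * e l\<bar> * indicator A T) \<partial>gauss_vec q \<partial>unif_vec q)"
    using gv.nn_integral_fst[OF m] by simp
  also have "\<dots> \<le> (\<integral>\<^sup>+T. ennreal ((1 + C) / 2) * indicator A T \<partial>unif_vec q)"
    by (intro nn_integral_mono *)
  also have "\<dots> = ennreal ((1 + C) / 2) * emeasure (unif_vec q) A"
    by (rule nn_integral_cmult_indicator) simp
  finally show ?thesis .
qed

end

text \<open>\<open>b\<close> is a bound on the sup norm, of order \<open>2 powr (j / 2)\<close> for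
  wavelets of level \<open>j\<close>. It enters the final correlation bounds only through the tail
  of the energy; their main terms rest on the normalised second moment \<open>norm\<close> and on
  \<open>disjoint\<close>.\<close>

locale bump_family =
  fixes \<sigma> a b :: real and d q :: nat and \<psi> :: "nat \<Rightarrow> real \<Rightarrow> real"
  assumes \<sigma>: "\<sigma> > 0" and a: "a > 0" and b: "b > 0"
    and \<psi>[measurable]: "\<And>r. \<psi> r \<in> borel_measurable borel"
    and bound: "\<And>r x. r < d \<Longrightarrow> \<bar>\<psi> r x\<bar> \<le> b"
    and disjoint: "\<And>r r' x. r < d \<Longrightarrow> r' < d \<Longrightarrow> r \<noteq> r' \<Longrightarrow> \<psi> r x * \<psi> r' x = 0"
    and norm: "\<And>r. r < d \<Longrightarrow> (\<integral>x. (\<psi> r x)\<^sup>2 \<partial>unif01) \<le> 1"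
begin

definition signal :: "(nat \<Rightarrow> real) \<Rightarrow> real \<Rightarrow> real" where
  "signal \<theta> x = a * (\<Sum>r<d. \<theta> r * \<psi> r x)"

lemma signal_measurable [measurable]: "signal \<theta> \<in> borel_measurable borel"
  unfolding signal_def by measurable

text \<open>The derivative in the coordinate \<open>\<theta> k\<close> of the Gaussian
  log-likelihood of one machine.\<close>

definition score :: "(nat \<Rightarrow> real) \<Rightarrow> nat \<Rightarrow> (nat \<Rightarrow> real \<times> real) \<Rightarrow> real" where
  "score \<theta> k D = a / \<sigma>\<^sup>2 * (\<Sum>l<q. \<psi> k (fst (D l)) * (snd (D l) - signal \<theta> (fst (D l))))"

text \<open>Times \<open>(a / \<sigma>)^2\<close>, this is the conditional Fisher information of one
  machine about coordinate \<open>k\<close> given its design.\<close>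

definition energy :: "nat \<Rightarrow> (nat \<Rightarrow> real) \<Rightarrow> real" where
  "energy k T = (\<Sum>l<q. (\<psi> k (T l))\<^sup>2)"

text \<open>The score restricted to designs with at most three times the expected energy at \<open>k\<close>; this
  makes the vector of scores sub-Gaussian with the right variance proxy.\<close>

definition tame_score :: "(nat \<Rightarrow> real) \<Rightarrow> nat \<Rightarrow> (nat \<Rightarrow> real \<times> real) \<Rightarrow> real" where
  "tame_score \<theta> k D = of_bool (energy k (\<lambda>l. fst (D l)) \<le> 3 * real q) * score \<theta> k D"

definition law :: "(nat \<Rightarrow> real) \<Rightarrow> (nat \<Rightarrow> real \<times> real) measure" where
  "law \<theta> = (\<Pi>\<^sub>M l\<in>{..<q}. obs_law \<sigma> (signal \<theta>))"

lemma sets_law [measurable_cong, simp]: "sets (law \<theta>) = sets (\<Pi>\<^sub>M l\<in>{..<q}. borel \<Otimes>\<^sub>M borel)"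
  unfolding law_def by (intro sets_PiM_cong) auto

lemma prob_space_law: "prob_space (law \<theta>)"
  unfolding law_def by (intro prob_space_PiM prob_space_obs_law) measurable

lemma energy_nonneg: "0 \<le> energy k T"
  unfolding energy_def by (intro sum_nonneg) auto

lemma energy_measurable [measurable]: "energy k \<in> borel_measurable (\<Pi>\<^sub>M l\<in>{..<q}. borel)"
  unfolding energy_def by measurable

lemma psi_component_measurable [measurable (raw)]:
  "l < q \<Longrightarrow> (\<lambda>T. \<psi> k (T l)) \<in> borel_measurable (\<Pi>\<^sub>M l\<in>{..<q}. borel)"
  by (rule measurable_compose[OF measurable_component_singleton[of l "{..<q}" "\<lambda>_. borel"] \<psi>]) simp

lemma score_measurable [measurable]: "score \<theta> k \<in> borel_measurable (\<Pi>\<^sub>M l\<in>{..<q}. borel \<Otimes>\<^sub>M borel)"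
  unfolding score_def by measurable

lemma energy_fst_measurable [measurable]:
  "(\<lambda>D. energy k (\<lambda>l. fst (D l))) \<in> borel_measurable (\<Pi>\<^sub>M l\<in>{..<q}. borel \<Otimes>\<^sub>M borel)"
  unfolding energy_def by measurable

lemma tame_score_measurable [measurable]:
  "tame_score \<theta> k \<in> borel_measurable (\<Pi>\<^sub>M l\<in>{..<q}. borel \<Otimes>\<^sub>M borel)"
  unfolding tame_score_def by measurable

lemma law_eq_distr:
  "law \<theta> = distr (unif_vec q \<Otimes>\<^sub>M gauss_vec q) (\<Pi>\<^sub>M l\<in>{..<q}. borel \<Otimes>\<^sub>M borel) (sample_map \<sigma> (signal \<theta>) q)"
  unfolding law_def by (rule PiM_obs_law_eq_distr) measurable

text \<open>On data generated from \<open>\<theta>\<close> itself the residuals are the noise, so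
  the score is a linear form in the noise with weights that depend on the design alone, and no
  longer on \<open>\<theta>\<close>.\<close>

lemma score_sample_map:
  "score \<theta> k (sample_map \<sigma> (signal \<theta>) q (T, e)) = (\<Sum>l<q. (a / \<sigma> * \<psi> k (T l)) * e l)"
  unfolding score_def sample_map_def sum_distrib_left
  using \<sigma> by (intro sum.cong) (auto simp: power2_eq_square)

lemma score_sample_map':
  "score \<theta> k (sample_map \<sigma> (signal \<theta>) q p) = (\<Sum>l<q. (a / \<sigma> * \<psi> k (fst p l)) * snd p l)"
  by (cases p) (simp only: score_sample_map fst_conv snd_conv)

lemma energy_sample_map:
  "energy k (\<lambda>l. fst (sample_map \<sigma> (signal \<theta>) q (T, e) l)) = energy k T"
  unfolding energy_def sample_map_def by (intro sum.cong) auto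

lemma tame_score_sample_map:
  "tame_score \<theta> k (sample_map \<sigma> (signal \<theta>) q (T, e))
    = (\<Sum>l<q. (of_bool (energy k T \<le> 3 * real q) * (a / \<sigma>) * \<psi> k (T l)) * e l)"
  unfolding tame_score_def energy_sample_map score_sample_map sum_distrib_left
  by (intro sum.cong) auto

lemma tame_score_sample_map':
  "tame_score \<theta> k (sample_map \<sigma> (signal \<theta>) q p)
    = (\<Sum>l<q. (of_bool (energy k (fst p) \<le> 3 * real q) * (a / \<sigma>) * \<psi> k (fst p l)) * snd p l)"
  by (cases p) (simp only: tame_score_sample_map fst_conv snd_conv)

lemma energy_le: "k < d \<Longrightarrow> energy k T \<le> real q * b\<^sup>2"
  using sum_mono[of "{..<q}" "\<lambda>l. (\<psi> k (T l))\<^sup>2" "\<lambda>_. b\<^sup>2"] bound[of k] 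
  unfolding energy_def by (simp add: abs_le_square_iff[symmetric] b abs_of_pos)

lemma law_nn_integral:
  assumes "f \<in> borel_measurable (\<Pi>\<^sub>M l\<in>{..<q}. borel \<Otimes>\<^sub>M borel)"
  shows "(\<integral>\<^sup>+D. f D \<partial>law \<theta>) = (\<integral>\<^sup>+p. f (sample_map \<sigma> (signal \<theta>) q p) \<partial>(unif_vec q \<Otimes>\<^sub>M gauss_vec q))"
  unfolding law_eq_distr by (rule nn_integral_distr[OF measurable_sample_map[OF signal_measurable]]) (simp add: assms)

lemma law_integral:
  fixes f :: "_ \<Rightarrow> real"
  assumes "f \<in> borel_measurable (\<Pi>\<^sub>M l\<in>{..<q}. borel \<Otimes>\<^sub>M borel)"
  shows "(\<integral>D. f D \<partial>law \<theta>) = (\<integral>p. f (sample_map \<sigma> (signal \<theta>) q p) \<partial>(unif_vec q \<Otimes>\<^sub>M gauss_vec q))"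
    and "integrable (law \<theta>) f \<longleftrightarrow> integrable (unif_vec q \<Otimes>\<^sub>M gauss_vec q) (\<lambda>p. f (sample_map \<sigma> (signal \<theta>) q p))"
  unfolding law_eq_distr
  by (rule integral_distr[OF measurable_sample_map[OF signal_measurable] assms],
      rule integrable_distr_eq[OF measurable_sample_map[OF signal_measurable] assms])

lemma psi_square_integrable: "r < d \<Longrightarrow> integrable unif01 (\<lambda>x. (\<psi> r x)\<^sup>2)"
proof -
  assume r: "r < d"
  interpret prob_space unif01 by (rule prob_space_unif01)
  show ?thesis
    using bound[OF r] b by (intro integrable_const_bound[of _ "b\<^sup>2"]) (auto simp: abs_le_square_iff[symmetric])
qed

lemma expected_energy: "k < d \<Longrightarrow> integrable (unif_vec q) (energy k) \<and> (\<integral>T. energy k T \<partial>unif_vec q) \<le> real q"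
proof -
  assume k: "k < d"
  have i: "integrable (unif_vec q) (\<lambda>T. (\<psi> k (T l))\<^sup>2)" "(\<integral>T. (\<psi> k (T l))\<^sup>2 \<partial>unif_vec q) \<le> 1" if "l < q" for l
    using integrable_PiM_component[of "{..<q}" "\<lambda>_. unif01" l "\<lambda>x. (\<psi> k x)\<^sup>2"] that
      psi_square_integrable[OF k] prob_space_unif01 norm[OF k] unfolding unif_vec_def by auto
  have "(\<integral>T. energy k T \<partial>unif_vec q) = (\<Sum>l<q. \<integral>T. (\<psi> k (T l))\<^sup>2 \<partial>unif_vec q)"
    unfolding energy_def by (rule Bochner_Integration.integral_sum) (use i in auto)
  also have "\<dots> \<le> (\<Sum>l<q. 1)" by (rule sum_mono) (use i in auto)
  moreover have "integrable (unif_vec q) (energy k)"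
    unfolding energy_def[abs_def] by (rule Bochner_Integration.integrable_sum) (use i in auto)
  ultimately show ?thesis by simp
qed

lemma sum_score_weights: "(\<Sum>l<q. (a / \<sigma> * \<psi> k (T l))\<^sup>2) = (a / \<sigma>)\<^sup>2 * energy k T"
  unfolding energy_def sum_distrib_left by (simp add: power_mult_distrib power_divide)

lemma score_moments:
  assumes k: "k < d"
  shows "integrable (law \<theta>) (\<lambda>D. (score \<theta> k D)\<^sup>2)" "(\<integral>D. (score \<theta> k D)\<^sup>2 \<partial>law \<theta>) \<le> real q * (a / \<sigma>)\<^sup>2"
    "(\<integral>D. score \<theta> k D \<partial>law \<theta>) = 0"
proof -
  have w: "(\<lambda>T. a / \<sigma> * \<psi> k (T l)) \<in> borel_measurable (\<Pi>\<^sub>M l\<in>{..<q}. borel)" if "l < q" for l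
    using psi_component_measurable[OF that] by measurable
  have le: "(\<Sum>l<q. (a / \<sigma> * \<psi> k (T l))\<^sup>2) \<le> (a / \<sigma>)\<^sup>2 * (real q * b\<^sup>2)" for T
    unfolding sum_score_weights by (intro mult_left_mono energy_le k) auto
  note W = weighted_noise_mean[where w="\<lambda>T l. a / \<sigma> * \<psi> k (T l)", OF w le]
  show i2: "integrable (law \<theta>) (\<lambda>D. (score \<theta> k D)\<^sup>2)"
    using W(1) by (subst law_integral) (auto simp: score_sample_map' split_beta')
  show "(\<integral>D. score \<theta> k D \<partial>law \<theta>) = 0"
    using W(3) by (subst law_integral) (auto simp: score_sample_map' split_beta')
  have "ennreal (\<integral>D. (score \<theta> k D)\<^sup>2 \<partial>law \<theta>) = (\<integral>\<^sup>+D. ennreal ((score \<theta> k D)\<^sup>2) \<partial>law \<theta>)"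
    by (rule nn_integral_eq_integral[symmetric]) (use i2 in auto)
  also have "\<dots> = (\<integral>\<^sup>+(T, e). ennreal ((\<Sum>l<q. (a / \<sigma> * \<psi> k (T l)) * e l)\<^sup>2) \<partial>(unif_vec q \<Otimes>\<^sub>M gauss_vec q))"
    by (subst law_nn_integral) (auto intro!: nn_integral_cong simp: score_sample_map)
  also have "\<dots> = (\<integral>\<^sup>+T. ennreal ((a / \<sigma>)\<^sup>2 * energy k T) \<partial>unif_vec q)"
    unfolding sum_score_weights[symmetric]
    by (rule weighted_noise_square[where w="\<lambda>T l. a / \<sigma> * \<psi> k (T l)", OF w])
  also have "\<dots> = ennreal (\<integral>T. (a / \<sigma>)\<^sup>2 * energy k T \<partial>unif_vec q)"
    using expected_energy[OF k] energy_nonneg[of k] by (intro nn_integral_eq_integral) auto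
  also have "(\<integral>T. (a / \<sigma>)\<^sup>2 * energy k T \<partial>unif_vec q) = (a / \<sigma>)\<^sup>2 * (\<integral>T. energy k T \<partial>unif_vec q)"
    by simp
  also have "\<dots> \<le> (a / \<sigma>)\<^sup>2 * real q"
    using expected_energy[OF k] by (intro mult_left_mono) auto
  finally have "ennreal (\<integral>D. (score \<theta> k D)\<^sup>2 \<partial>law \<theta>) \<le> ennreal ((a / \<sigma>)\<^sup>2 * real q)"
    by (simp add: ennreal_leI)
  then show "(\<integral>D. (score \<theta> k D)\<^sup>2 \<partial>law \<theta>) \<le> real q * (a / \<sigma>)\<^sup>2"
    by (subst (asm) ennreal_le_iff) (simp_all add: mult.commute)
qed

lemma tame_score_moments:
  assumes k: "k < d"
  shows "integrable (law \<theta>) (\<lambda>D. (tame_score \<theta> k D)\<^sup>2)" "(\<integral>D. tame_score \<theta> k D \<partial>law \<theta>) = 0"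
proof -
  let ?w = "\<lambda>T l. of_bool (energy k T \<le> 3 * real q) * (a / \<sigma>) * \<psi> k (T l)"
  have w: "(\<lambda>T. ?w T l) \<in> borel_measurable (\<Pi>\<^sub>M l\<in>{..<q}. borel)" if "l < q" for l
    using psi_component_measurable[OF that] by measurable
  have le: "(\<Sum>l<q. (?w T l)\<^sup>2) \<le> (a / \<sigma>)\<^sup>2 * (real q * b\<^sup>2)" for T
  proof -
    have "(\<Sum>l<q. (?w T l)\<^sup>2) \<le> (\<Sum>l<q. (a / \<sigma> * \<psi> k (T l))\<^sup>2)"
      by (intro sum_mono) (auto simp: power_mult_distrib)
    also have "\<dots> \<le> (a / \<sigma>)\<^sup>2 * (real q * b\<^sup>2)"
      unfolding sum_score_weights by (intro mult_left_mono energy_le k) auto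
    finally show ?thesis .
  qed
  note W = weighted_noise_mean[where w="?w", OF w le]
  show "integrable (law \<theta>) (\<lambda>D. (tame_score \<theta> k D)\<^sup>2)"
    using W(1) by (subst law_integral) (auto simp: tame_score_sample_map' split_beta')
  show "(\<integral>D. tame_score \<theta> k D \<partial>law \<theta>) = 0"
    using W(3) by (subst law_integral) (auto simp: tame_score_sample_map' split_beta')
qed

text \<open>At each design point at most one bump is nonzero, so the squared weights of the combined
  linear form split over \<open>k\<close> without cross terms, and each truncated energy is at most
  \<open>3 * q\<close>. The variance proxy is therefore free of the dimension
  \<open>d\<close>.\<close>

lemma tame_score_mgf:
  "(\<integral>\<^sup>+D. ennreal (exp (\<Sum>k<d. v k * tame_score \<theta> k D)) \<partial>law \<theta>)
    \<le> ennreal (exp (3 * real q * (a / \<sigma>)\<^sup>2 / 2 * (\<Sum>k<d. (v k)\<^sup>2)))"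
proof -
  define act where "act k T = (of_bool (energy k T \<le> 3 * real q) :: real)" for k T
  let ?w = "\<lambda>T l. \<Sum>k<d. v k * (act k T * (a / \<sigma>) * \<psi> k (T l))"
  have w: "(\<lambda>T. ?w T l) \<in> borel_measurable (\<Pi>\<^sub>M l\<in>{..<q}. borel)" if "l < q" for l
    unfolding act_def using psi_component_measurable[OF that] by measurable
  have le: "(\<Sum>l<q. (?w T l)\<^sup>2) \<le> 3 * real q * (a / \<sigma>)\<^sup>2 * (\<Sum>k<d. (v k)\<^sup>2)" for T
  proof -
    have "(\<Sum>l<q. (?w T l)\<^sup>2) = (\<Sum>l<q. \<Sum>k<d. (v k * (act k T * (a / \<sigma>) * \<psi> k (T l)))\<^sup>2)"
      using disjoint by (intro sum.cong refl square_sum_disjoint) auto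
    also have "\<dots> = (\<Sum>k<d. (\<Sum>l<q. (v k * (act k T * (a / \<sigma>) * \<psi> k (T l)))\<^sup>2))" by (rule sum.swap)
    also have "\<dots> = (\<Sum>k<d. (v k)\<^sup>2 * (a / \<sigma>)\<^sup>2 * ((act k T)\<^sup>2 * energy k T))"
      unfolding energy_def sum_distrib_left by (intro sum.cong refl) (simp add: power_mult_distrib power_divide mult_ac)
    also have "\<dots> \<le> (\<Sum>k<d. (v k)\<^sup>2 * (a / \<sigma>)\<^sup>2 * (3 * real q))"
      by (intro sum_mono mult_left_mono) (auto simp: act_def)
    also have "\<dots> = 3 * real q * (a / \<sigma>)\<^sup>2 * (\<Sum>k<d. (v k)\<^sup>2)"
      by (simp add: sum_distrib_left sum_distrib_right mult_ac)
    finally show ?thesis .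
  qed
  have eq: "(\<Sum>k<d. v k * tame_score \<theta> k (sample_map \<sigma> (signal \<theta>) q (T, e))) = (\<Sum>l<q. ?w T l * e l)" for T e
    unfolding tame_score_sample_map act_def sum_distrib_left sum_distrib_right
    by (subst sum.swap) (simp add: mult_ac)
  have "(\<integral>\<^sup>+D. ennreal (exp (\<Sum>k<d. v k * tame_score \<theta> k D)) \<partial>law \<theta>)
      = (\<integral>\<^sup>+(T, e). ennreal (exp (\<Sum>l<q. ?w T l * e l)) \<partial>(unif_vec q \<Otimes>\<^sub>M gauss_vec q))"
    by (subst law_nn_integral, measurable, intro nn_integral_cong) (auto simp: eq)
  also have "\<dots> = (\<integral>\<^sup>+T. ennreal (exp ((\<Sum>l<q. (?w T l)\<^sup>2) / 2)) \<partial>unif_vec q)"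
    by (rule weighted_noise_mgf[where w="?w", OF w])
  also have "\<dots> \<le> (\<integral>\<^sup>+T. ennreal (exp (3 * real q * (a / \<sigma>)\<^sup>2 / 2 * (\<Sum>k<d. (v k)\<^sup>2))) \<partial>unif_vec q)"
    using le by (intro nn_integral_mono ennreal_leI) auto
  also have "\<dots> = ennreal (exp (3 * real q * (a / \<sigma>)\<^sup>2 / 2 * (\<Sum>k<d. (v k)\<^sup>2)))"
    using prob_space.emeasure_space_1[OF prob_space_unif_vec] by simp
  finally show ?thesis .
qed

text \<open>Chernoff's bound at the exponent \<open>1 / b^2\<close>, which keeps
  \<open>\<psi>^2 / b^2\<close> in [0,1], where \<open>exp x \<le> 1 + 2 * x\<close>. Each design
  point costs at most a factor \<open>exp (2 / b^2)\<close> against \<open>exp (3 / b^2)\<close>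
  from the threshold; hence the factor three in the truncation level.\<close>

lemma energy_tail:
  assumes k: "k < d"
  shows "emeasure (unif_vec q) {T \<in> space (\<Pi>\<^sub>M l\<in>{..<q}. borel). \<not> energy k T \<le> 3 * real q} \<le> ennreal (exp (- real q / b\<^sup>2))"
proof -
  interpret U: product_prob_space "\<lambda>_. unif01" "{..<q}" by (rule product_prob_spaceI[OF prob_space_unif01])
  let ?A = "{T \<in> space (\<Pi>\<^sub>M l\<in>{..<q}. borel). \<not> energy k T \<le> 3 * real q}"
  have A: "?A \<in> sets (unif_vec q)" by simp
  have one: "(\<integral>\<^sup>+t. ennreal (exp ((\<psi> k t)\<^sup>2 / b\<^sup>2)) \<partial>unif01) \<le> ennreal (exp (2 / b\<^sup>2))"
  proof -
    have "(\<integral>\<^sup>+t. ennreal (exp ((\<psi> k t)\<^sup>2 / b\<^sup>2)) \<partial>unif01) \<le> (\<integral>\<^sup>+t. ennreal (1 + 2 * ((\<psi> k t)\<^sup>2 / b\<^sup>2)) \<partial>unif01)"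
      using bound[OF k] b
      by (intro nn_integral_mono ennreal_leI exp_le_one_plus_two_times) (auto simp: abs_le_square_iff[symmetric])
    also have "\<dots> = ennreal (\<integral>t. 1 + 2 * ((\<psi> k t)\<^sup>2 / b\<^sup>2) \<partial>unif01)"
      using psi_square_integrable[OF k] by (intro nn_integral_eq_integral) auto
    also have "(\<integral>t. 1 + 2 * ((\<psi> k t)\<^sup>2 / b\<^sup>2) \<partial>unif01) = 1 + 2 * (\<integral>t. (\<psi> k t)\<^sup>2 \<partial>unif01) / b\<^sup>2"
      using psi_square_integrable[OF k] prob_space.prob_space[OF prob_space_unif01] by simp
    also have "\<dots> \<le> 1 + 2 / b\<^sup>2"
      using norm[OF k] b by (intro add_left_mono divide_right_mono) auto
    also have "\<dots> \<le> exp (2 / b\<^sup>2)" by (rule exp_ge_add_one_self)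
    finally show ?thesis by (simp add: ennreal_leI)
  qed
  have "emeasure (unif_vec q) ?A = (\<integral>\<^sup>+T. indicator ?A T \<partial>unif_vec q)" using A by simp
  also have "\<dots> \<le> (\<integral>\<^sup>+T. ennreal (exp (- 3 * real q / b\<^sup>2)) * (\<Prod>l<q. ennreal (exp ((\<psi> k (T l))\<^sup>2 / b\<^sup>2))) \<partial>unif_vec q)"
  proof (rule nn_integral_mono)
    fix T
    have "ennreal (exp (- 3 * real q / b\<^sup>2)) * (\<Prod>l<q. ennreal (exp ((\<psi> k (T l))\<^sup>2 / b\<^sup>2)))
      = ennreal (exp ((energy k T - 3 * real q) / b\<^sup>2))"
      unfolding energy_def
      by (simp add: prod_ennreal exp_sum[symmetric] ennreal_mult[symmetric] exp_add[symmetric]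
          sum_divide_distrib[symmetric] diff_divide_distrib add.commute)
    moreover have "indicator ?A T \<le> ennreal (exp ((energy k T - 3 * real q) / b\<^sup>2))"
      using b by (auto simp: indicator_def ennreal_1[symmetric] simp del: ennreal_1 intro!: ennreal_leI)
    ultimately show "indicator ?A T \<le> ennreal (exp (- 3 * real q / b\<^sup>2)) * (\<Prod>l<q. ennreal (exp ((\<psi> k (T l))\<^sup>2 / b\<^sup>2)))"
      by simp
  qed
  also have "\<dots> = ennreal (exp (- 3 * real q / b\<^sup>2)) * (\<integral>\<^sup>+T. (\<Prod>l<q. ennreal (exp ((\<psi> k (T l))\<^sup>2 / b\<^sup>2))) \<partial>unif_vec q)"
    by (rule nn_integral_cmult) measurable
  also have "(\<integral>\<^sup>+T. (\<Prod>l<q. ennreal (exp ((\<psi> k (T l))\<^sup>2 / b\<^sup>2))) \<partial>unif_vec q)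
      = (\<Prod>l<q. \<integral>\<^sup>+t. ennreal (exp ((\<psi> k t)\<^sup>2 / b\<^sup>2)) \<partial>unif01)"
    unfolding unif_vec_def by (intro U.product_nn_integral_prod) auto
  also have "\<dots> \<le> (\<Prod>l<q. ennreal (exp (2 / b\<^sup>2)))" by (intro prod_mono_ennreal one)
  also have "\<dots> = ennreal (exp (2 * real q / b\<^sup>2))"
    by (simp add: prod_ennreal ennreal_power exp_of_nat_mult[symmetric] mult_ac)
  also have "ennreal (exp (- 3 * real q / b\<^sup>2)) * ennreal (exp (2 * real q / b\<^sup>2)) = ennreal (exp (- real q / b\<^sup>2))"
    by (simp add: ennreal_mult[symmetric] exp_add[symmetric] add_divide_distrib[symmetric])
  finally show ?thesis by (simp add: mult_left_mono)
qed

text \<open>An L1 bound is the right form, since the difference will be integrated against bounded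
  functions. The crude bound \<open>q * b^2\<close> on the energy is harmless next to the
  exponential factor.\<close>

lemma score_minus_tame_score:
  assumes k: "k < d"
  shows "integrable (law \<theta>) (\<lambda>D. \<bar>score \<theta> k D - tame_score \<theta> k D\<bar>)"
    "(\<integral>D. \<bar>score \<theta> k D - tame_score \<theta> k D\<bar> \<partial>law \<theta>)
      \<le> (1 + (a / \<sigma>)\<^sup>2 * (real q * b\<^sup>2)) / 2 * exp (- real q / b\<^sup>2)"
proof -
  interpret prob_space "law \<theta>" by (rule prob_space_law)
  let ?A = "{T \<in> space (\<Pi>\<^sub>M l\<in>{..<q}. borel). \<not> energy k T \<le> 3 * real q}"
  let ?C = "(a / \<sigma>)\<^sup>2 * (real q * b\<^sup>2)"
  have w: "(\<lambda>T. a / \<sigma> * \<psi> k (T l)) \<in> borel_measurable (\<Pi>\<^sub>M l\<in>{..<q}. borel)" if "l < q" for l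
    using psi_component_measurable[OF that] by measurable
  have le: "(\<Sum>l<q. (a / \<sigma> * \<psi> k (T l))\<^sup>2) \<le> ?C" for T
    unfolding sum_score_weights by (intro mult_left_mono energy_le k) auto
  have C0: "?C \<ge> 0" by simp
  have A: "?A \<in> sets (\<Pi>\<^sub>M l\<in>{..<q}. borel)" by simp
  show i: "integrable (law \<theta>) (\<lambda>D. \<bar>score \<theta> k D - tame_score \<theta> k D\<bar>)"
    using square_integrable_imp_integrable[OF _ score_moments(1)[OF k, of \<theta>]]
      square_integrable_imp_integrable[OF _ tame_score_moments(1)[OF k, of \<theta>]]
    by (intro integrable_abs Bochner_Integration.integrable_diff) simp_all
  have sp: "fst p \<in> space (\<Pi>\<^sub>M l\<in>{..<q}. borel)" if "p \<in> space (unif_vec q \<Otimes>\<^sub>M gauss_vec q)" for p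
    using that by (simp only: space_pair_measure mem_Times_iff sets_eq_imp_space_eq[OF sets_unif_vec])
  have "ennreal (\<integral>D. \<bar>score \<theta> k D - tame_score \<theta> k D\<bar> \<partial>law \<theta>) = (\<integral>\<^sup>+D. ennreal \<bar>score \<theta> k D - tame_score \<theta> k D\<bar> \<partial>law \<theta>)"
    by (rule nn_integral_eq_integral[symmetric]) (use i in auto)
  also have "\<dots> = (\<integral>\<^sup>+(T, e). ennreal (\<bar>\<Sum>l<q. (a / \<sigma> * \<psi> k (T l)) * e l\<bar> * indicator ?A T) \<partial>(unif_vec q \<Otimes>\<^sub>M gauss_vec q))"
    by (subst law_nn_integral, measurable, intro nn_integral_cong)
       (use sp in \<open>auto simp: tame_score_def energy_sample_map score_sample_map indicator_def\<close>)
  also have "\<dots> \<le> ennreal ((1 + ?C) / 2) * emeasure (unif_vec q) ?A"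
    by (rule weighted_noise_restricted_abs[where w="\<lambda>T l. a / \<sigma> * \<psi> k (T l)", OF w A le])
  also have "\<dots> \<le> ennreal ((1 + ?C) / 2) * ennreal (exp (- real q / b\<^sup>2))"
    by (intro mult_left_mono energy_tail k) auto
  also have "\<dots> = ennreal ((1 + ?C) / 2 * exp (- real q / b\<^sup>2))"
    using C0 by (intro ennreal_mult[symmetric]) auto
  finally show "(\<integral>D. \<bar>score \<theta> k D - tame_score \<theta> k D\<bar> \<partial>law \<theta>) \<le> (1 + ?C) / 2 * exp (- real q / b\<^sup>2)"
    by (subst (asm) ennreal_le_iff) (use C0 in auto)
qed

end

section \<open>Information carried by short messages\<close>

text \<open>The empty string gets almost all the mass. This matters for budgets \<open>B < 1\<close>, where most
  messages are empty and the logarithmic cost must be proportional to \<open>B\<close>.\<close>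

definition string_weight :: "real \<Rightarrow> bool list \<Rightarrow> real" where
  "string_weight \<eta> y = (if y = [] then 1 - \<eta> else \<eta> * (1 / 4) ^ length y)"

context
  fixes \<eta> :: real
  assumes \<eta>: "0 < \<eta>" "\<eta> \<le> 1 / 2"
begin

lemma string_weight_pos: "string_weight \<eta> y > 0"
  using \<eta> by (simp add: string_weight_def)

text \<open>The \<open>2^n\<close> strings of length \<open>n \<ge> 1\<close> have total weight
  \<open>\<eta> * 2^(-n)\<close>, and these sum to \<open>\<eta>\<close>, exactly what the empty
  string leaves.\<close>

lemma string_weight_sum: "(\<integral>\<^sup>+y. ennreal (string_weight \<eta> y) \<partial>count_space UNIV) \<le> 1"
proof -
  define A where "A n = {y :: bool list. length y = n}" for n
  have A: "finite (A n)" "card (A n) = 2 ^ n" for n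
    using finite_lists_length_eq[of "UNIV :: bool set" n] card_lists_length_eq[of "UNIV :: bool set" n]
    by (auto simp: A_def)
  define p where "p n = (if n = 0 then 1 - \<eta> else \<eta> * (1 / 4) ^ n)" for n :: nat
  have w: "string_weight \<eta> y = p (length y)" for y
    by (simp add: string_weight_def p_def)
  have "(\<integral>\<^sup>+y. ennreal (string_weight \<eta> y) \<partial>count_space UNIV)
      = (\<integral>\<^sup>+y. (\<Sum>n. ennreal (p n) * indicator (A n) y) \<partial>count_space UNIV)"
  proof (rule nn_integral_cong)
    fix y :: "bool list"
    have "(\<Sum>n. ennreal (p n) * indicator (A n) y) = (\<Sum>n\<in>{length y}. ennreal (p n) * indicator (A n) y)"
      by (rule suminf_finite) (auto simp: A_def)
    then show "ennreal (string_weight \<eta> y) = (\<Sum>n. ennreal (p n) * indicator (A n) y)"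
      by (simp add: A_def w)
  qed
  also have "\<dots> = (\<Sum>n. \<integral>\<^sup>+y. ennreal (p n) * indicator (A n) y \<partial>count_space UNIV)"
    by (rule nn_integral_suminf) auto
  also have "\<dots> = (\<Sum>n. ennreal (p n * 2 ^ n))"
  proof (intro arg_cong[where f=suminf] ext)
    fix n
    have "(\<integral>\<^sup>+y. ennreal (p n) * indicator (A n) y \<partial>count_space UNIV) = ennreal (p n) * ennreal (2 ^ n)"
      using A[of n] by (subst nn_integral_cmult_indicator) (auto simp: ennreal_of_nat_eq_real_of_nat)
    also have "\<dots> = ennreal (p n * 2 ^ n)"
      using \<eta> by (intro ennreal_mult[symmetric]) (auto simp: p_def)
    finally show "(\<integral>\<^sup>+y. ennreal (p n) * indicator (A n) y \<partial>count_space UNIV) = ennreal (p n * 2 ^ n)" .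
  qed
  also have "\<dots> = ennreal 1"
  proof (rule suminf_ennreal_eq)
    show "0 \<le> p n * 2 ^ n" for n using \<eta> by (simp add: p_def)
    \<comment> \<open>The geometric series taken from \<open>n = 0\<close> has sum
      \<open>2 * \<eta>\<close> and first term \<open>\<eta>\<close>; adding
      \<open>1 - 2 * \<eta>\<close> at \<open>n = 0\<close> corrects the first term to
      \<open>1 - \<eta>\<close>.\<close>
    have "(\<lambda>n. \<eta> * (1 / 2) ^ n) sums (\<eta> * (1 / (1 - 1 / 2)))"
      by (intro sums_mult geometric_sums) auto
    moreover have "(\<lambda>n. if n = 0 then 1 - 2 * \<eta> else 0) sums (1 - 2 * \<eta>)"
      using sums_single[of 0 "\<lambda>_. 1 - 2 * \<eta>"] by simp
    ultimately have "(\<lambda>n. \<eta> * (1 / 2) ^ n + (if n = 0 then 1 - 2 * \<eta> else 0)) sums (\<eta> * (1 / (1 - 1 / 2)) + (1 - 2 * \<eta>))"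
      by (rule sums_add)
    moreover have "\<eta> * (1 / 2) ^ n + (if n = 0 then 1 - 2 * \<eta> else 0) = p n * 2 ^ n" for n
      by (simp add: p_def power_divide power_mult_distrib[symmetric] field_simps flip: power_mult_distrib)
    ultimately show "(\<lambda>n. p n * 2 ^ n) sums 1" by simp
  qed
  finally show ?thesis by simp
qed

text \<open>A nonempty string has length at least 1, which absorbs the price
  \<open>ln (1 / \<eta>)\<close> of being nonempty. The cost is thus affine in the length, so its
  mean is controlled by the budget on the expected length.\<close>

lemma string_weight_ln:
  "- ln (string_weight \<eta> y) \<le> 2 * \<eta> + real (length y) * (ln (1 / \<eta>) + ln 4)" "0 \<le> - ln (string_weight \<eta> y)"
proof -
  have l: "0 \<le> ln (1 / \<eta>)" using \<eta> by (intro ln_ge_zero) (auto simp: field_simps)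
  have "- ln (string_weight \<eta> y) \<le> 2 * \<eta> + real (length y) * (ln (1 / \<eta>) + ln 4) \<and> 0 \<le> - ln (string_weight \<eta> y)"
  proof (cases "y = []")
    case True
    have "- ln (1 - \<eta>) = ln (1 / (1 - \<eta>))" using \<eta> by (simp add: ln_div)
    also have "\<dots> \<le> 1 / (1 - \<eta>) - 1" using \<eta> by (intro ln_le_minus_one) auto
    also have "\<dots> \<le> 2 * \<eta>"
    proof -
      have "0 \<le> \<eta> * (1 - 2 * \<eta>)" using \<eta> by simp
      then show ?thesis using \<eta> by (simp add: field_simps)
    qed
    finally show ?thesis using True \<eta> by (simp add: string_weight_def)
  next
    case False
    then have n: "real (length y) \<ge> 1" by (cases y) auto
    have "- ln (string_weight \<eta> y) = ln (1 / \<eta>) + real (length y) * ln 4"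
      using False \<eta> by (simp add: string_weight_def ln_mult ln_div ln_realpow)
    moreover have "ln (1 / \<eta>) \<le> real (length y) * ln (1 / \<eta>)"
      using mult_right_mono[OF n l] by simp
    moreover have "0 \<le> real (length y) * ln 4" by simp
    ultimately show ?thesis using \<eta> l unfolding distrib_left by linarith
  qed
  then show "- ln (string_weight \<eta> y) \<le> 2 * \<eta> + real (length y) * (ln (1 / \<eta>) + ln 4)" "0 \<le> - ln (string_weight \<eta> y)"
    by auto
qed

end

section \<open>Correlation of bounded functions with the total score\<close>

context bump_family
begin

definition total_score :: "nat \<Rightarrow> (nat \<Rightarrow> real) \<Rightarrow> nat \<Rightarrow> (nat \<Rightarrow> nat \<Rightarrow> real \<times> real) \<Rightarrow> real" where
  "total_score m \<theta> k D = (\<Sum>i<m. score \<theta> k (D i))"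

definition full_law :: "nat \<Rightarrow> (nat \<Rightarrow> real) \<Rightarrow> (nat \<Rightarrow> nat \<Rightarrow> real \<times> real) measure" where
  "full_law m \<theta> = (\<Pi>\<^sub>M i\<in>{..<m}. law \<theta>)"

abbreviation data_space :: "nat \<Rightarrow> (nat \<Rightarrow> nat \<Rightarrow> real \<times> real) measure" where
  "data_space m \<equiv> (\<Pi>\<^sub>M i\<in>{..<m}. \<Pi>\<^sub>M l\<in>{..<q}. borel \<Otimes>\<^sub>M borel)"

lemma sets_full_law [measurable_cong, simp]: "sets (full_law m \<theta>) = sets (data_space m)"
  unfolding full_law_def by (intro sets_PiM_cong) auto

lemma prob_space_full_law: "prob_space (full_law m \<theta>)"
  unfolding full_law_def by (intro prob_space_PiM prob_space_law)

lemma total_score_measurable [measurable]: "total_score m \<theta> k \<in> borel_measurable (data_space m)"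
  unfolding total_score_def
proof (rule borel_measurable_sum)
  fix i assume "i \<in> {..<m}"
  then have "(\<lambda>D. D i) \<in> measurable (data_space m) (\<Pi>\<^sub>M l\<in>{..<q}. borel \<Otimes>\<^sub>M borel)"
    by (rule measurable_component_singleton)
  from measurable_compose[OF this score_measurable]
  show "(\<lambda>D. score \<theta> k (D i)) \<in> borel_measurable (data_space m)" .
qed

lemma total_score_moments:
  assumes k: "k < d"
  shows "integrable (full_law m \<theta>) (\<lambda>D. (total_score m \<theta> k D)\<^sup>2)"
    and "(\<integral>D. (total_score m \<theta> k D)\<^sup>2 \<partial>full_law m \<theta>) \<le> real m * (real q * (a / \<sigma>)\<^sup>2)"
proof -
  note o = integral_square_sum_indep[of "\<lambda>_. law \<theta>" "{..<m}" "\<lambda>_. score \<theta> k",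
      OF prob_space_law _ _ score_moments(1)[OF k] score_moments(3)[OF k]]
  show "integrable (full_law m \<theta>) (\<lambda>D. (total_score m \<theta> k D)\<^sup>2)"
    unfolding full_law_def total_score_def using o(1) by simp
  have "(\<integral>D. (total_score m \<theta> k D)\<^sup>2 \<partial>full_law m \<theta>) = real m * (\<integral>D. (score \<theta> k D)\<^sup>2 \<partial>law \<theta>)"
    unfolding full_law_def total_score_def using o(2) by simp
  also have "\<dots> \<le> real m * (real q * (a / \<sigma>)\<^sup>2)"
    by (intro mult_left_mono score_moments(2)[OF k]) auto
  finally show "(\<integral>D. (total_score m \<theta> k D)\<^sup>2 \<partial>full_law m \<theta>) \<le> real m * (real q * (a / \<sigma>)\<^sup>2)" .
qed

text \<open>Young's inequality with parameter 12, applied to the full data. The denominator 24 means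
  that a Fisher information of at most 8 per coordinate leaves a remainder of at most
  \<open>1 / 3\<close>.\<close>

lemma score_correlation_unconstrained:
  assumes k: "k < d" and F[measurable]: "F \<in> borel_measurable (data_space m)" and Fb: "\<And>D. \<bar>F D\<bar> \<le> 2"
  shows "(\<integral>D. F D * total_score m \<theta> k D \<partial>full_law m \<theta>)
    \<le> 6 * (\<integral>D. (F D)\<^sup>2 \<partial>full_law m \<theta>) + real m * (real q * (a / \<sigma>)\<^sup>2) / 24"
proof -
  interpret prob_space "full_law m \<theta>" by (rule prob_space_full_law)
  have "(F D)\<^sup>2 \<le> 4" for D
    using power_mono[OF Fb[of D], of 2] by simp
  then have iF: "integrable (full_law m \<theta>) (\<lambda>D. (F D)\<^sup>2)"
    by (intro integrable_const_bound[of _ 4]) auto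
  note T = total_score_moments[OF k, of m \<theta>]
  have iFT: "integrable (full_law m \<theta>) (\<lambda>D. F D * total_score m \<theta> k D)"
    by (rule integrable_mult_of_squares[OF _ _ iF T(1)]) auto
  have "(\<integral>D. F D * total_score m \<theta> k D \<partial>full_law m \<theta>)
     \<le> (\<integral>D. 6 * (F D)\<^sup>2 + (total_score m \<theta> k D)\<^sup>2 / 24 \<partial>full_law m \<theta>)"
  proof (rule integral_mono[OF iFT])
    show "integrable (full_law m \<theta>) (\<lambda>D. 6 * (F D)\<^sup>2 + (total_score m \<theta> k D)\<^sup>2 / 24)"
      using iF T(1) by auto
    show "F D * total_score m \<theta> k D \<le> 6 * (F D)\<^sup>2 + (total_score m \<theta> k D)\<^sup>2 / 24" for D
      using mult_le_weighted_squares[of 12 "F D" "total_score m \<theta> k D"] by simp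
  qed
  also have "\<dots> = 6 * (\<integral>D. (F D)\<^sup>2 \<partial>full_law m \<theta>) + (\<integral>D. (total_score m \<theta> k D)\<^sup>2 \<partial>full_law m \<theta>) / 24"
    using iF T(1) by simp
  also have "\<dots> \<le> 6 * (\<integral>D. (F D)\<^sup>2 \<partial>full_law m \<theta>) + real m * (real q * (a / \<sigma>)\<^sup>2) / 24"
    using T(2) by simp
  finally show ?thesis .
qed

definition tail_bound :: real where
  "tail_bound = (1 + (a / \<sigma>)\<^sup>2 * (real q * b\<^sup>2)) / 2 * exp (- real q / b\<^sup>2)"

text \<open>The level-one inequality is applied once per machine to all \<open>d\<close> coordinates
  together, because they share one message. This is why the information term carries no factor
  \<open>d\<close>, in contrast to the sum of the unconstrained bounds over
  \<open>k\<close>.\<close>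

lemma score_correlation_constrained:
  fixes enc :: "nat \<Rightarrow> (nat \<Rightarrow> real \<times> real) \<Rightarrow> bool list"
  assumes q: "q > 0" and \<eta>: "0 < \<eta>" "\<eta> \<le> 1 / 2" and B: "B \<ge> 0"
    and enc: "\<And>i. i < m \<Longrightarrow> enc i \<in> measurable (\<Pi>\<^sub>M l\<in>{..<q}. borel \<Otimes>\<^sub>M borel) (count_space UNIV)"
    and len: "\<And>i. i < m \<Longrightarrow> (\<integral>\<^sup>+D. of_nat (length (enc i (D i))) \<partial>full_law m \<theta>) \<le> ennreal B"
    and F: "\<And>k. k < d \<Longrightarrow> F k \<in> borel_measurable (data_space m)" and Fb: "\<And>k D. \<bar>F k D\<bar> \<le> 2"
    and dep: "\<And>k D D'. (\<And>i. i < m \<Longrightarrow> enc i (D i) = enc i (D' i)) \<Longrightarrow> F k D = F k D'"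
  shows "(\<Sum>k<d. \<integral>D. F k D * total_score m \<theta> k D \<partial>full_law m \<theta>)
    \<le> 6 * (\<Sum>k<d. \<integral>D. (F k D)\<^sup>2 \<partial>full_law m \<theta>)
      + real m * (real q * (a / \<sigma>)\<^sup>2) * (2 * \<eta> + B * (ln (1 / \<eta>) + ln 4)) / 4
      + 2 * real m * real d * tail_bound"
proof -
  interpret L: prob_space "law \<theta>" by (rule prob_space_law)
  interpret P: prob_space "full_law m \<theta>" by (rule prob_space_full_law)
  define \<epsilon> where "\<epsilon> = 3 * real q * (a / \<sigma>)\<^sup>2"
  have \<epsilon>: "\<epsilon> > 0" using q a \<sigma> by (simp add: \<epsilon>_def)
  define budget where "budget = 2 * \<eta> + B * (ln (1 / \<eta>) + ln 4)"
  have l\<eta>: "0 \<le> ln (1 / \<eta>)" using \<eta> by (intro ln_ge_zero) (auto simp: field_simps)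
  have enc': "enc i \<in> measurable (law \<theta>) (count_space UNIV)" if "i < m" for i
    using enc[OF that] by simp
  have tm: "tame_score \<theta> k \<in> borel_measurable (law \<theta>)" for k by simp
  have it: "integrable (law \<theta>) (tame_score \<theta> k)" if "k < d" for k
    by (rule L.square_integrable_imp_integrable[OF tm tame_score_moments(1)[OF that]])
  \<comment> \<open>\<open>Q i k c\<close> says that \<open>c\<close> is the conditional expectation
    of the truncated score given the message, written as a function of the message.\<close>
  define Q where "Q i k c \<longleftrightarrow> integrable (law \<theta>) (\<lambda>x. (c (enc i x))\<^sup>2) \<and>
      (\<forall>h. integrable (law \<theta>) (\<lambda>x. h (enc i x) * tame_score \<theta> k x) \<longrightarrow>
          (\<integral>x. h (enc i x) * c (enc i x) \<partial>law \<theta>) = (\<integral>x. h (enc i x) * tame_score \<theta> k x \<partial>law \<theta>))"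
    for i k and c :: "bool list \<Rightarrow> real"
  define c where "c i k = (SOME c. Q i k c)" for i k
  have Q: "Q i k (c i k)" if ik: "i < m" "k < d" for i k
  proof -
    obtain c' where "Q i k c'"
      unfolding Q_def
      by (rule cond_exp_discrete[OF prob_space_law enc'[OF ik(1)] tm tame_score_moments(1)[OF ik(2)]]) blast
    then show ?thesis unfolding c_def by (rule someI[of "Q i k"])
  qed
  have c2: "integrable (law \<theta>) (\<lambda>x. (c i k (enc i x))\<^sup>2)" if "i < m" "k < d" for i k
    using Q[OF that] unfolding Q_def by (rule conjunct1)
  have c: "(\<integral>x. h (enc i x) * c i k (enc i x) \<partial>law \<theta>) = (\<integral>x. h (enc i x) * tame_score \<theta> k x \<partial>law \<theta>)"
    if "i < m" "k < d" and h: "integrable (law \<theta>) (\<lambda>x. h (enc i x) * tame_score \<theta> k x)" for i k h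
    using conjunct2[OF Q[OF that(1,2), unfolded Q_def]] h by simp
  have information: "(\<Sum>k<d. \<integral>x. (c i k (enc i x))\<^sup>2 \<partial>law \<theta>) \<le> 2 * \<epsilon> * budget" if i: "i < m" for i
  proof -
    note e[measurable] = enc'[OF i]
    \<comment> \<open>The budget is stated under the joint law; here it is moved to the marginal law
      of a single machine.\<close>
    have "(\<integral>\<^sup>+x. of_nat (length (enc i x)) \<partial>law \<theta>) = (\<integral>\<^sup>+D. of_nat (length (enc i (D i))) \<partial>full_law m \<theta>)"
    proof -
      have d: "distr (full_law m \<theta>) (law \<theta>) (\<lambda>D. D i) = law \<theta>"
        unfolding full_law_def by (rule distr_PiM_component) (use i prob_space_law in auto)
      have "(\<integral>\<^sup>+x. of_nat (length (enc i x)) \<partial>law \<theta>) = (\<integral>\<^sup>+x. of_nat (length (enc i x)) \<partial>distr (full_law m \<theta>) (law \<theta>) (\<lambda>D. D i))"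
        by (simp only: d)
      also have "\<dots> = (\<integral>\<^sup>+D. of_nat (length (enc i (D i))) \<partial>full_law m \<theta>)"
        by (rule nn_integral_distr) (use i in \<open>auto simp: full_law_def intro!: measurable_component_singleton\<close>)
      finally show ?thesis .
    qed
    then have len': "(\<integral>\<^sup>+x. ennreal (real (length (enc i x))) \<partial>law \<theta>) \<le> ennreal B"
      using len[OF i] by (simp add: ennreal_of_nat_eq_real_of_nat)
    have il: "integrable (law \<theta>) (\<lambda>x. real (length (enc i x)))"
      by (rule integrableI_nonneg) (use len' in \<open>auto intro: le_less_trans\<close>)
    have "ennreal (\<integral>x. real (length (enc i x)) \<partial>law \<theta>) \<le> ennreal B"
      using len' by (subst nn_integral_eq_integral[OF il, symmetric]) auto
    then have lenB: "(\<integral>x. real (length (enc i x)) \<partial>law \<theta>) \<le> B" using B by simp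
    let ?U = "\<lambda>x. 2 * \<eta> + real (length (enc i x)) * (ln (1 / \<eta>) + ln 4)"
    have iU: "integrable (law \<theta>) ?U" using il by simp
    have ir: "integrable (law \<theta>) (\<lambda>x. ln (string_weight \<eta> (enc i x)))"
      by (rule Bochner_Integration.integrable_bound[OF iU])
         (use string_weight_ln[OF \<eta>] in \<open>auto intro!: AE_I2 simp: abs_le_iff intro: order_trans[OF _ abs_ge_self]\<close>)
    have "(\<integral>x. - ln (string_weight \<eta> (enc i x)) \<partial>law \<theta>) \<le> (\<integral>x. ?U x \<partial>law \<theta>)"
      by (intro integral_mono Bochner_Integration.integrable_minus ir iU string_weight_ln(1)[OF \<eta>])
    also have "\<dots> = 2 * \<eta> + (\<integral>x. real (length (enc i x)) \<partial>law \<theta>) * (ln (1 / \<eta>) + ln 4)"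
      using il by (simp add: L.prob_space)
    also have "\<dots> \<le> budget" unfolding budget_def
      using l\<eta> by (intro add_left_mono mult_right_mono lenB) auto
    finally have b: "(\<integral>x. - ln (string_weight \<eta> (enc i x)) \<partial>law \<theta>) \<le> budget" .
    have cm: "(\<lambda>x. c i k (enc i x)) \<in> borel_measurable (law \<theta>)" for k
      by measurable
    have cS: "integrable (law \<theta>) (\<lambda>x. c i k (enc i x) * tame_score \<theta> k x)" if "k \<in> {..<d}" for k
      using that by (intro integrable_mult_of_squares cm tm c2 i tame_score_moments) auto
    have "(\<Sum>k<d. \<integral>x. (c i k (enc i x))\<^sup>2 \<partial>law \<theta>) \<le> 2 * \<epsilon> * (\<integral>x. - ln (string_weight \<eta> (enc i x)) \<partial>law \<theta>)"
    proof (rule level_one_inequality[OF prob_space_law e tm _ \<epsilon> _ cS _ _ string_weight_pos[OF \<eta>] string_weight_sum[OF \<eta>] ir])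
      show "integrable (law \<theta>) (\<lambda>x. (c i k (enc i x))\<^sup>2)" if "k \<in> {..<d}" for k using c2[OF i] that by simp
      show "(\<integral>x. c i k (enc i x) * tame_score \<theta> k x \<partial>law \<theta>) = (\<integral>x. (c i k (enc i x))\<^sup>2 \<partial>law \<theta>)" if "k \<in> {..<d}" for k
        using c[OF i _ cS[OF that]] that by (simp add: power2_eq_square)
      show "(\<integral>\<^sup>+x. ennreal (exp (\<Sum>k<d. v k * tame_score \<theta> k x)) \<partial>law \<theta>) \<le> ennreal (exp (\<epsilon> / 2 * (\<Sum>k<d. (v k)\<^sup>2)))" for v
        unfolding \<epsilon>_def by (rule tame_score_mgf)
    qed auto
    also have "\<dots> \<le> 2 * \<epsilon> * budget" using \<epsilon> by (intro mult_left_mono b) simp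
    finally show ?thesis .
  qed
  have per_k: "(\<integral>D. F k D * total_score m \<theta> k D \<partial>full_law m \<theta>)
     \<le> 6 * (\<integral>D. (F k D)\<^sup>2 \<partial>full_law m \<theta>) + (\<Sum>i<m. \<integral>x. (c i k (enc i x))\<^sup>2 \<partial>law \<theta>) / 24 + 2 * real m * tail_bound"
    if k: "k < d" for k
  proof -
    note Fk[measurable] = F[OF k]
    have comp: "integrable (full_law m \<theta>) (\<lambda>D. g (D i))" "(\<integral>D. g (D i) \<partial>full_law m \<theta>) = (\<integral>x. g x \<partial>law \<theta>)"
      if "i < m" "integrable (law \<theta>) g" for i and g :: "_ \<Rightarrow> real"
      using integrable_PiM_component[of "{..<m}" "\<lambda>_. law \<theta>" i g] that prob_space_law
      unfolding full_law_def by auto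
    have bd: "integrable (full_law m \<theta>) (\<lambda>D. F k D * (\<Sum>i<m. g (D i)))" if g: "integrable (law \<theta>) g" for g
    proof (rule Bochner_Integration.integrable_bound)
      show i2: "integrable (full_law m \<theta>) (\<lambda>D. 2 * (\<Sum>i<m. g (D i)))"
        by (intro integrable_mult_right Bochner_Integration.integrable_sum comp(1)[OF _ g]) simp
      have "(\<lambda>D. \<Sum>i<m. g (D i)) \<in> borel_measurable (full_law m \<theta>)"
        by (intro borel_measurable_sum borel_measurable_integrable comp(1)[OF _ g]) simp
      then show "(\<lambda>D. F k D * (\<Sum>i<m. g (D i))) \<in> borel_measurable (full_law m \<theta>)"
        by simp
      show "AE D in full_law m \<theta>. norm (F k D * (\<Sum>i<m. g (D i))) \<le> norm (2 * (\<Sum>i<m. g (D i)))"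
        using Fb[of k] by (auto simp: abs_mult intro!: mult_right_mono)
    qed
    have isc: "integrable (law \<theta>) (score \<theta> k)"
      by (rule L.square_integrable_imp_integrable[OF _ score_moments(1)[OF k]]) simp
    note id = score_minus_tame_score[OF k, of \<theta>]
    \<comment> \<open>The true scores give way to the truncated ones; the bound 2 on
      \<open>F\<close> becomes the factor in front of the L1 error.\<close>
    have "(\<integral>D. F k D * total_score m \<theta> k D \<partial>full_law m \<theta>)
       \<le> (\<integral>D. F k D * (\<Sum>i<m. tame_score \<theta> k (D i)) + 2 * (\<Sum>i<m. \<bar>score \<theta> k (D i) - tame_score \<theta> k (D i)\<bar>) \<partial>full_law m \<theta>)"
    proof (rule integral_mono)
      show "integrable (full_law m \<theta>) (\<lambda>D. F k D * total_score m \<theta> k D)"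
        unfolding total_score_def by (rule bd[OF isc])
      show "integrable (full_law m \<theta>) (\<lambda>D. F k D * (\<Sum>i<m. tame_score \<theta> k (D i)) + 2 * (\<Sum>i<m. \<bar>score \<theta> k (D i) - tame_score \<theta> k (D i)\<bar>))"
        by (intro Bochner_Integration.integrable_add bd it k integrable_mult_right
            Bochner_Integration.integrable_sum comp(1)[OF _ id(1)]) simp
      fix D
      have "F k D * (\<Sum>i<m. score \<theta> k (D i) - tame_score \<theta> k (D i)) \<le> \<bar>F k D\<bar> * \<bar>\<Sum>i<m. score \<theta> k (D i) - tame_score \<theta> k (D i)\<bar>"
        by (simp only: abs_mult[symmetric] abs_ge_self)
      also have "\<dots> \<le> 2 * (\<Sum>i<m. \<bar>score \<theta> k (D i) - tame_score \<theta> k (D i)\<bar>)"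
        by (intro mult_mono Fb sum_abs) auto
      finally show "F k D * total_score m \<theta> k D \<le> F k D * (\<Sum>i<m. tame_score \<theta> k (D i)) + 2 * (\<Sum>i<m. \<bar>score \<theta> k (D i) - tame_score \<theta> k (D i)\<bar>)"
        unfolding total_score_def by (simp add: sum_subtractf algebra_simps)
    qed
    also have "\<dots> = (\<integral>D. F k D * (\<Sum>i<m. tame_score \<theta> k (D i)) \<partial>full_law m \<theta>)
        + (\<integral>D. 2 * (\<Sum>i<m. \<bar>score \<theta> k (D i) - tame_score \<theta> k (D i)\<bar>) \<partial>full_law m \<theta>)"
      by (intro Bochner_Integration.integral_add bd it k integrable_mult_right
          Bochner_Integration.integrable_sum comp(1)[OF _ id(1)]) simp
    also have "(\<integral>D. 2 * (\<Sum>i<m. \<bar>score \<theta> k (D i) - tame_score \<theta> k (D i)\<bar>) \<partial>full_law m \<theta>)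
        = 2 * (\<Sum>i<m. \<integral>D. \<bar>score \<theta> k (D i) - tame_score \<theta> k (D i)\<bar> \<partial>full_law m \<theta>)"
      unfolding integral_mult_right_zero
      by (subst Bochner_Integration.integral_sum, rule comp(1)[OF _ id(1)], simp, rule refl)
    also have "\<dots> = 2 * (\<Sum>i<m. \<integral>x. \<bar>score \<theta> k x - tame_score \<theta> k x\<bar> \<partial>law \<theta>)"
      using comp(2)[OF _ id(1)] by simp
    also have "\<dots> \<le> 2 * (\<Sum>i<m. tail_bound)"
      unfolding tail_bound_def by (intro mult_left_mono sum_mono id(2)) auto
    also have "(\<integral>D. F k D * (\<Sum>i<m. tame_score \<theta> k (D i)) \<partial>full_law m \<theta>)
        \<le> 12 / 2 * (\<integral>D. (F k D)\<^sup>2 \<partial>full_law m \<theta>) + (\<Sum>i<m. \<integral>x. (c i k (enc i x))\<^sup>2 \<partial>law \<theta>) / (2 * 12)"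
      unfolding full_law_def
    proof (rule message_correlation_bound[where b=2 and E=enc and c="\<lambda>i. c i k" and S="\<lambda>_. tame_score \<theta> k"])
      show "F k \<in> borel_measurable (Pi\<^sub>M {..<m} (\<lambda>i. law \<theta>))" using Fk by (simp add: full_law_def[symmetric])
      show "F k x = F k y" if "\<And>i. i \<in> {..<m} \<Longrightarrow> enc i (x i) = enc i (y i)" for x y
        by (rule dep) (use that in auto)
    qed (use prob_space_law Fb enc' it tame_score_moments c2 c k in auto)
    finally show ?thesis by (simp add: mult_ac)
  qed
  have "(\<Sum>k<d. \<integral>D. F k D * total_score m \<theta> k D \<partial>full_law m \<theta>)
     \<le> (\<Sum>k<d. 6 * (\<integral>D. (F k D)\<^sup>2 \<partial>full_law m \<theta>) + (\<Sum>i<m. \<integral>x. (c i k (enc i x))\<^sup>2 \<partial>law \<theta>) / 24 + 2 * real m * tail_bound)"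
    by (intro sum_mono per_k) auto
  also have "\<dots> = 6 * (\<Sum>k<d. \<integral>D. (F k D)\<^sup>2 \<partial>full_law m \<theta>)
     + (\<Sum>i<m. \<Sum>k<d. \<integral>x. (c i k (enc i x))\<^sup>2 \<partial>law \<theta>) / 24 + 2 * real m * real d * tail_bound"
    unfolding sum.swap[of _ "{..<d}" "{..<m}"]
    by (simp add: sum.distrib sum_distrib_left[symmetric] sum_divide_distrib[symmetric])
  also have "(\<Sum>i<m. \<Sum>k<d. \<integral>x. (c i k (enc i x))\<^sup>2 \<partial>law \<theta>) \<le> (\<Sum>i<m. 2 * \<epsilon> * budget)"
    by (intro sum_mono information) auto
  \<comment> \<open>With \<open>\<epsilon> = 3 * q * (a / \<sigma>)^2\<close> the constants combine
    to \<open>2 * 3 / 24 = 1 / 4\<close>.\<close>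
  also have "\<dots> / 24 = real m * (real q * (a / \<sigma>)\<^sup>2) * budget / 4"
    by (simp add: \<epsilon>_def)
  finally show ?thesis unfolding budget_def by simp
qed

end

section \<open>A weighted van Trees inequality\<close>

text \<open>For fixed \<open>t\<close> this is the substitution
  \<open>x = f t + \<sigma> * e\<close>. It yields a dominating measure that does not depend on
  \<open>f\<close>.\<close>

lemma obs_law_eq_density:
  assumes f[measurable]: "f \<in> borel_measurable borel" and \<sigma>: "\<sigma> > 0"
  shows "obs_law \<sigma> f = density (unif01 \<Otimes>\<^sub>M lborel) (\<lambda>(t, x). ennreal (normal_density (f t) \<sigma> x))"
proof (rule measure_eqI)
  show "sets (obs_law \<sigma> f) = sets (density (unif01 \<Otimes>\<^sub>M lborel) (\<lambda>(t, x). ennreal (normal_density (f t) \<sigma> x)))"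
    unfolding sets_obs_law sets_density by (intro sets_pair_measure_cong) auto
  fix A assume "A \<in> sets (obs_law \<sigma> f)"
  then have A[measurable]: "A \<in> sets (borel \<Otimes>\<^sub>M borel)" by simp
  have A': "A \<in> sets (unif01 \<Otimes>\<^sub>M lborel)"
    using A sets_pair_measure_cong[of unif01 borel lborel borel] by simp
  have nd[measurable]: "(\<lambda>(t, x). ennreal (normal_density (f t) \<sigma> x)) \<in> borel_measurable (unif01 \<Otimes>\<^sub>M lborel)"
    unfolding normal_density_def split_beta' by measurable
  have m: "(\<lambda>(t, e). (t, f t + \<sigma> * e)) \<in> measurable (unif01 \<Otimes>\<^sub>M std_gauss) (borel \<Otimes>\<^sub>M borel)"
    by measurable
  have "emeasure (obs_law \<sigma> f) A = (\<integral>\<^sup>+p. indicator A (case p of (t, e) \<Rightarrow> (t, f t + \<sigma> * e)) \<partial>(unif01 \<Otimes>\<^sub>M std_gauss))"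
    unfolding obs_law_def using nn_integral_distr[OF m, of "indicator A"] by simp
  also have "\<dots> = (\<integral>\<^sup>+t. \<integral>\<^sup>+e. indicator A (t, f t + \<sigma> * e) \<partial>std_gauss \<partial>unif01)"
    using sigma_finite_measure.nn_integral_fst[OF prob_space_imp_sigma_finite[OF prob_space_std_gauss],
        of "\<lambda>p. indicator A (case p of (t, e) \<Rightarrow> (t, f t + \<sigma> * e))" unif01] by simp
  also have "\<dots> = (\<integral>\<^sup>+t. \<integral>\<^sup>+x. ennreal (normal_density (f t) \<sigma> x) * indicator A (t, x) \<partial>lborel \<partial>unif01)"
  proof (rule nn_integral_cong)
    fix t
    have "(\<integral>\<^sup>+x. ennreal (normal_density (f t) \<sigma> x) * indicator A (t, x) \<partial>lborel)
       = \<bar>\<sigma>\<bar> * (\<integral>\<^sup>+e. ennreal (normal_density (f t) \<sigma> (f t + \<sigma> * e)) * indicator A (t, f t + \<sigma> * e) \<partial>lborel)"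
      by (rule nn_integral_real_affine) (use \<sigma> in auto)
    also have "\<dots> = (\<integral>\<^sup>+e. ennreal \<sigma> * (ennreal (normal_density (f t) \<sigma> (f t + \<sigma> * e)) * indicator A (t, f t + \<sigma> * e)) \<partial>lborel)"
      using \<sigma> by (simp add: nn_integral_cmult)
    also have "\<dots> = (\<integral>\<^sup>+e. ennreal (std_normal_density e) * indicator A (t, f t + \<sigma> * e) \<partial>lborel)"
    proof (rule nn_integral_cong)
      fix e
      have "\<sigma> * normal_density (f t) \<sigma> (f t + \<sigma> * e) = std_normal_density e"
        using \<sigma> by (simp add: normal_density_def real_sqrt_mult power_mult_distrib)
      then have "ennreal \<sigma> * ennreal (normal_density (f t) \<sigma> (f t + \<sigma> * e)) = ennreal (std_normal_density e)"
        using \<sigma> by (metis ennreal_mult' less_imp_le)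
      then show "ennreal \<sigma> * (ennreal (normal_density (f t) \<sigma> (f t + \<sigma> * e)) * indicator A (t, f t + \<sigma> * e))
        = ennreal (std_normal_density e) * indicator A (t, f t + \<sigma> * e)"
        by (simp only: mult.assoc[symmetric])
    qed
    also have "\<dots> = (\<integral>\<^sup>+e. indicator A (t, f t + \<sigma> * e) \<partial>std_gauss)"
      by (subst nn_integral_density) auto
    finally show "(\<integral>\<^sup>+e. indicator A (t, f t + \<sigma> * e) \<partial>std_gauss)
      = (\<integral>\<^sup>+x. ennreal (normal_density (f t) \<sigma> x) * indicator A (t, x) \<partial>lborel)" ..
  qed
  also have "\<dots> = (\<integral>\<^sup>+p. (case p of (t, x) \<Rightarrow> ennreal (normal_density (f t) \<sigma> x)) * indicator A p \<partial>(unif01 \<Otimes>\<^sub>M lborel))"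
    using lborel.nn_integral_fst[of "\<lambda>p. (case p of (t, x) \<Rightarrow> ennreal (normal_density (f t) \<sigma> x)) * indicator A p" unif01] nd A'
    by simp
  also have "\<dots> = emeasure (density (unif01 \<Otimes>\<^sub>M lborel) (\<lambda>(t, x). ennreal (normal_density (f t) \<sigma> x))) A"
    by (rule emeasure_density[symmetric, OF nd A'])
  finally show "emeasure (obs_law \<sigma> f) A = emeasure (density (unif01 \<Otimes>\<^sub>M lborel) (\<lambda>(t, x). ennreal (normal_density (f t) \<sigma> x))) A" .
qed

section \<open>The uniform prior of one coordinate\<close>

definition prior1 :: "real measure" where
  "prior1 = density lborel (\<lambda>x. ennreal (indicator {-1..1} x / 2))"

lemma sets_prior1 [measurable_cong, simp]: "sets prior1 = sets borel"
  by (simp add: prior1_def)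

lemma space_prior1 [simp]: "space prior1 = UNIV"
  by (simp add: prior1_def)

lemma prob_space_prior1: "prob_space prior1"
proof
  have "emeasure prior1 (space prior1) = (\<integral>\<^sup>+x. ennreal (indicator {-1..1} x / 2) * indicator UNIV (x::real) \<partial>lborel)"
    unfolding space_prior1 unfolding prior1_def by (rule emeasure_density) auto
  also have "\<dots> = (\<integral>\<^sup>+x. ennreal (1 / 2) * indicator {-1..1} (x::real) \<partial>lborel)"
    by (intro nn_integral_cong) (simp split: split_indicator)
  also have "\<dots> = ennreal (1 / 2) * ennreal 2" by (subst nn_integral_cmult_indicator) auto
  also have "\<dots> = 1" by (subst ennreal_mult[symmetric]) auto
  finally show "emeasure prior1 (space prior1) = 1" .
qed

lemma AE_prior1: "AE x in prior1. x \<in> {-1..1}"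
  unfolding prior1_def by (subst AE_density) (auto simp: indicator_def)

lemma prior1_integral:
  fixes f :: "real \<Rightarrow> real"
  assumes [measurable]: "f \<in> borel_measurable borel"
  shows "(\<integral>x. f x \<partial>prior1) = (\<integral>x. f x * indicator {-1..1} x \<partial>lborel) / 2"
  unfolding prior1_def by (subst integral_density) (auto simp: mult.commute)

lemma prior1_FTC:
  fixes f F :: "real \<Rightarrow> real"
  assumes "\<And>t. (F has_real_derivative f t) (at t)" "\<And>t. isCont f t" "f \<in> borel_measurable borel" "F 1 = 0" "F (-1) = 0"
  shows "(\<integral>x. f x \<partial>prior1) = 0"
  using integral_FTC_Icc_real[of "-1" 1 F f] assms by (simp add: prior1_integral)

text \<open>The prior mean of the weight is the constant that the van Trees identity produces for
  every estimator.\<close>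

lemma prior1_weight: "(\<integral>t. 1 - t\<^sup>2 \<partial>prior1) = 2 / 3"
proof -
  have "(\<integral>t. (1 - t\<^sup>2) * indicator {-1..1} t \<partial>lborel) = (1 - 1 ^ 3 / 3) - ((-1) - (-1) ^ 3 / 3 :: real)"
    by (rule integral_FTC_Icc_real[where F="\<lambda>t. t - t ^ 3 / 3"])
       (auto intro!: derivative_eq_intros simp: power2_eq_square)
  then show ?thesis by (subst prior1_integral) auto
qed

section \<open>The likelihood of all data and its derivative in one coordinate\<close>

context bump_family
begin

text \<open>A dominating measure free of the parameter. The responses carry Lebesgue measure, so it
  is only sigma-finite, which is enough for Fubini.\<close>

definition base :: "nat \<Rightarrow> (nat \<Rightarrow> nat \<Rightarrow> real \<times> real) measure" where
  "base m = (\<Pi>\<^sub>M i\<in>{..<m}. \<Pi>\<^sub>M l\<in>{..<q}. unif01 \<Otimes>\<^sub>M lborel)"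

lemma sets_base [measurable_cong, simp]: "sets (base m) = sets (data_space m)"
proof -
  have "sets (unif01 \<Otimes>\<^sub>M lborel) = sets (borel \<Otimes>\<^sub>M borel)"
    by (intro sets_pair_measure_cong) auto
  then show ?thesis unfolding base_def by (intro sets_PiM_cong) auto
qed

lemma sigma_finite_unif01_lborel: "sigma_finite_measure (unif01 \<Otimes>\<^sub>M lborel)"
  by (intro sigma_finite_pair_measure prob_space_imp_sigma_finite prob_space_unif01 lborel.sigma_finite_measure_axioms)

lemma sigma_finite_base: "sigma_finite_measure (base m)"
proof -
  interpret I: product_sigma_finite "\<lambda>_::nat. unif01 \<Otimes>\<^sub>M lborel"
    using sigma_finite_unif01_lborel by (simp add: product_sigma_finite_def)
  interpret I1: finite_product_sigma_finite "\<lambda>_::nat. unif01 \<Otimes>\<^sub>M lborel" "{..<q}" by standard auto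
  interpret O: product_sigma_finite "\<lambda>_::nat. (\<Pi>\<^sub>M l\<in>{..<q}. unif01 \<Otimes>\<^sub>M lborel)"
    using I1.sigma_finite_measure_axioms by (simp add: product_sigma_finite_def)
  interpret O1: finite_product_sigma_finite "\<lambda>_::nat. (\<Pi>\<^sub>M l\<in>{..<q}. unif01 \<Otimes>\<^sub>M lborel)" "{..<m}" by standard auto
  show ?thesis unfolding base_def by (rule O1.sigma_finite_measure_axioms)
qed

definition lik :: "nat \<Rightarrow> (nat \<Rightarrow> real) \<Rightarrow> (nat \<Rightarrow> nat \<Rightarrow> real \<times> real) \<Rightarrow> real" where
  "lik m \<theta> D = (\<Prod>i<m. \<Prod>l<q. normal_density (signal \<theta> (fst (D i l))) \<sigma> (snd (D i l)))"

lemma lik_nonneg: "0 \<le> lik m \<theta> D"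
  unfolding lik_def by (intro prod_nonneg) auto

text \<open>With one exponential of a sum in place of a product over all observations, a single
  chain rule gives the derivative.\<close>

lemma lik_eq_exp:
  "lik m \<theta> D = (\<Prod>i<m. \<Prod>l<q. 1 / sqrt (2 * pi * \<sigma>\<^sup>2)) *
     exp (\<Sum>i<m. \<Sum>l<q. - (snd (D i l) - signal \<theta> (fst (D i l)))\<^sup>2 / (2 * \<sigma>\<^sup>2))"
proof -
  have "lik m \<theta> D = (\<Prod>i<m. \<Prod>l<q. (1 / sqrt (2 * pi * \<sigma>\<^sup>2)) *
      exp (- (snd (D i l) - signal \<theta> (fst (D i l)))\<^sup>2 / (2 * \<sigma>\<^sup>2)))"
    by (simp only: lik_def normal_density_def)
  then show ?thesis by (simp only: prod.distrib exp_sum finite_lessThan)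
qed

lemma law_eq_density:
  "law \<theta> = density (\<Pi>\<^sub>M l\<in>{..<q}. unif01 \<Otimes>\<^sub>M lborel)
     (\<lambda>D. \<Prod>l<q. case D l of (t, x) \<Rightarrow> ennreal (normal_density (signal \<theta> t) \<sigma> x))"
proof -
  have o: "obs_law \<sigma> (signal \<theta>) = density (unif01 \<Otimes>\<^sub>M lborel) (\<lambda>(t, x). ennreal (normal_density (signal \<theta> t) \<sigma> x))"
    by (rule obs_law_eq_density[OF signal_measurable \<sigma>])
  show ?thesis unfolding law_def o
  proof (rule PiM_density)
    show "product_sigma_finite (\<lambda>_::nat. unif01 \<Otimes>\<^sub>M lborel)"
      using sigma_finite_unif01_lborel by (simp add: product_sigma_finite_def)
    show "(\<lambda>(t, x). ennreal (normal_density (signal \<theta> t) \<sigma> x)) \<in> borel_measurable (unif01 \<Otimes>\<^sub>M lborel)"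
      unfolding normal_density_def split_beta' by measurable
    show "product_sigma_finite (\<lambda>_::nat. density (unif01 \<Otimes>\<^sub>M lborel) (\<lambda>(t, x). ennreal (normal_density (signal \<theta> t) \<sigma> x)))"
      unfolding o[symmetric] product_sigma_finite_def
      using prob_space_imp_sigma_finite[OF prob_space_obs_law[OF signal_measurable]] by simp
  qed auto
qed

lemma full_law_eq_density: "full_law m \<theta> = density (base m) (\<lambda>D. ennreal (lik m \<theta> D))"
proof -
  interpret I: product_sigma_finite "\<lambda>_::nat. unif01 \<Otimes>\<^sub>M lborel"
    using sigma_finite_unif01_lborel by (simp add: product_sigma_finite_def)
  interpret I1: finite_product_sigma_finite "\<lambda>_::nat. unif01 \<Otimes>\<^sub>M lborel" "{..<q}" by standard auto
  have "full_law m \<theta> = density (base m) (\<lambda>D. \<Prod>i<m. \<Prod>l<q. case D i l of (t, x) \<Rightarrow> ennreal (normal_density (signal \<theta> t) \<sigma> x))"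
    unfolding full_law_def law_eq_density base_def
  proof (rule PiM_density)
    show "product_sigma_finite (\<lambda>_::nat. \<Pi>\<^sub>M l\<in>{..<q}. unif01 \<Otimes>\<^sub>M lborel)"
      using I1.sigma_finite_measure_axioms by (simp add: product_sigma_finite_def)
    show "product_sigma_finite (\<lambda>_::nat. density (\<Pi>\<^sub>M l\<in>{..<q}. unif01 \<Otimes>\<^sub>M lborel)
       (\<lambda>D. \<Prod>l<q. case D l of (t, x) \<Rightarrow> ennreal (normal_density (signal \<theta> t) \<sigma> x)))"
      unfolding law_eq_density[symmetric] product_sigma_finite_def
      using prob_space_imp_sigma_finite[OF prob_space_law] by simp
    have nd: "(\<lambda>(t, x). ennreal (normal_density (signal \<theta> t) \<sigma> x)) \<in> borel_measurable (unif01 \<Otimes>\<^sub>M lborel)"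
      unfolding normal_density_def split_beta' by measurable
    have "(\<lambda>D. case D l of (t, x) \<Rightarrow> ennreal (normal_density (signal \<theta> t) \<sigma> x))
        \<in> borel_measurable (\<Pi>\<^sub>M l\<in>{..<q}. unif01 \<Otimes>\<^sub>M lborel)" if "l \<in> {..<q}" for l
      by (rule measurable_compose[OF measurable_component_singleton[OF that] nd])
    then show "(\<lambda>D. \<Prod>l<q. case D l of (t, x) \<Rightarrow> ennreal (normal_density (signal \<theta> t) \<sigma> x)) \<in> borel_measurable (\<Pi>\<^sub>M l\<in>{..<q}. unif01 \<Otimes>\<^sub>M lborel)"
      by (rule borel_measurable_prod_ennreal)
  qed auto
  also have "(\<lambda>D. \<Prod>i<m. \<Prod>l<q. case D i l of (t, x) \<Rightarrow> ennreal (normal_density (signal \<theta> t) \<sigma> x)) = (\<lambda>D. ennreal (lik m \<theta> D))"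
    unfolding lik_def by (simp add: split_beta' prod_ennreal prod_nonneg)
  finally show ?thesis .
qed

context
  fixes m :: nat
begin

text \<open>This and the following measurability facts treat the parameter as an argument next to
  the data, as Fubini between prior and data requires.\<close>

lemma joint_measurable_param:
  "r < d \<Longrightarrow> (\<lambda>p. fst p r) \<in> borel_measurable ((\<Pi>\<^sub>M r\<in>{..<d}. borel) \<Otimes>\<^sub>M data_space m)"
  by (rule measurable_compose[OF measurable_fst measurable_component_singleton]) simp

lemma joint_measurable_data:
  "i < m \<Longrightarrow> l < q \<Longrightarrow> (\<lambda>p. snd p i l) \<in> measurable ((\<Pi>\<^sub>M r\<in>{..<d}. borel :: real measure) \<Otimes>\<^sub>M data_space m) (borel \<Otimes>\<^sub>M borel)"
  by (rule measurable_compose[OF measurable_compose[OF measurable_snd measurable_component_singleton[of i]] measurable_component_singleton[of l]]) simp_all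

lemma joint_measurable_signal:
  assumes "i < m" "l < q"
  shows "(\<lambda>p. signal (fst p) (fst (snd p i l))) \<in> borel_measurable ((\<Pi>\<^sub>M r\<in>{..<d}. borel) \<Otimes>\<^sub>M data_space m)"
  unfolding signal_def
  by (intro borel_measurable_times borel_measurable_const borel_measurable_sum joint_measurable_param
      measurable_compose[OF measurable_compose[OF joint_measurable_data[OF assms] measurable_fst] \<psi>]) simp

lemma joint_measurable_lik:
  "(\<lambda>p. lik m (fst p) (snd p)) \<in> borel_measurable ((\<Pi>\<^sub>M r\<in>{..<d}. borel) \<Otimes>\<^sub>M data_space m)"
proof -
  have "(\<lambda>p. normal_density (signal (fst p) (fst (snd p i l))) \<sigma> (snd (snd p i l)))
      \<in> borel_measurable ((\<Pi>\<^sub>M r\<in>{..<d}. borel) \<Otimes>\<^sub>M data_space m)" if "i < m" "l < q" for i l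
  proof -
    note [measurable] = joint_measurable_signal[OF that] joint_measurable_data[OF that]
    show ?thesis unfolding normal_density_def by measurable
  qed
  then show ?thesis unfolding lik_def by (intro borel_measurable_prod) simp
qed

lemma joint_measurable_total_score:
  "(\<lambda>p. total_score m (fst p) k (snd p)) \<in> borel_measurable ((\<Pi>\<^sub>M r\<in>{..<d}. borel) \<Otimes>\<^sub>M data_space m)"
proof -
  have *: "(\<lambda>p. \<psi> k (fst (snd p i l)) * (snd (snd p i l) - signal (fst p) (fst (snd p i l))))
      \<in> borel_measurable ((\<Pi>\<^sub>M r\<in>{..<d}. borel) \<Otimes>\<^sub>M data_space m)" if "i < m" "l < q" for i l
  proof -
    note [measurable] = joint_measurable_signal[OF that] joint_measurable_data[OF that]
    show ?thesis by measurable
  qed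
  then show ?thesis unfolding total_score_def score_def
    by (intro borel_measurable_sum borel_measurable_times[OF borel_measurable_const] *) simp_all
qed

lemma lik_measurable [measurable]: "lik m \<theta> \<in> borel_measurable (data_space m)"
proof -
  have "(\<lambda>D. normal_density (signal \<theta> (fst (D i l))) \<sigma> (snd (D i l))) \<in> borel_measurable (data_space m)"
    if "i < m" "l < q" for i l
  proof -
    have [measurable]: "(\<lambda>D. D i l) \<in> measurable (data_space m) (borel \<Otimes>\<^sub>M borel)"
      using that by (intro measurable_compose[OF measurable_component_singleton[of i] measurable_component_singleton[of l]]) auto
    show ?thesis unfolding normal_density_def by measurable
  qed
  then show ?thesis unfolding lik_def by (intro borel_measurable_prod) simp
qed

lemma full_law_integral:
  fixes G :: "_ \<Rightarrow> real"
  assumes "G \<in> borel_measurable (data_space m)"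
  shows "(\<integral>D. G D \<partial>full_law m \<theta>) = (\<integral>D. lik m \<theta> D * G D \<partial>base m)"
  unfolding full_law_eq_density using assms lik_nonneg[of m \<theta>] by (subst integral_density) auto

lemma full_law_nn_integral:
  assumes "G \<in> borel_measurable (data_space m)"
  shows "(\<integral>\<^sup>+D. G D \<partial>full_law m \<theta>) = (\<integral>\<^sup>+D. ennreal (lik m \<theta> D) * G D \<partial>base m)"
  unfolding full_law_eq_density using assms by (subst nn_integral_density) auto

lemma signal_upd:
  assumes "k < d"
  shows "signal (\<theta>(k := t)) x = a * (\<Sum>r\<in>{..<d} - {k}. \<theta> r * \<psi> r x) + t * (a * \<psi> k x)"
proof -
  have "(\<Sum>r<d. (\<theta>(k := t)) r * \<psi> r x) = (\<theta>(k := t)) k * \<psi> k x + (\<Sum>r\<in>{..<d} - {k}. (\<theta>(k := t)) r * \<psi> r x)"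
    using assms by (intro sum.remove) auto
  also have "(\<Sum>r\<in>{..<d} - {k}. (\<theta>(k := t)) r * \<psi> r x) = (\<Sum>r\<in>{..<d} - {k}. \<theta> r * \<psi> r x)"
    by (intro sum.cong) auto
  finally show ?thesis unfolding signal_def by (simp add: algebra_simps)
qed

lemma lik_has_derivative:
  assumes k: "k < d"
  shows "((\<lambda>t. lik m (\<theta>(k := t)) D) has_real_derivative
    lik m (\<theta>(k := t)) D * total_score m (\<theta>(k := t)) k D) (at t)"
proof -
  let ?x = "\<lambda>i l. snd (D i l)" and ?s = "\<lambda>i l. a * (\<Sum>r\<in>{..<d} - {k}. \<theta> r * \<psi> r (fst (D i l)))"
    and ?c = "\<lambda>i l. a * \<psi> k (fst (D i l))"
  have 1: "((\<lambda>t. - (?x i l - (?s i l + t * ?c i l))\<^sup>2 / (2 * \<sigma>\<^sup>2)) has_real_derivative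
      (?x i l - (?s i l + t * ?c i l)) * ?c i l / \<sigma>\<^sup>2) (at t)" for i l
    using \<sigma> by (auto intro!: derivative_eq_intros simp: field_simps power2_eq_square)
  have 2: "((\<lambda>t. \<Sum>i<m. \<Sum>l<q. - (?x i l - (?s i l + t * ?c i l))\<^sup>2 / (2 * \<sigma>\<^sup>2)) has_real_derivative
      (\<Sum>i<m. \<Sum>l<q. (?x i l - (?s i l + t * ?c i l)) * ?c i l / \<sigma>\<^sup>2)) (at t)"
    by (intro DERIV_sum 1)
  have ts: "(\<Sum>i<m. \<Sum>l<q. (?x i l - (?s i l + t * ?c i l)) * ?c i l / \<sigma>\<^sup>2) = total_score m (\<theta>(k := t)) k D"
    unfolding total_score_def score_def signal_upd[OF k] sum_distrib_left
    by (intro sum.cong refl) (simp add: mult_ac)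
  show ?thesis
    unfolding ts[symmetric] lik_eq_exp signal_upd[OF k]
    by (rule DERIV_cong[OF DERIV_cmult[OF DERIV_fun_exp[OF 2]]]) (simp only: mult.assoc)
qed

lemma total_score_upd_continuous:
  assumes k: "k < d"
  shows "isCont (\<lambda>t. total_score m (\<theta>(k := t)) k D) t"
  unfolding total_score_def score_def signal_upd[OF k] by (intro continuous_intros)

text \<open>The integrand is \<open>(T - \<theta>\<^sub>k) \<cdot> \<partial>\<^sub>k(w p) / p\<close> for the likelihood \<open>p\<close> and the weight \<open>w = 1 - \<theta>\<^sub>k\<^sup>2\<close>. Since
  \<open>w\<close> vanishes at \<open>\<plusminus>1\<close>, integration by parts leaves no boundary term.\<close>

definition van_trees_integrand ::
    "nat \<Rightarrow> ((nat \<Rightarrow> nat \<Rightarrow> real \<times> real) \<Rightarrow> real) \<Rightarrow> (nat \<Rightarrow> real) \<Rightarrow> (nat \<Rightarrow> nat \<Rightarrow> real \<times> real) \<Rightarrow> real" where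
  "van_trees_integrand k T \<theta> D = (T D - \<theta> k) * (- 2 * \<theta> k + (1 - (\<theta> k)\<^sup>2) * total_score m \<theta> k D)"

context
  fixes k :: nat and T :: "(nat \<Rightarrow> nat \<Rightarrow> real \<times> real) \<Rightarrow> real"
  assumes k: "k < d" and T[measurable]: "T \<in> borel_measurable (data_space m)" and Tb: "\<And>D. \<bar>T D\<bar> \<le> 1"
begin

lemma van_trees_integrand_measurable [measurable]:
  "van_trees_integrand k T \<theta> \<in> borel_measurable (data_space m)"
  unfolding van_trees_integrand_def by measurable

lemma joint_measurable_van_trees_integrand:
  "(\<lambda>p. van_trees_integrand k T (fst p) (snd p)) \<in> borel_measurable ((\<Pi>\<^sub>M r\<in>{..<d}. borel) \<Otimes>\<^sub>M data_space m)"
proof -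
  note [measurable] = joint_measurable_param[OF k] joint_measurable_total_score
  show ?thesis unfolding van_trees_integrand_def by measurable
qed

text \<open>On the support of the prior this is a majorant free of \<open>\<theta>\<close>, which
  licenses Fubini. The numbers come from the bound 2 for the error and \<open>3 + S^2\<close> for
  the other factor, where \<open>S\<close> is the total score.\<close>

lemma van_trees_integrand_bound:
  assumes \<theta>: "\<bar>\<theta> k\<bar> \<le> 1"
  shows "(\<integral>\<^sup>+D. ennreal \<bar>van_trees_integrand k T \<theta> D\<bar> \<partial>full_law m \<theta>) \<le> ennreal (6 + 2 * (real m * (real q * (a / \<sigma>)\<^sup>2)))"
proof -
  interpret prob_space "full_law m \<theta>" by (rule prob_space_full_law)
  note ts = total_score_moments[OF k, of m \<theta>]
  have "(\<integral>\<^sup>+D. ennreal \<bar>van_trees_integrand k T \<theta> D\<bar> \<partial>full_law m \<theta>) \<le> (\<integral>\<^sup>+D. ennreal (6 + 2 * (total_score m \<theta> k D)\<^sup>2) \<partial>full_law m \<theta>)"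
  proof (intro nn_integral_mono ennreal_leI)
    fix D
    let ?s = "total_score m \<theta> k D"
    have s: "\<bar>?s\<bar> \<le> 1 + ?s\<^sup>2"
    proof -
      have "0 \<le> (\<bar>?s\<bar> - 1)\<^sup>2" by simp
      then have "2 * \<bar>?s\<bar> \<le> 1 + ?s\<^sup>2" by (simp add: power2_eq_square algebra_simps)
      then show ?thesis by simp
    qed
    have t: "0 \<le> 1 - (\<theta> k)\<^sup>2" "1 - (\<theta> k)\<^sup>2 \<le> 1" using \<theta> by (auto simp: abs_square_le_1)
    have "\<bar>- 2 * \<theta> k + (1 - (\<theta> k)\<^sup>2) * ?s\<bar> \<le> 2 * \<bar>\<theta> k\<bar> + (1 - (\<theta> k)\<^sup>2) * \<bar>?s\<bar>"
      using t by (intro order_trans[OF abs_triangle_ineq]) (simp add: abs_mult)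
    also have "\<dots> \<le> 2 + \<bar>?s\<bar>"
      using \<theta> t mult_right_mono[OF t(2), of "\<bar>?s\<bar>"] by simp
    also have "\<dots> \<le> 3 + ?s\<^sup>2" using s by simp
    finally have 1: "\<bar>- 2 * \<theta> k + (1 - (\<theta> k)\<^sup>2) * ?s\<bar> \<le> 3 + ?s\<^sup>2" .
    have 2: "\<bar>T D - \<theta> k\<bar> \<le> 2" using Tb[of D] \<theta> by simp
    have "\<bar>van_trees_integrand k T \<theta> D\<bar> \<le> 2 * (3 + ?s\<^sup>2)"
      unfolding van_trees_integrand_def abs_mult by (intro mult_mono 1 2) auto
    then show "\<bar>van_trees_integrand k T \<theta> D\<bar> \<le> 6 + 2 * ?s\<^sup>2" by simp
  qed
  also have "\<dots> = ennreal (\<integral>D. 6 + 2 * (total_score m \<theta> k D)\<^sup>2 \<partial>full_law m \<theta>)"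
    using ts by (intro nn_integral_eq_integral) auto
  also have "(\<integral>D. 6 + 2 * (total_score m \<theta> k D)\<^sup>2 \<partial>full_law m \<theta>) = 6 + 2 * (\<integral>D. (total_score m \<theta> k D)\<^sup>2 \<partial>full_law m \<theta>)"
    using ts(1) by (simp add: prob_space)
  also have "ennreal \<dots> \<le> ennreal (6 + 2 * (real m * (real q * (a / \<sigma>)\<^sup>2)))"
    using ts(2) by (intro ennreal_leI) auto
  finally show ?thesis .
qed

text \<open>The function \<open>(T - t) * (1 - t^2) * lik\<close> of \<open>t\<close> vanishes at
  both ends of the prior's support, so its derivative integrates to zero for every data point.
  Exchanging the integrals leaves the prior mean of the weight, whatever the estimator and the other
  coordinates are.\<close>

lemma van_trees_identity:
  assumes \<theta>: "\<theta> \<in> space (\<Pi>\<^sub>M r\<in>{..<d} - {k}. borel)"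
  shows "(\<integral>t. (\<integral>D. van_trees_integrand k T (\<theta>(k := t)) D \<partial>full_law m (\<theta>(k := t))) \<partial>prior1) = 2 / 3"
proof -
  interpret B: sigma_finite_measure "base m" by (rule sigma_finite_base)
  interpret P: prob_space prior1 by (rule prob_space_prior1)
  interpret PB: pair_sigma_finite prior1 "base m" ..
  let ?th = "\<lambda>t. \<theta>(k := t)"
  have "(\<lambda>t. ?th t) \<in> measurable borel (\<Pi>\<^sub>M r\<in>insert k ({..<d} - {k}). borel)"
    using measurable_component_update[OF \<theta>, of k] by simp
  then have th: "(\<lambda>t. ?th t) \<in> measurable borel (\<Pi>\<^sub>M r\<in>{..<d}. borel)"
    using k by (simp add: insert_absorb)
  have pair: "(\<lambda>p. (?th (fst p), snd p)) \<in> measurable (prior1 \<Otimes>\<^sub>M base m) ((\<Pi>\<^sub>M r\<in>{..<d}. borel) \<Otimes>\<^sub>M data_space m)"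
    by (intro measurable_Pair measurable_compose[OF _ th]) measurable
  define g where "g t D = lik m (?th t) D * van_trees_integrand k T (?th t) D" for t D
  \<comment> \<open>\<open>- h\<close> is the part of the derivative that comes from differentiating
    the factor \<open>T D - t\<close>; \<open>g\<close> collects the other two parts.\<close>
  define h where "h t D = (1 - t\<^sup>2) * lik m (?th t) D" for t D
  have lm[measurable]: "(\<lambda>p. lik m (?th (fst p)) (snd p)) \<in> borel_measurable (prior1 \<Otimes>\<^sub>M base m)"
    using measurable_compose[OF pair joint_measurable_lik] by simp
  have gm[measurable]: "case_prod g \<in> borel_measurable (prior1 \<Otimes>\<^sub>M base m)"
    unfolding g_def split_beta'
    using lm measurable_compose[OF pair joint_measurable_van_trees_integrand] by simp
  have hm[measurable]: "case_prod h \<in> borel_measurable (prior1 \<Otimes>\<^sub>M base m)"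
    unfolding h_def split_beta' by measurable
  have ig: "integrable (prior1 \<Otimes>\<^sub>M base m) (case_prod g)"
  proof (rule integrableI_bounded[OF gm])
    have "(\<integral>\<^sup>+p. ennreal (norm (case_prod g p)) \<partial>(prior1 \<Otimes>\<^sub>M base m)) = (\<integral>\<^sup>+t. \<integral>\<^sup>+D. ennreal (norm (g t D)) \<partial>base m \<partial>prior1)"
      by (subst B.nn_integral_fst[symmetric]) auto
    also have "\<dots> \<le> (\<integral>\<^sup>+t. ennreal (6 + 2 * (real m * (real q * (a / \<sigma>)\<^sup>2))) \<partial>prior1)"
    proof (rule nn_integral_mono_AE, use AE_prior1 in eventually_elim)
      fix t :: real assume t: "t \<in> {-1..1}"
      have "(\<integral>\<^sup>+D. ennreal (norm (g t D)) \<partial>base m) = (\<integral>\<^sup>+D. ennreal \<bar>van_trees_integrand k T (?th t) D\<bar> \<partial>full_law m (?th t))"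
        by (subst full_law_nn_integral, measurable, intro nn_integral_cong)
           (simp add: g_def abs_mult lik_nonneg ennreal_mult)
      also have "\<dots> \<le> ennreal (6 + 2 * (real m * (real q * (a / \<sigma>)\<^sup>2)))"
        by (rule van_trees_integrand_bound) (use t in auto)
      finally show "(\<integral>\<^sup>+D. ennreal (norm (g t D)) \<partial>base m) \<le> ennreal (6 + 2 * (real m * (real q * (a / \<sigma>)\<^sup>2)))" .
    qed
    also have "\<dots> < \<infinity>" using P.emeasure_space_1 by simp
    finally show "(\<integral>\<^sup>+p. ennreal (norm (case_prod g p)) \<partial>(prior1 \<Otimes>\<^sub>M base m)) < \<infinity>" .
  qed
  have lik1: "(\<integral>\<^sup>+D. ennreal (lik m \<theta>' D) \<partial>base m) = 1" for \<theta>'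
    using full_law_nn_integral[of "\<lambda>_. 1" \<theta>'] prob_space.emeasure_space_1[OF prob_space_full_law, of m \<theta>'] by simp
  have ih: "integrable (prior1 \<Otimes>\<^sub>M base m) (case_prod h)"
  proof (rule integrableI_bounded[OF hm])
    have "(\<integral>\<^sup>+p. ennreal (norm (case_prod h p)) \<partial>(prior1 \<Otimes>\<^sub>M base m)) = (\<integral>\<^sup>+t. \<integral>\<^sup>+D. ennreal (norm (h t D)) \<partial>base m \<partial>prior1)"
      by (subst B.nn_integral_fst[symmetric]) auto
    also have "\<dots> \<le> (\<integral>\<^sup>+t. 1 \<partial>prior1)"
    proof (rule nn_integral_mono_AE, use AE_prior1 in eventually_elim)
      fix t :: real assume "t \<in> {-1..1}"
      then have t: "\<bar>1 - t\<^sup>2\<bar> \<le> 1" by (auto simp: abs_le_iff abs_square_le_1)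
      have "(\<integral>\<^sup>+D. ennreal (norm (h t D)) \<partial>base m) \<le> (\<integral>\<^sup>+D. ennreal (lik m (?th t) D) \<partial>base m)"
        using mult_right_mono[OF t lik_nonneg]
        by (intro nn_integral_mono ennreal_leI) (simp add: h_def abs_mult lik_nonneg)
      then show "(\<integral>\<^sup>+D. ennreal (norm (h t D)) \<partial>base m) \<le> 1" by (simp add: lik1)
    qed
    also have "\<dots> < \<infinity>" using P.emeasure_space_1 by simp
    finally show "(\<integral>\<^sup>+p. ennreal (norm (case_prod h p)) \<partial>(prior1 \<Otimes>\<^sub>M base m)) < \<infinity>" .
  qed
  have liki: "(\<integral>D. lik m \<theta>' D \<partial>base m) = 1" for \<theta>'
    using lik1[of \<theta>'] lik_nonneg[of m \<theta>'] by (subst integral_eq_nn_integral) auto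
  have inner: "(\<integral>t. g t D - h t D \<partial>prior1) = 0" if D: "D \<in> space (base m)" for D
  proof (rule prior1_FTC[where F="\<lambda>t. (T D - t) * (1 - t\<^sup>2) * lik m (?th t) D"])
    show "((\<lambda>t. (T D - t) * (1 - t\<^sup>2) * lik m (?th t) D) has_real_derivative g t D - h t D) (at t)" for t
      unfolding g_def h_def van_trees_integrand_def
      by (rule derivative_eq_intros lik_has_derivative[OF k] refl)+ (simp add: algebra_simps power2_eq_square)
    have c: "isCont (\<lambda>t. g t D - h t D) t" for t
      unfolding g_def h_def van_trees_integrand_def
      using DERIV_isCont[OF lik_has_derivative[OF k, where \<theta>=\<theta> and D=D and t=t]]
          total_score_upd_continuous[OF k, where \<theta>=\<theta> and D=D and t=t]
      by (simp; intro continuous_intros)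
    then show "isCont (\<lambda>t. g t D - h t D) t" for t .
    show "(\<lambda>t. g t D - h t D) \<in> borel_measurable borel"
      using c by (intro borel_measurable_continuous_onI continuous_at_imp_continuous_on) auto
  qed auto
  have "(\<integral>t. (\<integral>D. van_trees_integrand k T (?th t) D \<partial>full_law m (?th t)) \<partial>prior1) = (\<integral>t. \<integral>D. g t D \<partial>base m \<partial>prior1)"
    unfolding g_def by (intro Bochner_Integration.integral_cong refl full_law_integral) measurable
  also have "\<dots> = (\<integral>p. case_prod g p \<partial>(prior1 \<Otimes>\<^sub>M base m))"
    using PB.integral_fst[OF ig] by simp
  also have "\<dots> = (\<integral>p. (case_prod g p - case_prod h p) \<partial>(prior1 \<Otimes>\<^sub>M base m)) + (\<integral>p. case_prod h p \<partial>(prior1 \<Otimes>\<^sub>M base m))"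
    unfolding Bochner_Integration.integral_diff[OF ig ih] by simp
  \<comment> \<open>The order of integration is reversed for the difference only: integrated over
    \<open>t\<close> first, it vanishes by \<open>inner\<close>.\<close>
  also have "(\<integral>p. (case_prod g p - case_prod h p) \<partial>(prior1 \<Otimes>\<^sub>M base m)) = (\<integral>D. \<integral>t. g t D - h t D \<partial>prior1 \<partial>base m)"
  proof -
    have "integrable (prior1 \<Otimes>\<^sub>M base m) (case_prod (\<lambda>t D. g t D - h t D))"
      using Bochner_Integration.integrable_diff[OF ig ih] by (simp add: split_beta')
    from PB.integral_snd[OF this] show ?thesis by (simp add: split_beta')
  qed
  also have "\<dots> = (\<integral>D. 0 \<partial>base m)" by (intro Bochner_Integration.integral_cong refl inner)
  also have "(\<integral>p. case_prod h p \<partial>(prior1 \<Otimes>\<^sub>M base m)) = (\<integral>t. \<integral>D. h t D \<partial>base m \<partial>prior1)"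
    using PB.integral_fst[OF ih] by simp
  also have "\<dots> = (\<integral>t. 1 - t\<^sup>2 \<partial>prior1)" unfolding h_def by (simp add: liki)
  finally show ?thesis
    by (simp only: prior1_weight Bochner_Integration.integral_zero add_0_left)
qed

end

end

text \<open>The identity holds with the other coordinates frozen, hence also on average over the
  product prior. Summed over \<open>k\<close> it gives \<open>2 / 3 * d\<close>, which an upper
  bound valid on the whole cube cannot undercut.\<close>

lemma van_trees_average:
  fixes T :: "nat \<Rightarrow> (nat \<Rightarrow> nat \<Rightarrow> real \<times> real) \<Rightarrow> real"
  assumes T: "\<And>k. k < d \<Longrightarrow> T k \<in> borel_measurable (data_space m)" and Tb: "\<And>k D. \<bar>T k D\<bar> \<le> 1"
    and M: "\<And>\<theta>. (\<And>r. r < d \<Longrightarrow> \<bar>\<theta> r\<bar> \<le> 1) \<Longrightarrow>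
      (\<Sum>k<d. \<integral>D. van_trees_integrand m k (T k) \<theta> D \<partial>full_law m \<theta>) \<le> M"
  shows "2 / 3 * real d \<le> M"
proof -
  interpret product_prob_space "\<lambda>_::nat. prior1" "{..<d}" by (rule product_prob_spaceI[OF prob_space_prior1])
  define \<rho> where "\<rho> = (\<Pi>\<^sub>M r\<in>{..<d}. prior1)"
  interpret R: prob_space \<rho> unfolding \<rho>_def by (intro prob_space_PiM prob_space_prior1)
  interpret B: sigma_finite_measure "base m" by (rule sigma_finite_base)
  define H where "H k \<theta> = (\<integral>D. van_trees_integrand m k (T k) \<theta> D \<partial>full_law m \<theta>)" for k \<theta>
  have sets_\<rho>: "sets \<rho> = sets (\<Pi>\<^sub>M r\<in>{..<d}. borel)" unfolding \<rho>_def by (intro sets_PiM_cong) auto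
  have AE: "AE \<theta> in \<rho>. \<forall>r<d. \<bar>\<theta> r\<bar> \<le> 1"
  proof -
    have "AE \<theta> in \<rho>. \<forall>r\<in>{..<d}. \<theta> r \<in> {-1..1}"
      unfolding \<rho>_def by (intro AE_finite_allI AE_PiM_component[OF prob_space_prior1 _ AE_prior1]) auto
    then show ?thesis by eventually_elim (auto simp: abs_le_iff)
  qed
  have Hm: "H k \<in> borel_measurable \<rho>" if k: "k < d" for k
  proof -
    have "(\<lambda>p. lik m (fst p) (snd p) * van_trees_integrand m k (T k) (fst p) (snd p)) \<in> borel_measurable ((\<Pi>\<^sub>M r\<in>{..<d}. borel) \<Otimes>\<^sub>M data_space m)"
      by (intro borel_measurable_times joint_measurable_lik joint_measurable_van_trees_integrand k T Tb)
    then have "(\<lambda>(\<theta>, D). lik m \<theta> D * van_trees_integrand m k (T k) \<theta> D) \<in> borel_measurable (\<rho> \<Otimes>\<^sub>M base m)"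
      using sets_pair_measure_cong[OF sets_\<rho> sets_base[of m]]
      by (simp add: split_beta' cong: measurable_cong_sets)
    from B.borel_measurable_lebesgue_integral[OF this]
    have "(\<lambda>\<theta>. \<integral>D. lik m \<theta> D * van_trees_integrand m k (T k) \<theta> D \<partial>base m) \<in> borel_measurable \<rho>" by simp
    moreover have "H k = (\<lambda>\<theta>. \<integral>D. lik m \<theta> D * van_trees_integrand m k (T k) \<theta> D \<partial>base m)"
      unfolding H_def by (intro ext full_law_integral van_trees_integrand_measurable[OF k T[OF k] Tb])
    ultimately show ?thesis by (simp only:)
  qed
  have Hb: "\<bar>H k \<theta>\<bar> \<le> 6 + 2 * (real m * (real q * (a / \<sigma>)\<^sup>2))" if k: "k < d" and "\<bar>\<theta> k\<bar> \<le> 1" for k \<theta>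
  proof -
    have "ennreal \<bar>H k \<theta>\<bar> \<le> (\<integral>\<^sup>+D. ennreal \<bar>van_trees_integrand m k (T k) \<theta> D\<bar> \<partial>full_law m \<theta>)"
    proof (cases "integrable (full_law m \<theta>) (van_trees_integrand m k (T k) \<theta>)")
      case True then show ?thesis unfolding H_def using integral_norm_bound_ennreal[OF True] by simp
    next
      \<comment> \<open>A function that is not integrable has Bochner integral 0, so the bound holds
        here as well.\<close>
      case False then show ?thesis unfolding H_def by (simp add: not_integrable_integral_eq)
    qed
    also have "\<dots> \<le> ennreal (6 + 2 * (real m * (real q * (a / \<sigma>)\<^sup>2)))"
      by (rule van_trees_integrand_bound[OF k T[OF k] Tb]) fact
    finally show ?thesis by (subst (asm) ennreal_le_iff) (auto intro!: add_nonneg_nonneg)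
  qed
  have Hi: "integrable \<rho> (H k)" if k: "k < d" for k
    by (rule R.integrable_const_bound[where B="6 + 2 * (real m * (real q * (a / \<sigma>)\<^sup>2))"])
       (use AE Hb[OF k] k Hm[OF k] in \<open>auto elim!: eventually_mono\<close>)
  have HI: "(\<integral>\<theta>. H k \<theta> \<partial>\<rho>) = 2 / 3" if k: "k < d" for k
  proof -
    have ins: "insert k ({..<d} - {k}) = {..<d}" using k by auto
    have "(\<integral>\<theta>. H k \<theta> \<partial>\<rho>) = (\<integral>\<theta>. (\<integral>t. H k (\<theta>(k := t)) \<partial>prior1) \<partial>(\<Pi>\<^sub>M r\<in>{..<d} - {k}. prior1))"
      using product_integral_insert[of "{..<d} - {k}" k "H k"] Hi[OF k] unfolding ins \<rho>_def by simp
    also have "\<dots> = (\<integral>\<theta>. 2 / 3 \<partial>(\<Pi>\<^sub>M r\<in>{..<d} - {k}. prior1))"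
    proof (intro Bochner_Integration.integral_cong refl)
      fix \<theta> assume "\<theta> \<in> space (\<Pi>\<^sub>M r\<in>{..<d} - {k}. prior1)"
      then have "\<theta> \<in> space (\<Pi>\<^sub>M r\<in>{..<d} - {k}. borel :: real measure)" by (simp add: space_PiM)
      from van_trees_identity[OF k T[OF k] Tb this]
      show "(\<integral>t. H k (\<theta>(k := t)) \<partial>prior1) = 2 / 3" unfolding H_def by simp
    qed
    also have "\<dots> = 2 / 3"
      using prob_space.prob_space[OF prob_space_PiM[OF prob_space_prior1]] by simp
    finally show ?thesis .
  qed
  have "2 / 3 * real d = (\<integral>\<theta>. (\<Sum>k<d. H k \<theta>) \<partial>\<rho>)"
  proof -
    have "(\<integral>\<theta>. (\<Sum>k<d. H k \<theta>) \<partial>\<rho>) = (\<Sum>k<d. \<integral>\<theta>. H k \<theta> \<partial>\<rho>)"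
      using Hi by (intro Bochner_Integration.integral_sum) simp
    also have "\<dots> = (\<Sum>k<d. 2 / 3)" using HI by (intro sum.cong) auto
    finally show ?thesis by simp
  qed
  also have "\<dots> \<le> (\<integral>\<theta>. M \<partial>\<rho>)"
  proof (rule integral_mono_AE)
    show "integrable \<rho> (\<lambda>\<theta>. \<Sum>k<d. H k \<theta>)" using Hi by (intro Bochner_Integration.integrable_sum) auto
    show "AE \<theta> in \<rho>. (\<Sum>k<d. H k \<theta>) \<le> M"
      using AE by eventually_elim (auto simp: H_def intro!: M)
  qed simp
  also have "\<dots> = M" by (simp add: R.prob_space)
  finally show ?thesis .
qed

end

section \<open>A hard parameter\<close>

lemma unif01_integral:
  fixes f :: "real \<Rightarrow> real"
  assumes [measurable]: "f \<in> borel_measurable borel"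
  shows "(\<integral>x. f x \<partial>unif01) = (LINT x:{0..1}|lborel. f x)"
proof -
  have u: "unif01 = density lborel (\<lambda>x. ennreal (indicator {0<..<1} x))"
    unfolding uniform_measure_def by (intro arg_cong[where f="density lborel"] ext) (simp split: split_indicator)
  have "(\<integral>x. f x \<partial>unif01) = (\<integral>x. indicator {0<..<1} x *\<^sub>R f x \<partial>lborel)"
    unfolding u by (rule integral_density) auto
  also have "\<dots> = (\<integral>x. indicator {0..1} x *\<^sub>R f x \<partial>lborel)"
  proof (rule integral_cong_AE)
    have "AE x in lborel. x \<noteq> (0::real)" "AE x in lborel. x \<noteq> (1::real)"
      by (rule AE_lborel_singleton)+
    then show "AE x in lborel. indicator {0<..<1} x *\<^sub>R f x = indicator {0..1} x *\<^sub>R f x"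
      by eventually_elim (auto simp: indicator_def)
  qed measurable
  finally show ?thesis unfolding set_lebesgue_integral_def .
qed

section \<open>Bessel's inequality on the unit interval\<close>

abbreviation leb01 :: "real measure" where
  "leb01 \<equiv> restrict_space lborel {0..1}"

lemma leb01_convert:
  fixes f g :: "real \<Rightarrow> real"
  shows "inner01 f g = (\<integral>x. f x * g x \<partial>leb01)"
    and "f \<in> L2_01 \<Longrightarrow> f \<in> borel_measurable leb01"
    and "f \<in> L2_01 \<Longrightarrow> integrable leb01 (\<lambda>x. (f x)\<^sup>2)"
    and "dist01_sq f g = (\<integral>\<^sup>+x. ennreal ((f x - g x)\<^sup>2) \<partial>leb01)"
  unfolding inner01_def dist01_sq_def L2_01_def set_lebesgue_integral_def set_integrable_def
  by (auto simp: integral_restrict_space integrable_restrict_space nn_integral_restrict_space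
      set_integrable_def intro: measurable_restrict_space1)

text \<open>The squared distance is expanded for general coefficients \<open>w\<close>. Taking the
  coefficients \<open>u\<close> of \<open>g\<close> gives Bessel's inequality; taking
  \<open>c\<close> gives the claim, because the two sides then differ exactly by the squared norm of
  \<open>g\<close> minus the sum of the \<open>(u r)^2\<close>.\<close>

lemma bessel_dist01:
  fixes e :: "nat \<Rightarrow> real \<Rightarrow> real"
  assumes g: "g \<in> L2_01" and e: "\<And>r. r < d \<Longrightarrow> e r \<in> L2_01"
    and on: "\<And>r r'. r < d \<Longrightarrow> r' < d \<Longrightarrow> inner01 (e r) (e r') = of_bool (r = r')"
  shows "ennreal (\<Sum>r<d. (inner01 g (e r) - c r)\<^sup>2) \<le> dist01_sq g (\<lambda>x. \<Sum>r<d. c r * e r x)"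
proof -
  note em = leb01_convert(2)[OF e] and e2 = leb01_convert(3)[OF e]
    and gm = leb01_convert(2)[OF g] and g2 = leb01_convert(3)[OF g]
  define u where "u r = inner01 g (e r)" for r
  have ee: "integrable leb01 (\<lambda>x. e r x * e r' x)" if "r < d" "r' < d" for r r'
    using that by (intro integrable_mult_of_squares em e2)
  have ge: "integrable leb01 (\<lambda>x. g x * e r x)" if "r < d" for r
    using that by (intro integrable_mult_of_squares em e2 gm g2)
  have expand: "(g x - (\<Sum>r<d. w r * e r x))\<^sup>2
    = (g x)\<^sup>2 - (\<Sum>r<d. 2 * w r * (g x * e r x)) + (\<Sum>r<d. \<Sum>r'<d. w r * w r' * (e r x * e r' x))" for w x
    by (simp add: power2_diff power2_eq_square[of "sum _ _"] sum_product sum_distrib_left mult_ac)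
  have int: "integrable leb01 (\<lambda>x. (g x - (\<Sum>r<d. w r * e r x))\<^sup>2)" for w
    unfolding expand
    by (intro Bochner_Integration.integrable_add Bochner_Integration.integrable_diff g2
        Bochner_Integration.integrable_sum integrable_mult_right ge ee) simp_all
  have val: "(\<integral>x. (g x - (\<Sum>r<d. w r * e r x))\<^sup>2 \<partial>leb01) = (\<integral>x. (g x)\<^sup>2 \<partial>leb01) - (\<Sum>r<d. 2 * w r * u r) + (\<Sum>r<d. (w r)\<^sup>2)" for w
  proof -
    have i1: "integrable leb01 (\<lambda>x. \<Sum>r<d. 2 * w r * (g x * e r x))"
      by (intro Bochner_Integration.integrable_sum integrable_mult_right ge) simp
    have i2: "integrable leb01 (\<lambda>x. \<Sum>r<d. \<Sum>r'<d. w r * w r' * (e r x * e r' x))"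
      by (intro Bochner_Integration.integrable_sum integrable_mult_right ee) simp_all
    have "(\<integral>x. (\<Sum>r<d. 2 * w r * (g x * e r x)) \<partial>leb01) = (\<Sum>r<d. 2 * w r * u r)"
      by (subst Bochner_Integration.integral_sum) (auto intro!: integrable_mult_right ge simp: u_def leb01_convert)
    moreover have "(\<integral>x. (\<Sum>r<d. \<Sum>r'<d. w r * w r' * (e r x * e r' x)) \<partial>leb01) = (\<Sum>r<d. (w r)\<^sup>2)"
    proof -
      have "(\<integral>x. (\<Sum>r<d. \<Sum>r'<d. w r * w r' * (e r x * e r' x)) \<partial>leb01)
         = (\<Sum>r<d. \<integral>x. (\<Sum>r'<d. w r * w r' * (e r x * e r' x)) \<partial>leb01)"
        by (rule Bochner_Integration.integral_sum) (intro Bochner_Integration.integrable_sum integrable_mult_right ee, simp_all)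
      also have "\<dots> = (\<Sum>r<d. \<Sum>r'<d. \<integral>x. w r * w r' * (e r x * e r' x) \<partial>leb01)"
        by (intro sum.cong refl Bochner_Integration.integral_sum integrable_mult_right ee) simp_all
      also have "\<dots> = (\<Sum>r<d. \<Sum>r'<d. if r = r' then (w r)\<^sup>2 else 0)"
        using on by (intro sum.cong refl) (auto simp: leb01_convert(1)[symmetric] power2_eq_square)
      also have "\<dots> = (\<Sum>r<d. (w r)\<^sup>2)" by simp
      finally show ?thesis .
    qed
    ultimately show ?thesis unfolding expand using i1 i2 g2 by simp
  qed
  have "0 \<le> (\<integral>x. (g x - (\<Sum>r<d. u r * e r x))\<^sup>2 \<partial>leb01)" by simp
  then have "(\<Sum>r<d. (u r)\<^sup>2) \<le> (\<integral>x. (g x)\<^sup>2 \<partial>leb01)"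
    unfolding val by (simp add: power2_eq_square sum_distrib_left[symmetric] mult.assoc)
  moreover have "(\<Sum>r<d. (u r - c r)\<^sup>2) = (\<Sum>r<d. (u r)\<^sup>2) - (\<Sum>r<d. 2 * c r * u r) + (\<Sum>r<d. (c r)\<^sup>2)"
    by (simp add: power2_diff sum.distrib sum_subtractf algebra_simps)
  ultimately have "(\<Sum>r<d. (u r - c r)\<^sup>2) \<le> (\<integral>x. (g x - (\<Sum>r<d. c r * e r x))\<^sup>2 \<partial>leb01)"
    unfolding val by linarith
  then show ?thesis
    unfolding leb01_convert(4) u_def using int[of c]
    by (subst nn_integral_eq_integral) (auto intro: ennreal_leI)
qed

context bump_family
begin

text \<open>If the risk were below \<open>d / 100\<close> on the whole cube, the van Trees sum would
  be at most \<open>6 * d / 100 + d / 6\<close> from the term \<open>- 2 * \<theta> k\<close> plus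
  \<open>6 * d / 100 + d / 3\<close> from \<open>corr\<close>, that is, \<open>62 / 100 * d\<close>,
  which is less than \<open>2 / 3 * d\<close>. In \<open>corr\<close> the function \<open>F\<close>
  factors through the estimates \<open>T\<close>, so the bound can be supplied either from the
  messages or from the full data.\<close>

lemma exists_bad_parameter:
  fixes T :: "nat \<Rightarrow> (nat \<Rightarrow> nat \<Rightarrow> real \<times> real) \<Rightarrow> real"
  assumes "d > 0" and T: "\<And>k. k < d \<Longrightarrow> T k \<in> borel_measurable (data_space m)" and Tb: "\<And>k D. \<bar>T k D\<bar> \<le> 1"
    and corr: "\<And>\<theta> F. (\<And>r. r < d \<Longrightarrow> \<bar>\<theta> r\<bar> \<le> 1) \<Longrightarrow> (\<And>k. k < d \<Longrightarrow> F k \<in> borel_measurable (data_space m)) \<Longrightarrow>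
        (\<And>k D. \<bar>F k D\<bar> \<le> 2) \<Longrightarrow> (\<And>k D D'. (\<And>i. T i D = T i D') \<Longrightarrow> F k D = F k D') \<Longrightarrow>
        (\<Sum>k<d. \<integral>D. F k D * total_score m \<theta> k D \<partial>full_law m \<theta>)
          \<le> 6 * (\<Sum>k<d. \<integral>D. (F k D)\<^sup>2 \<partial>full_law m \<theta>) + real d / 3"
  shows "\<exists>\<theta>. (\<forall>r<d. \<bar>\<theta> r\<bar> \<le> 1) \<and> real d / 100 \<le> (\<Sum>k<d. \<integral>D. (T k D - \<theta> k)\<^sup>2 \<partial>full_law m \<theta>)"
proof (rule ccontr)
  assume "\<not> ?thesis"
  then have small: "(\<Sum>k<d. \<integral>D. (T k D - \<theta> k)\<^sup>2 \<partial>full_law m \<theta>) < real d / 100" if "\<And>r. r < d \<Longrightarrow> \<bar>\<theta> r\<bar> \<le> 1" for \<theta>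
    using that by (meson not_le)
  have "2 / 3 * real d \<le> 62 / 100 * real d"
  proof (rule van_trees_average[OF T Tb])
    fix \<theta> :: "nat \<Rightarrow> real" assume \<theta>: "\<And>r. r < d \<Longrightarrow> \<bar>\<theta> r\<bar> \<le> 1"
    interpret P: prob_space "full_law m \<theta>" by (rule prob_space_full_law)
    \<comment> \<open>The estimation error times the van Trees weight. The zero branch makes the
      bound by 2 hold for every index.\<close>
    define F where "F k D = (if k < d then (T k D - \<theta> k) * (1 - (\<theta> k)\<^sup>2) else 0)" for k D
    have w: "0 \<le> 1 - (\<theta> k)\<^sup>2" "1 - (\<theta> k)\<^sup>2 \<le> 1" if "k < d" for k
      using \<theta>[OF that] by (auto simp: abs_square_le_1)
    have T\<theta>: "\<bar>T k D - \<theta> k\<bar> \<le> 2" if "k < d" for k D using Tb[of k D] \<theta>[OF that] by simp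
    have F_le: "\<bar>F k D\<bar> \<le> \<bar>T k D - \<theta> k\<bar>" if "k < d" for k D
      using mult_left_mono[OF w(2)[OF that], of "\<bar>T k D - \<theta> k\<bar>"] w[OF that] that
      by (simp add: F_def abs_mult)
    have Fb: "\<bar>F k D\<bar> \<le> 2" for k D
      using order_trans[OF F_le T\<theta>] by (cases "k < d") (auto simp: F_def)
    have Fm: "F k \<in> borel_measurable (data_space m)" if "k < d" for k
      using T[OF that] unfolding F_def by simp
    have sq4: "(x::real)\<^sup>2 \<le> 4" if "\<bar>x\<bar> \<le> 2" for x using power_mono[OF that, of 2] by simp
    have i1: "integrable (full_law m \<theta>) (\<lambda>D. (T k D - \<theta> k)\<^sup>2)" if "k < d" for k
      using T[OF that] sq4[OF T\<theta>[OF that]] by (intro P.integrable_const_bound[of _ 4]) auto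
    have i2: "integrable (full_law m \<theta>) (\<lambda>D. (F k D)\<^sup>2)" if "k < d" for k
      using Fm[OF that] sq4[OF Fb] by (intro P.integrable_const_bound[of _ 4]) auto
    have i3: "integrable (full_law m \<theta>) (\<lambda>D. F k D * total_score m \<theta> k D)" if "k < d" for k
      using Fm[OF that] by (intro integrable_mult_of_squares i2 total_score_moments that) auto
    have one: "(\<integral>D. van_trees_integrand m k (T k) \<theta> D \<partial>full_law m \<theta>)
      \<le> 6 * (\<integral>D. (T k D - \<theta> k)\<^sup>2 \<partial>full_law m \<theta>) + 1 / 6 + (\<integral>D. F k D * total_score m \<theta> k D \<partial>full_law m \<theta>)"
      if k: "k < d" for k
    proof -
      have i4: "integrable (full_law m \<theta>) (\<lambda>D. (T k D - \<theta> k) * (- 2 * \<theta> k))"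
        using T[OF k] T\<theta>[OF k]
        by (intro integrable_mult_left P.integrable_const_bound[of _ 2]) auto
      have split: "van_trees_integrand m k (T k) \<theta> D = (T k D - \<theta> k) * (- 2 * \<theta> k) + F k D * total_score m \<theta> k D" for D
        using k by (simp add: van_trees_integrand_def F_def algebra_simps)
      have "(\<integral>D. van_trees_integrand m k (T k) \<theta> D \<partial>full_law m \<theta>)
         = (\<integral>D. (T k D - \<theta> k) * (- 2 * \<theta> k) \<partial>full_law m \<theta>) + (\<integral>D. F k D * total_score m \<theta> k D \<partial>full_law m \<theta>)"
        unfolding split by (rule Bochner_Integration.integral_add[OF i4 i3[OF k]])
      also have "(\<integral>D. (T k D - \<theta> k) * (- 2 * \<theta> k) \<partial>full_law m \<theta>) \<le> (\<integral>D. 6 * (T k D - \<theta> k)\<^sup>2 + 1 / 6 \<partial>full_law m \<theta>)"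
      proof (rule integral_mono[OF i4])
        show "integrable (full_law m \<theta>) (\<lambda>D. 6 * (T k D - \<theta> k)\<^sup>2 + 1 / 6)" using i1[OF k] by simp
        fix D
        \<comment> \<open>Young's inequality with parameter 12 turns this square into
          \<open>4 / 24 = 1 / 6\<close>.\<close>
        have "(- 2 * \<theta> k)\<^sup>2 \<le> 4" using \<theta>[OF k] by (intro sq4) (simp add: abs_mult)
        then show "(T k D - \<theta> k) * (- 2 * \<theta> k) \<le> 6 * (T k D - \<theta> k)\<^sup>2 + 1 / 6"
          using mult_le_weighted_squares[of 12 "T k D - \<theta> k" "- 2 * \<theta> k"] by linarith
      qed
      also have "\<dots> = 6 * (\<integral>D. (T k D - \<theta> k)\<^sup>2 \<partial>full_law m \<theta>) + 1 / 6"
        using i1[OF k] by (simp add: P.prob_space)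
      finally show ?thesis by simp
    qed
    have c: "(\<Sum>k<d. \<integral>D. F k D * total_score m \<theta> k D \<partial>full_law m \<theta>) \<le> 6 * (\<Sum>k<d. \<integral>D. (F k D)\<^sup>2 \<partial>full_law m \<theta>) + real d / 3"
      by (rule corr[OF \<theta> Fm Fb]) (auto simp: F_def)
    have f2: "(\<Sum>k<d. \<integral>D. (F k D)\<^sup>2 \<partial>full_law m \<theta>) \<le> (\<Sum>k<d. \<integral>D. (T k D - \<theta> k)\<^sup>2 \<partial>full_law m \<theta>)"
      using i1 i2 F_le by (intro sum_mono integral_mono) (auto simp: abs_le_square_iff)
    have "(\<Sum>k<d. \<integral>D. van_trees_integrand m k (T k) \<theta> D \<partial>full_law m \<theta>)
       \<le> (\<Sum>k<d. 6 * (\<integral>D. (T k D - \<theta> k)\<^sup>2 \<partial>full_law m \<theta>) + 1 / 6 + (\<integral>D. F k D * total_score m \<theta> k D \<partial>full_law m \<theta>))"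
      by (intro sum_mono one) simp
    also have "\<dots> = 6 * (\<Sum>k<d. \<integral>D. (T k D - \<theta> k)\<^sup>2 \<partial>full_law m \<theta>) + real d / 6
        + (\<Sum>k<d. \<integral>D. F k D * total_score m \<theta> k D \<partial>full_law m \<theta>)"
      by (simp add: sum.distrib sum_distrib_left[symmetric])
    also have "\<dots> \<le> 62 / 100 * real d"
    proof -
      have "(\<Sum>k<d. \<integral>D. (T k D - \<theta> k)\<^sup>2 \<partial>full_law m \<theta>) < real d / 100"
        by (rule small) (rule \<theta>)
      with c f2 show ?thesis by linarith
    qed
    finally show "(\<Sum>k<d. \<integral>D. van_trees_integrand m k (T k) \<theta> D \<partial>full_law m \<theta>) \<le> 62 / 100 * real d" .
  qed
  with \<open>d > 0\<close> show False by simp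
qed

end

section \<open>Interior wavelets\<close>

text \<open>Both facts are read off the two-scale relation: the filter and the father wavelet live
  on [1-N,N], and \<open>2 * x - n\<close> leaves this interval for each \<open>n\<close> in it as
  soon as \<open>x\<close> does.\<close>

lemma mother_bounded_support:
  assumes "daubechies N \<phi> \<psi>"
  obtains C where "C > 0" "\<And>x. \<bar>\<psi> x\<bar> \<le> C" "\<And>x. \<psi> x \<noteq> 0 \<Longrightarrow> 1 - real N \<le> x \<and> x \<le> real N"
proof -
  from assms obtain h :: "int \<Rightarrow> real" where b: "bounded (range \<phi>)"
    and supp: "\<And>x. x \<notin> {1 - real N .. real N} \<Longrightarrow> \<phi> x = 0"
    and h: "\<And>x. \<psi> x = sqrt 2 * (\<Sum>n = 1 - int N..int N. (-1) powi n * h (1 - n) * \<phi> (2 * x - of_int n))"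
    unfolding daubechies_def by blast
  from b obtain K where K: "\<And>x. \<bar>\<phi> x\<bar> \<le> K" unfolding bounded_iff by auto
  have K0: "K \<ge> 0" using K[of 0] by linarith
  define C where "C = sqrt 2 * (\<Sum>n = 1 - int N..int N. \<bar>h (1 - n)\<bar> * K) + 1"
  have "C > 0" unfolding C_def using K0 by (intro add_nonneg_pos mult_nonneg_nonneg sum_nonneg) auto
  moreover have "\<bar>\<psi> x\<bar> \<le> C" for x
  proof -
    have "\<bar>\<Sum>n = 1 - int N..int N. (-1) powi n * h (1 - n) * \<phi> (2 * x - of_int n)\<bar>
       \<le> (\<Sum>n = 1 - int N..int N. \<bar>h (1 - n)\<bar> * K)"
    proof (rule order_trans[OF sum_abs sum_mono])
      fix n
      have "\<bar>(-1) powi n :: real\<bar> = 1" by (simp add: power_int_abs)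
      then show "\<bar>(-1) powi n * h (1 - n) * \<phi> (2 * x - of_int n)\<bar> \<le> \<bar>h (1 - n)\<bar> * K"
        using K by (simp add: abs_mult mult_left_mono)
    qed
    then have "sqrt 2 * \<bar>\<Sum>n = 1 - int N..int N. (-1) powi n * h (1 - n) * \<phi> (2 * x - of_int n)\<bar>
       \<le> sqrt 2 * (\<Sum>n = 1 - int N..int N. \<bar>h (1 - n)\<bar> * K)" by (rule mult_left_mono) simp
    moreover have "\<bar>\<psi> x\<bar> = sqrt 2 * \<bar>\<Sum>n = 1 - int N..int N. (-1) powi n * h (1 - n) * \<phi> (2 * x - of_int n)\<bar>"
      unfolding h[of x] abs_mult by simp
    ultimately show ?thesis unfolding C_def by linarith
  qed
  moreover have "1 - real N \<le> x \<and> x \<le> real N" if "\<psi> x \<noteq> 0" for x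
  proof (rule ccontr)
    assume out: "\<not> (1 - real N \<le> x \<and> x \<le> real N)"
    have zero: "(-1) powi n * h (1 - n) * \<phi> (2 * x - of_int n) = 0" if n: "n \<in> {1 - int N..int N}" for n
    proof -
      have "1 - real N \<le> real_of_int n" "real_of_int n \<le> real N" using n by auto
      then have "2 * x - of_int n \<notin> {1 - real N .. real N}" using out by auto
      then show ?thesis using supp by simp
    qed
    have "(\<Sum>n = 1 - int N..int N. (-1) powi n * h (1 - n) * \<phi> (2 * x - of_int n)) = 0"
      by (rule sum.neutral, rule ballI, rule zero)
    then have "\<psi> x = 0" unfolding h[of x] by (simp only: mult_zero_right)
    with that show False by simp
  qed
  ultimately show thesis using that by blast
qed

text \<open>At level \<open>j\<close> every \<open>2 * N\<close>-th interior wavelet is kept, so that the supports are disjoint.\<close>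

definition interior_count :: "nat \<Rightarrow> nat \<Rightarrow> nat" where
  "interior_count N j = (2 ^ j - 2 * N) div (2 * N)"

text \<open>Functions beyond the count are set to zero, so that boundedness and disjointness hold
  for all \<open>r\<close>.\<close>

definition interior_wavelet :: "nat \<Rightarrow> (cdv_index \<Rightarrow> real \<Rightarrow> real) \<Rightarrow> nat \<Rightarrow> nat \<Rightarrow> real \<Rightarrow> real" where
  "interior_wavelet N \<psi> j r = (if r < interior_count N j then \<psi> (Wav j (N + 2 * N * r)) else (\<lambda>_. 0))"

text \<open>The index stays at least \<open>N\<close> away from both ends, so \<open>cdv_fun\<close>
  selects a translate of the mother wavelet and no edge function.\<close>

lemma interior_index_less:
  assumes "r < interior_count N j"
  shows "N + 2 * N * r + N < 2 ^ j" "N + 2 * N * r < 2 ^ j"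
proof -
  have N: "N > 0" using assms by (cases N) (auto simp: interior_count_def)
  have "2 * N * (r + 1) \<le> 2 * N * interior_count N j" using assms by (intro mult_left_mono) auto
  also have "\<dots> \<le> 2 ^ j - 2 * N" unfolding interior_count_def by (rule times_div_less_eq_dividend)
  finally have "2 * N * (r + 1) \<le> 2 ^ j - 2 * N" .
  moreover have "2 * N * (r + 1) > 0" using N by simp
  ultimately show "N + 2 * N * r + N < 2 ^ j" "N + 2 * N * r < 2 ^ j" using N by (auto simp: algebra_simps)
qed

text \<open>The edges and the rounding cost less than two blocks of length \<open>2 * N\<close>. As
  \<open>2 ^ j\<close> contains at least four blocks, half of the \<open>2 ^ j / (2 * N)\<close>
  blocks remain.\<close>

lemma interior_count_bounds:
  assumes "N > 0" "8 * N \<le> 2 ^ j"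
  shows "interior_count N j > 0" "2 ^ j / (4 * real N) \<le> real (interior_count N j)" "interior_count N j \<le> 2 ^ j"
proof -
  define t M where "t = 2 * N" and "M = (2 ^ j :: nat)"
  have t: "t > 0" "4 * t \<le> M" using assms by (auto simp: t_def M_def)
  have d: "interior_count N j = (M - t) div t" by (simp add: interior_count_def t_def M_def)
  have "(M - t) = (M - t) div t * t + (M - t) mod t" by simp
  moreover have "(M - t) mod t < t" using t by simp
  moreover have "(interior_count N j + 2) * t = (M - t) div t * t + 2 * t" by (simp add: d algebra_simps)
  ultimately have "M < (interior_count N j + 2) * t" using t by linarith
  then have "real M < (real (interior_count N j) + 2) * real t"
    by (metis of_nat_add of_nat_less_iff of_nat_mult of_nat_numeral)
  moreover have "4 * real t \<le> real M" using of_nat_mono[OF t(2), where 'a=real] by simp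
  ultimately have *: "real M < 2 * real (interior_count N j) * real t" by (simp add: algebra_simps)
  show "interior_count N j > 0" using * by (cases "interior_count N j") auto
  have "real M / (2 * real t) \<le> real (interior_count N j)"
    using * t by (simp add: pos_divide_le_eq mult_ac)
  then show "2 ^ j / (4 * real N) \<le> real (interior_count N j)" by (simp add: t_def M_def)
  show "interior_count N j \<le> 2 ^ j" unfolding d M_def[symmetric] by (metis diff_le_self div_le_dividend le_trans)
qed

lemma interior_wavelets:
  assumes cdv: "cdv_basis N J0 \<psi>"
  obtains C where "C > 0"
    and "\<And>j r x. J0 \<le> j \<Longrightarrow> \<bar>interior_wavelet N \<psi> j r x\<bar> \<le> C * 2 powr (real j / 2)"
    and "\<And>j r r' x. J0 \<le> j \<Longrightarrow> r \<noteq> r' \<Longrightarrow> interior_wavelet N \<psi> j r x * interior_wavelet N \<psi> j r' x = 0"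
proof -
  from cdv obtain father mother \<phi>L \<psi>L \<phi>R \<psi>R where d: "daubechies N father mother"
    and w: "\<And>j k. J0 \<le> j \<Longrightarrow> k < 2 ^ j \<Longrightarrow> \<psi> (Wav j k) = cdv_fun N mother \<psi>L \<psi>R j k"
    unfolding cdv_basis_def by blast
  have N: "N \<ge> 1" using d unfolding daubechies_def by blast
  obtain C where C: "C > 0" "\<And>x. \<bar>mother x\<bar> \<le> C" "\<And>x. mother x \<noteq> 0 \<Longrightarrow> 1 - real N \<le> x \<and> x \<le> real N"
    using mother_bounded_support[OF d] by blast
  have eq: "interior_wavelet N \<psi> j r x = 2 powr (real j / 2) * mother (2 ^ j * x - real (N + 2 * N * r))"
    if "J0 \<le> j" "r < interior_count N j" for j r x
  proof -
    note l = interior_index_less[OF that(2)]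
    have "\<not> N + 2 * N * r < N" "N + 2 * N * r < 2 ^ j - N" using l by auto
    then show ?thesis unfolding interior_wavelet_def w[OF that(1) l(2)] cdv_fun_def using that by simp
  qed
  have 1: "\<bar>interior_wavelet N \<psi> j r x\<bar> \<le> C * 2 powr (real j / 2)" if "J0 \<le> j" for j r x
  proof (cases "r < interior_count N j")
    case True
    show ?thesis unfolding eq[OF that True] using C(2) by (simp add: abs_mult mult.commute mult_right_mono)
  next
    case False
    then show ?thesis using C(1) by (simp add: interior_wavelet_def)
  qed
  have 2: "interior_wavelet N \<psi> j r x * interior_wavelet N \<psi> j r' x = 0" if j: "J0 \<le> j" and "r < r'" for j r r' x
  proof (rule ccontr)
    assume *: "\<not> ?thesis"
    then have r: "r < interior_count N j" "r' < interior_count N j" by (auto simp: interior_wavelet_def split: if_splits)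
    have "mother (2 ^ j * x - real (N + 2 * N * r)) \<noteq> 0" "mother (2 ^ j * x - real (N + 2 * N * r')) \<noteq> 0"
      using * eq[OF j r(1)] eq[OF j r(2)] by auto
    \<comment> \<open>Both arguments lie in an interval of length \<open>2 * N - 1\<close>, whereas
      the two shifts differ by at least \<open>2 * N\<close>.\<close>
    from this[THEN C(3)] have "real (N + 2 * N * r') - real (N + 2 * N * r) \<le> 2 * real N - 1" by linarith
    moreover have "2 * N * (r + 1) \<le> 2 * N * r'" using \<open>r < r'\<close> by (intro mult_left_mono) auto
    then have "real (2 * N * (r + 1)) \<le> real (2 * N * r')" by (rule of_nat_mono)
    ultimately show False by (simp add: algebra_simps)
  qed
  have 3: "interior_wavelet N \<psi> j r x * interior_wavelet N \<psi> j r' x = 0" if "J0 \<le> j" "r \<noteq> r'" for j r r' x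
    using 2[OF that(1), of r r' x] 2[OF that(1), of r' r x] that(2) by (cases "r < r'") (auto simp: mult.commute)
  show thesis using that[OF C(1) 1 3] .
qed

section \<open>Coefficients and Besov norm of combinations of interior wavelets\<close>

lemma inner01_sum_left:
  assumes "finite A" "\<And>r. r \<in> A \<Longrightarrow> f r \<in> L2_01" "g \<in> L2_01"
  shows "inner01 (\<lambda>x. \<Sum>r\<in>A. c r * f r x) g = (\<Sum>r\<in>A. c r * inner01 (f r) g)"
proof -
  have i: "integrable leb01 (\<lambda>x. c r * (f r x * g x))" if "r \<in> A" for r
    using assms that by (intro integrable_mult_right integrable_mult_of_squares leb01_convert)
  have "inner01 (\<lambda>x. \<Sum>r\<in>A. c r * f r x) g = (\<integral>x. (\<Sum>r\<in>A. c r * (f r x * g x)) \<partial>leb01)"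
    unfolding leb01_convert(1) by (simp add: sum_distrib_right mult.assoc)
  also have "\<dots> = (\<Sum>r\<in>A. \<integral>x. c r * (f r x * g x) \<partial>leb01)"
    by (rule Bochner_Integration.integral_sum[OF i])
  also have "\<dots> = (\<Sum>r\<in>A. c r * inner01 (f r) g)" unfolding leb01_convert(1) by simp
  finally show ?thesis .
qed

context
  fixes N J0 :: nat and \<psi> :: "cdv_index \<Rightarrow> real \<Rightarrow> real"
  assumes cdv: "cdv_basis N J0 \<psi>"
begin

lemma interior_wavelet_mem:
  assumes "J0 \<le> j" "r < interior_count N j"
  shows "Wav j (N + 2 * N * r) \<in> cdv_indices J0" "interior_wavelet N \<psi> j r \<in> L2_01"
proof -
  show 1: "Wav j (N + 2 * N * r) \<in> cdv_indices J0"
    using assms interior_index_less(2)[OF assms(2)] by (auto simp: cdv_indices_def)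
  show "interior_wavelet N \<psi> j r \<in> L2_01"
    using cdv 1 assms(2) by (auto simp: cdv_basis_def orthonormal_basis01_def interior_wavelet_def)
qed

lemma inner01_interior_wavelet:
  assumes "J0 \<le> j" "r < interior_count N j" "i \<in> cdv_indices J0"
  shows "inner01 (interior_wavelet N \<psi> j r) (\<psi> i) = of_bool (i = Wav j (N + 2 * N * r))"
  using cdv interior_wavelet_mem(1)[OF assms(1,2)] assms
  by (auto simp: cdv_basis_def orthonormal_basis01_def interior_wavelet_def)

lemma interior_wavelet_orthonormal:
  assumes "J0 \<le> j" "r < interior_count N j" "r' < interior_count N j"
  shows "inner01 (interior_wavelet N \<psi> j r) (interior_wavelet N \<psi> j r') = of_bool (r = r')"
proof -
  have "N > 0" using assms(2) by (cases N) (auto simp: interior_count_def)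
  then show ?thesis
    using inner01_interior_wavelet[OF assms(1,2) interior_wavelet_mem(1)[OF assms(1,3)]] assms
    by (auto simp: interior_wavelet_def)
qed

lemma interior_wavelet_measurable:
  assumes "J0 \<le> j"
  shows "interior_wavelet N \<psi> j r \<in> borel_measurable borel"
  using interior_wavelet_mem(2)[OF assms] by (cases "r < interior_count N j") (auto simp: L2_01_def interior_wavelet_def)

text \<open>Orthonormality kills all coefficients outside level \<open>j\<close>, so the supremum
  over the levels reduces to a single term.\<close>

lemma interior_combination_in_besov_ball:
  fixes c :: "nat \<Rightarrow> real"
  assumes j: "J0 \<le> j" and c: "2 powr (2 * real j * s) * (\<Sum>r<interior_count N j. (c r)\<^sup>2) < L\<^sup>2"
  shows "(\<lambda>x. \<Sum>r<interior_count N j. c r * interior_wavelet N \<psi> j r x) \<in> besov_ball s J0 \<psi> L"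
proof -
  let ?d = "interior_count N j" and ?w = "interior_wavelet N \<psi> j"
  let ?f = "\<lambda>x. \<Sum>r<?d. c r * ?w r x"
  have wL: "?w r \<in> L2_01" if "r \<in> {..<?d}" for r using interior_wavelet_mem(2)[OF j] that by simp
  have in2: "inner01 ?f (\<psi> i) = (\<Sum>r<?d. c r * of_bool (i = Wav j (N + 2 * N * r)))" if "i \<in> cdv_indices J0" for i
  proof -
    have "\<psi> i \<in> L2_01" using cdv that by (auto simp: cdv_basis_def orthonormal_basis01_def)
    then have "inner01 ?f (\<psi> i) = (\<Sum>r<?d. c r * inner01 (?w r) (\<psi> i))"
      by (intro inner01_sum_left wL) auto
    also have "\<dots> = (\<Sum>r<?d. c r * of_bool (i = Wav j (N + 2 * N * r)))"
      by (intro sum.cong refl) (simp add: inner01_interior_wavelet[OF j _ that])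
    finally show ?thesis .
  qed
  have scal: "(\<Sum>k<2 ^ J0. (inner01 ?f (\<psi> (Scal k)))\<^sup>2) = 0"
    by (intro sum.neutral ballI) (subst in2, auto simp: cdv_indices_def)
  have other: "(\<Sum>k<2 ^ j'. (inner01 ?f (\<psi> (Wav j' k)))\<^sup>2) = 0" if "J0 \<le> j'" "j' \<noteq> j" for j'
    using that by (intro sum.neutral ballI) (subst in2, auto simp: cdv_indices_def)
  have level: "(\<Sum>k<2 ^ j. (inner01 ?f (\<psi> (Wav j k)))\<^sup>2) = (\<Sum>r<?d. (c r)\<^sup>2)"
  proof -
    have "(\<Sum>k<2 ^ j. (inner01 ?f (\<psi> (Wav j k)))\<^sup>2) = (\<Sum>k<2 ^ j. (\<Sum>r<?d. c r * of_bool (k = N + 2 * N * r))\<^sup>2)"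
      using j by (intro sum.cong refl) (subst in2, auto simp: cdv_indices_def)
    also have "\<dots> = (\<Sum>k<2 ^ j. \<Sum>r<?d. (c r * of_bool (k = N + 2 * N * r))\<^sup>2)"
    proof (intro sum.cong refl square_sum_disjoint)
      fix k r r' assume r: "r \<in> {..<?d}" "r' \<in> {..<?d}" "r \<noteq> r'"
      then have "N > 0" by (cases N) (auto simp: interior_count_def)
      then show "c r * of_bool (k = N + 2 * N * r) * (c r' * of_bool (k = N + 2 * N * r')) = 0"
        using r by auto
    qed auto
    also have "\<dots> = (\<Sum>r<?d. \<Sum>k<2 ^ j. (c r * of_bool (k = N + 2 * N * r))\<^sup>2)" by (rule sum.swap)
    also have "\<dots> = (\<Sum>r<?d. (c r)\<^sup>2)"
    proof (intro sum.cong refl)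
      fix r assume "r \<in> {..<?d}"
      then have "N + 2 * N * r < 2 ^ j" using interior_index_less(2) by simp
      moreover have "(c r * of_bool (k = N + 2 * N * r))\<^sup>2 = (if k = N + 2 * N * r then (c r)\<^sup>2 else 0)" for k
        by simp
      ultimately show "(\<Sum>k<2 ^ j. (c r * of_bool (k = N + 2 * N * r))\<^sup>2) = (c r)\<^sup>2" by simp
    qed
    finally show ?thesis .
  qed
  have "besov_norm_sq s J0 \<psi> ?f \<le> ennreal (2 powr (2 * real j * s) * (\<Sum>r<?d. (c r)\<^sup>2))"
    unfolding besov_norm_sq_def
  proof (intro sup_least SUP_least)
    show "ennreal (2 powr (2 * real J0 * s) * (\<Sum>k<2 ^ J0. (inner01 ?f (\<psi> (Scal k)))\<^sup>2))
      \<le> ennreal (2 powr (2 * real j * s) * (\<Sum>r<?d. (c r)\<^sup>2))"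
      unfolding scal by simp
    fix j' assume "j' \<in> {J0..}"
    then show "ennreal (2 powr (2 * real j' * s) * (\<Sum>k<2 ^ j'. (inner01 ?f (\<psi> (Wav j' k)))\<^sup>2))
      \<le> ennreal (2 powr (2 * real j * s) * (\<Sum>r<?d. (c r)\<^sup>2))"
      using level other[of j'] by (cases "j' = j") auto
  qed
  also have "\<dots> < ennreal (L\<^sup>2)"
  proof -
    have "0 \<le> 2 powr (2 * real j * s) * (\<Sum>r<?d. (c r)\<^sup>2)" by (intro mult_nonneg_nonneg sum_nonneg) auto
    then show ?thesis using c by (simp add: ennreal_less_iff)
  qed
  finally have "besov_norm_sq s J0 \<psi> ?f < ennreal (L\<^sup>2)" .
  moreover have "?f \<in> L2_01"
  proof -
    have m: "?f \<in> borel_measurable borel"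
      by (intro borel_measurable_sum borel_measurable_times borel_measurable_const interior_wavelet_measurable[OF j])
    have "integrable leb01 (\<lambda>x. c r * ?w r x * (c r' * ?w r' x))" if "r \<in> {..<?d}" "r' \<in> {..<?d}" for r r'
    proof -
      have "integrable leb01 (\<lambda>x. (c r * c r') * (?w r x * ?w r' x))"
        by (intro integrable_mult_right integrable_mult_of_squares leb01_convert wL that)
      moreover have "(\<lambda>x. (c r * c r') * (?w r x * ?w r' x)) = (\<lambda>x. c r * ?w r x * (c r' * ?w r' x))"
        by (simp add: fun_eq_iff mult_ac)
      ultimately show ?thesis by (simp only:)
    qed
    then have "integrable leb01 (\<lambda>x. (?f x)\<^sup>2)"
      unfolding power2_eq_square sum_product by (intro Bochner_Integration.integrable_sum) blast
    then have "set_integrable lborel {0..1} (\<lambda>x. (?f x)\<^sup>2)"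
      unfolding set_integrable_def by (rule integrable_restrict_space[THEN iffD1, rotated]) simp
    then show ?thesis unfolding L2_01_def using m by (intro CollectI conjI)
  qed
  ultimately show ?thesis unfolding besov_ball_def by simp
qed

end

section \<open>Lower bound at a fixed level\<close>

lemma measurable_messages:
  fixes enc :: "nat \<Rightarrow> 'a \<Rightarrow> 'b::countable"
  assumes "\<And>i. i < m \<Longrightarrow> enc i \<in> measurable M (count_space UNIV)"
  shows "(\<lambda>D. map (\<lambda>i. enc i (D i)) [0..<m]) \<in> measurable (\<Pi>\<^sub>M i\<in>{..<m}. M) (count_space UNIV)"
proof -
  have "(\<lambda>D. map (\<lambda>i. enc i (D i)) xs) \<in> measurable (\<Pi>\<^sub>M i\<in>{..<m}. M) (count_space UNIV)" if "set xs \<subseteq> {..<m}" for xs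
    using that
  proof (induction xs)
    case (Cons i xs)
    then have i: "i < m" by simp
    have 1: "(\<lambda>D. enc i (D i)) \<in> measurable (\<Pi>\<^sub>M i\<in>{..<m}. M) (count_space UNIV)"
      by (rule measurable_compose[OF measurable_component_singleton[of i "{..<m}" "\<lambda>_. M"] assms[OF i]]) (use i in simp)
    have 2: "(\<lambda>D. map (\<lambda>i. enc i (D i)) xs) \<in> measurable (\<Pi>\<^sub>M i\<in>{..<m}. M) (count_space UNIV)"
      using Cons by simp
    have "(\<lambda>D. (enc i (D i), map (\<lambda>i. enc i (D i)) xs)) \<in> measurable (\<Pi>\<^sub>M i\<in>{..<m}. M) (count_space UNIV)"
      using measurable_Pair[OF 1 2] by (simp add: pair_measure_countable)
    from measurable_compose[OF this, of "\<lambda>p. fst p # snd p" "count_space UNIV"] show ?case by simp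
  qed simp
  from this[of "[0..<m]"] show ?thesis by (simp add: lessThan_atLeast0)
qed

text \<open>Clipping to an interval that contains the parameter never moves an estimate away from
  it. The estimates thus become bounded, as the van Trees argument demands, at no cost in
  risk.\<close>

lemma clip_square_le:
  fixes y \<theta> a :: real
  assumes "a > 0" "\<bar>\<theta>\<bar> \<le> 1"
  shows "a\<^sup>2 * (max (-1) (min 1 (y / a)) - \<theta>)\<^sup>2 \<le> (y - a * \<theta>)\<^sup>2"
proof -
  have "\<bar>max (-1) (min 1 z) - \<theta>\<bar> \<le> \<bar>z - \<theta>\<bar>" for z
    using assms(2) by (auto simp: max_def min_def abs_if)
  from this[of "y / a"] have "a * \<bar>max (-1) (min 1 (y / a)) - \<theta>\<bar> \<le> a * \<bar>y / a - \<theta>\<bar>" using assms by (intro mult_left_mono) auto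
  also have "a * \<bar>y / a - \<theta>\<bar> = \<bar>y - a * \<theta>\<bar>"
  proof -
    have "a * \<bar>y / a - \<theta>\<bar> = \<bar>a * (y / a - \<theta>)\<bar>" using assms by (simp add: abs_mult)
    also have "a * (y / a - \<theta>) = y - a * \<theta>" using assms by (simp add: algebra_simps)
    finally show ?thesis .
  qed
  finally have "\<bar>a * (max (-1) (min 1 (y / a)) - \<theta>)\<bar> \<le> \<bar>y - a * \<theta>\<bar>" using assms by (simp add: abs_mult)
  then show ?thesis by (simp only: power_mult_distrib[symmetric] abs_le_square_iff)
qed

text \<open>\<open>alt\<close> lists the two ways to keep the remainder in the correlation bound
  below \<open>d / 3\<close>: the full data carry information at most 8 per coordinate, or the
  information of the messages and the tail of the design energy together are small. The amplitude
  \<open>a2\<close> has the largest order for which the whole cube of signals lies in the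
  ball.\<close>

lemma minimax_core_bound:
  fixes s L \<sigma> B C :: real
  assumes cdv: "cdv_basis N J0 \<psi>" and "\<sigma> > 0" "L > 0" "C > 0" "B > 0"
    and Cb: "\<And>r x. \<bar>interior_wavelet N \<psi> j r x\<bar> \<le> C * 2 powr (real j / 2)"
    and disj: "\<And>r r' x. r \<noteq> r' \<Longrightarrow> interior_wavelet N \<psi> j r x * interior_wavelet N \<psi> j r' x = 0"
    and j: "J0 \<le> j" and dpos: "interior_count N j > 0" and dle: "interior_count N j \<le> 2 ^ j"
    and q: "n div m > 0"
    and apos: "a > 0" and a2: "a\<^sup>2 = L\<^sup>2 / 2 * 2 powr (- real j * (1 + 2 * s))"
    and alt: "real m * (real (n div m) * (a / \<sigma>)\<^sup>2) \<le> 8 \<or>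
      (\<exists>\<eta>>0. \<eta> \<le> 1 / 2 \<and>
        real m * (real (n div m) * (a / \<sigma>)\<^sup>2) * (2 * \<eta> + B * (ln (1 / \<eta>) + ln 4)) / 4
        + 2 * real m * real (interior_count N j) *
          ((1 + (a / \<sigma>)\<^sup>2 * (real (n div m) * (C * 2 powr (real j / 2))\<^sup>2)) / 2
             * exp (- real (n div m) / (C * 2 powr (real j / 2))\<^sup>2))
        \<le> real (interior_count N j) / 3)"
  shows "ennreal (a\<^sup>2 * real (interior_count N j) / 100) \<le> minimax_risk \<sigma> n m (\<lambda>_. B) (besov_ball s J0 \<psi> L)"
  unfolding minimax_risk_def
proof (rule INF_greatest)
  fix fhat assume "fhat \<in> F_dist \<sigma> n m (\<lambda>_. B) (besov_ball s J0 \<psi> L)"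
  then obtain enc dec where
    enc: "\<And>i. i < m \<Longrightarrow> enc i \<in> (\<Pi>\<^sub>M l\<in>{..<n div m}. borel \<Otimes>\<^sub>M borel) \<rightarrow>\<^sub>M count_space UNIV"
    and len: "\<And>f i. f \<in> besov_ball s J0 \<psi> L \<Longrightarrow> i < m \<Longrightarrow> (\<integral>\<^sup>+ D. of_nat (length (enc i (D i))) \<partial>data_law \<sigma> n m f) \<le> ennreal B"
    and dec: "\<And>y. dec y \<in> L2_01" and fhat: "fhat = (\<lambda>D. dec (map (\<lambda>i. enc i (D i :: nat \<Rightarrow> real \<times> real) :: bool list) [0..<m]))"
    unfolding F_dist_def by blast
  define d where "d = interior_count N j"
  define w where "w = interior_wavelet N \<psi> j"
  define q where "q = n div m"
  have wL: "w r \<in> L2_01" if "r < d" for r using interior_wavelet_mem(2)[OF cdv j] that by (simp add: w_def d_def)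
  have won: "inner01 (w r) (w r') = of_bool (r = r')" if "r < d" "r' < d" for r r'
    using interior_wavelet_orthonormal[OF cdv j] that by (simp add: w_def d_def)
  have wm: "w r \<in> borel_measurable borel" for r
    using interior_wavelet_measurable[OF cdv j] by (simp add: w_def)
  interpret bump_family \<sigma> a "C * 2 powr (real j / 2)" d q w
  proof
    show "(\<integral>x. (w r x)\<^sup>2 \<partial>unif01) \<le> 1" if "r < d" for r
    proof -
      have "(\<integral>x. (w r x)\<^sup>2 \<partial>unif01) = inner01 (w r) (w r)"
        unfolding inner01_def using wm[of r] by (subst unif01_integral) (auto simp: power2_eq_square)
      then show ?thesis using won[OF that that] by simp
    qed
  qed (use assms wm in \<open>auto simp: w_def\<close>)
  have full: "full_law m \<theta> = data_law \<sigma> n m (signal \<theta>)" for \<theta>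
    unfolding full_law_def law_def data_law_def local_law_def q_def[symmetric] ..
  have ball: "signal \<theta> \<in> besov_ball s J0 \<psi> L" if \<theta>: "\<And>r. r < d \<Longrightarrow> \<bar>\<theta> r\<bar> \<le> 1" for \<theta>
  proof -
    have "(\<Sum>r<d. (a * \<theta> r)\<^sup>2) \<le> (\<Sum>r<d. a\<^sup>2)"
      using \<theta> by (intro sum_mono) (auto simp: power_mult_distrib abs_square_le_1 intro: mult_left_le)
    also have "\<dots> \<le> 2 ^ j * a\<^sup>2" using dle by (simp add: d_def mult_right_mono)
    finally have "2 powr (2 * real j * s) * (\<Sum>r<d. (a * \<theta> r)\<^sup>2) \<le> 2 powr (2 * real j * s) * (2 ^ j * a\<^sup>2)"
      by (rule mult_left_mono) simp
    also have "\<dots> = L\<^sup>2 / 2 * (2 powr (2 * real j * s) * 2 powr (real j) * 2 powr (- real j * (1 + 2 * s)))"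
      by (simp add: a2 powr_realpow)
    also have "2 powr (2 * real j * s) * 2 powr (real j) * 2 powr (- real j * (1 + 2 * s)) = 2 powr 0"
      unfolding powr_add[symmetric] by (rule arg_cong[where f="(powr) 2"]) (simp add: algebra_simps)
    \<comment> \<open>The factor \<open>1 / 2\<close> in \<open>a2\<close> leaves room for the
      strict inequality that defines the ball.\<close>
    also have "L\<^sup>2 / 2 * 2 powr 0 < L\<^sup>2" using \<open>L > 0\<close> by simp
    finally have "(\<lambda>x. \<Sum>r<interior_count N j. (a * \<theta> r) * interior_wavelet N \<psi> j r x) \<in> besov_ball s J0 \<psi> L"
      unfolding d_def by (rule interior_combination_in_besov_ball[OF cdv j])
    also have "(\<lambda>x. \<Sum>r<interior_count N j. (a * \<theta> r) * interior_wavelet N \<psi> j r x) = signal \<theta>"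
      unfolding d_def[symmetric] w_def[symmetric]
      by (simp add: signal_def fun_eq_iff sum_distrib_left mult.assoc)
    finally show ?thesis .
  qed
  define T where "T k D = max (-1) (min 1 (inner01 (fhat D) (w k) / a))" for k D
  have Tb: "\<bar>T k D\<bar> \<le> 1" for k D unfolding T_def by (auto simp: max_def min_def abs_le_iff)
  have enc': "enc i \<in> measurable (\<Pi>\<^sub>M l\<in>{..<q}. borel \<Otimes>\<^sub>M borel) (count_space UNIV)" if "i < m" for i
    using enc[OF that] by (simp add: q_def)
  have Tm: "T k \<in> borel_measurable (data_space m)" for k
  proof -
    have "(\<lambda>y. max (-1) (min 1 (inner01 (dec y) (w k) / a))) \<in> borel_measurable (count_space UNIV)" by simp
    from measurable_compose[OF measurable_messages[OF enc'] this] show ?thesis unfolding T_def fhat by simp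
  qed
  have Tdep: "T k D = T k D'" if "\<And>i. i < m \<Longrightarrow> enc i (D i) = enc i (D' i)" for k D D'
  proof -
    have "map (\<lambda>i. enc i (D i)) [0..<m] = map (\<lambda>i. enc i (D' i)) [0..<m]" using that by simp
    then show ?thesis unfolding T_def fhat by (simp only:)
  qed
  have "\<exists>\<theta>. (\<forall>r<d. \<bar>\<theta> r\<bar> \<le> 1) \<and> real d / 100 \<le> (\<Sum>k<d. \<integral>D. (T k D - \<theta> k)\<^sup>2 \<partial>full_law m \<theta>)"
  proof (rule exists_bad_parameter[OF _ Tm Tb])
    show "d > 0" using dpos by (simp add: d_def)
    fix \<theta> :: "nat \<Rightarrow> real" and F :: "nat \<Rightarrow> (nat \<Rightarrow> nat \<Rightarrow> real \<times> real) \<Rightarrow> real"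
    assume \<theta>: "\<And>r. r < d \<Longrightarrow> \<bar>\<theta> r\<bar> \<le> 1" and F: "\<And>k. k < d \<Longrightarrow> F k \<in> borel_measurable (data_space m)"
      and Fb: "\<And>k D. \<bar>F k D\<bar> \<le> 2" and Fd: "\<And>k D D'. (\<And>i. T i D = T i D') \<Longrightarrow> F k D = F k D'"
    from alt show "(\<Sum>k<d. \<integral>D. F k D * total_score m \<theta> k D \<partial>full_law m \<theta>)
          \<le> 6 * (\<Sum>k<d. \<integral>D. (F k D)\<^sup>2 \<partial>full_law m \<theta>) + real d / 3"
    proof
      assume small: "real m * (real (n div m) * (a / \<sigma>)\<^sup>2) \<le> 8"
      have "(\<Sum>k<d. \<integral>D. F k D * total_score m \<theta> k D \<partial>full_law m \<theta>)
        \<le> (\<Sum>k<d. 6 * (\<integral>D. (F k D)\<^sup>2 \<partial>full_law m \<theta>) + real m * (real q * (a / \<sigma>)\<^sup>2) / 24)"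
        by (intro sum_mono score_correlation_unconstrained F Fb) auto
      also have "\<dots> \<le> (\<Sum>k<d. 6 * (\<integral>D. (F k D)\<^sup>2 \<partial>full_law m \<theta>) + 1 / 3)"
        using small by (intro sum_mono add_left_mono) (simp add: q_def)
      also have "\<dots> = 6 * (\<Sum>k<d. \<integral>D. (F k D)\<^sup>2 \<partial>full_law m \<theta>) + real d / 3"
        by (simp add: sum.distrib sum_distrib_left)
      finally show ?thesis .
    next
      assume "\<exists>\<eta>>0. \<eta> \<le> 1 / 2 \<and>
        real m * (real (n div m) * (a / \<sigma>)\<^sup>2) * (2 * \<eta> + B * (ln (1 / \<eta>) + ln 4)) / 4
        + 2 * real m * real (interior_count N j) *
          ((1 + (a / \<sigma>)\<^sup>2 * (real (n div m) * (C * 2 powr (real j / 2))\<^sup>2)) / 2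
             * exp (- real (n div m) / (C * 2 powr (real j / 2))\<^sup>2))
        \<le> real (interior_count N j) / 3"
      then obtain \<eta> where \<eta>: "\<eta> > 0" "\<eta> \<le> 1 / 2"
        and le: "real m * (real q * (a / \<sigma>)\<^sup>2) * (2 * \<eta> + B * (ln (1 / \<eta>) + ln 4)) / 4
          + 2 * real m * real d * ((1 + (a / \<sigma>)\<^sup>2 * (real q * (C * 2 powr (real j / 2))\<^sup>2)) / 2
             * exp (- real q / (C * 2 powr (real j / 2))\<^sup>2)) \<le> real d / 3"
        unfolding q_def[symmetric] d_def[symmetric] by (elim exE conjE) (rule that)
      have "(\<Sum>k<d. \<integral>D. F k D * total_score m \<theta> k D \<partial>full_law m \<theta>)
        \<le> 6 * (\<Sum>k<d. \<integral>D. (F k D)\<^sup>2 \<partial>full_law m \<theta>)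
          + real m * (real q * (a / \<sigma>)\<^sup>2) * (2 * \<eta> + B * (ln (1 / \<eta>) + ln 4)) / 4
          + 2 * real m * real d * tail_bound"
      proof (rule score_correlation_constrained[OF _ \<eta> _ enc' _ F Fb])
        show "(\<integral>\<^sup>+D. of_nat (length (enc i (D i))) \<partial>full_law m \<theta>) \<le> ennreal B" if "i < m" for i
          unfolding full by (rule len[OF ball[OF \<theta>] that])
        show "F k D = F k D'" if "\<And>i. i < m \<Longrightarrow> enc i (D i) = enc i (D' i)" for k D D'
          by (rule Fd) (rule Tdep[OF that])
      qed (use assms(5) \<open>n div m > 0\<close> in \<open>auto simp: q_def\<close>)
      with le[folded tail_bound_def] show ?thesis by linarith
    qed
  qed
  then obtain \<theta> where \<theta>: "\<And>r. r < d \<Longrightarrow> \<bar>\<theta> r\<bar> \<le> 1"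
    and big: "real d / 100 \<le> (\<Sum>k<d. \<integral>D. (T k D - \<theta> k)\<^sup>2 \<partial>full_law m \<theta>)" by blast
  interpret P: prob_space "full_law m \<theta>" by (rule prob_space_full_law)
  have iT: "integrable (full_law m \<theta>) (\<lambda>D. (T k D - \<theta> k)\<^sup>2)" if "k < d" for k
  proof (rule P.integrable_const_bound[of _ 4])
    have "\<bar>T k D - \<theta> k\<bar> \<le> 2" for D using Tb[of k D] \<theta>[OF that] by simp
    from power_mono[OF this, where n = 2] show "AE D in full_law m \<theta>. norm ((T k D - \<theta> k)\<^sup>2) \<le> 4" by simp
    show "(\<lambda>D. (T k D - \<theta> k)\<^sup>2) \<in> borel_measurable (full_law m \<theta>)" using Tm[of k] by simp
  qed
  have "ennreal (a\<^sup>2 * real d / 100) \<le> ennreal (\<integral>D. a\<^sup>2 * (\<Sum>k<d. (T k D - \<theta> k)\<^sup>2) \<partial>full_law m \<theta>)"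
  proof (rule ennreal_leI)
    have "a\<^sup>2 * (real d / 100) \<le> a\<^sup>2 * (\<Sum>k<d. \<integral>D. (T k D - \<theta> k)\<^sup>2 \<partial>full_law m \<theta>)"
      by (rule mult_left_mono[OF big]) simp
    also have "(\<Sum>k<d. \<integral>D. (T k D - \<theta> k)\<^sup>2 \<partial>full_law m \<theta>) = (\<integral>D. (\<Sum>k<d. (T k D - \<theta> k)\<^sup>2) \<partial>full_law m \<theta>)"
      by (rule Bochner_Integration.integral_sum[symmetric]) (simp add: iT)
    also have "a\<^sup>2 * \<dots> = (\<integral>D. a\<^sup>2 * (\<Sum>k<d. (T k D - \<theta> k)\<^sup>2) \<partial>full_law m \<theta>)"
      by (rule integral_mult_right_zero[symmetric])
    finally show "a\<^sup>2 * real d / 100 \<le> (\<integral>D. a\<^sup>2 * (\<Sum>k<d. (T k D - \<theta> k)\<^sup>2) \<partial>full_law m \<theta>)" by simp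
  qed
  also have "\<dots> = (\<integral>\<^sup>+D. ennreal (a\<^sup>2 * (\<Sum>k<d. (T k D - \<theta> k)\<^sup>2)) \<partial>full_law m \<theta>)"
    by (rule nn_integral_eq_integral[symmetric])
       (auto intro!: integrable_mult_right Bochner_Integration.integrable_sum iT mult_nonneg_nonneg sum_nonneg)
  also have "\<dots> \<le> (\<integral>\<^sup>+D. dist01_sq (fhat D) (signal \<theta>) \<partial>full_law m \<theta>)"
  proof (rule nn_integral_mono)
    fix D
    have "a\<^sup>2 * (\<Sum>k<d. (T k D - \<theta> k)\<^sup>2) \<le> (\<Sum>k<d. (inner01 (fhat D) (w k) - a * \<theta> k)\<^sup>2)"
      unfolding sum_distrib_left T_def using apos \<theta> by (intro sum_mono clip_square_le) auto
    then have "ennreal (a\<^sup>2 * (\<Sum>k<d. (T k D - \<theta> k)\<^sup>2)) \<le> ennreal (\<Sum>k<d. (inner01 (fhat D) (w k) - a * \<theta> k)\<^sup>2)"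
      by (rule ennreal_leI)
    also have "\<dots> \<le> dist01_sq (fhat D) (\<lambda>x. \<Sum>k<d. (a * \<theta> k) * w k x)"
      by (rule bessel_dist01) (auto simp: fhat dec wL won)
    also have "(\<lambda>x. \<Sum>k<d. (a * \<theta> k) * w k x) = signal \<theta>"
      by (simp add: signal_def fun_eq_iff sum_distrib_left mult.assoc)
    finally show "ennreal (a\<^sup>2 * (\<Sum>k<d. (T k D - \<theta> k)\<^sup>2)) \<le> dist01_sq (fhat D) (signal \<theta>)" .
  qed
  also have "\<dots> \<le> (SUP f\<in>besov_ball s J0 \<psi> L. \<integral>\<^sup>+ D. dist01_sq (fhat D) f \<partial>data_law \<sigma> n m f)"
    unfolding full by (rule SUP_upper[OF ball[OF \<theta>]])
  finally show "ennreal (a\<^sup>2 * real (interior_count N j) / 100)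
     \<le> (SUP f\<in>besov_ball s J0 \<psi> L. \<integral>\<^sup>+ D. dist01_sq (fhat D) f \<partial>data_law \<sigma> n m f)"
    by (simp add: d_def)
qed

section \<open>Choice of the level\<close>

lemma exists_dyadic_scale:
  assumes "y \<ge> (1 :: real)"
  obtains j where "y \<le> 2 ^ j" "2 ^ j \<le> 2 * y"
proof -
  define j where "j = (LEAST j. y \<le> 2 ^ j)"
  have ex: "\<exists>j. y \<le> 2 ^ j" using real_arch_pow[of 2 y] by (auto intro: less_imp_le)
  have 1: "y \<le> 2 ^ j" unfolding j_def by (rule LeastI_ex[OF ex])
  have "2 ^ j \<le> 2 * y"
  proof (cases j)
    case (Suc i)
    then have "\<not> y \<le> 2 ^ i" using not_less_Least[of i "\<lambda>j. y \<le> 2 ^ j"] unfolding j_def[symmetric] by simp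
    then show ?thesis using Suc by simp
  qed (use assms in simp)
  with 1 show thesis using that by blast
qed

lemma log2_ge_ln:
  assumes "x \<ge> (1 :: real)"
  shows "ln x \<le> log 2 x"
proof -
  have "ln 2 \<le> (1 :: real)" using ln_le_minus_one[of 2] by simp
  then have "ln x * ln 2 \<le> ln x" using assms by (intro mult_left_le) auto
  then show ?thesis by (simp add: log_def pos_le_divide_eq)
qed

text \<open>This is where the squared logarithm in the bound on \<open>m\<close> is spent. The rate
  \<open>c2\<close> will depend on the implied constant \<open>K\<close>; with a first power of the
  logarithm, \<open>exp (c2 * ln n)\<close> would only be a power of \<open>n\<close>, possibly a
  small one.\<close>

lemma eventually_log_square_beats:
  fixes c1 c2 :: real
  assumes "c1 > 0" "c2 > 0"
  shows "\<forall>\<^sub>F n :: nat in sequentially. c1 * real n \<le> exp (c2 * (ln (real n))\<^sup>2)"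
  using assms by real_asymp

text \<open>\<open>x\<close> is a continuous stand-in for \<open>2 ^ j\<close>, and the claim is
  uniform in \<open>m\<close>, \<open>B\<close> and \<open>x\<close>, so each regime follows by
  inserting its own scale. The first alternative makes even the full data too weak. The second makes
  the messages too weak; its condition \<open>x \<le> n powr (1 / (1 + 2 * s))\<close> keeps the
  level coarse enough for atypical designs to be rare.\<close>

lemma minimax_lower_bound_at_scale:
  fixes s L \<sigma> K :: real
  assumes s: "s > 0" and L: "L > 0" and \<sigma>: "\<sigma> > 0" and cdv: "cdv_basis N J0 \<psi>" and K: "K > 0"
  shows "\<exists>c>0. \<exists>x0. \<forall>\<^sub>F n in sequentially. \<forall>(m::nat) (B::real) (x::real).
    m dvd n \<and> m > 0 \<and> real m \<le> K * (real n powr (2 * s / (1 + 2 * s)) / (ln (real n))\<^sup>2) \<and> B > 0 \<and> x \<ge> x0 \<and>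
    (real n \<le> x powr (1 + 2 * s) \<or> real n * B * log 2 (real n) \<le> x powr (2 + 2 * s) \<and> x \<le> real n powr (1 / (1 + 2 * s))) \<longrightarrow>
    ennreal (c * x powr (- (2 * s))) \<le> minimax_risk \<sigma> n m (\<lambda>_. B) (besov_ball s J0 \<psi> L)"
proof -
  obtain C where C: "C > 0"
    and Cb: "\<And>j r x. J0 \<le> j \<Longrightarrow> \<bar>interior_wavelet N \<psi> j r x\<bar> \<le> C * 2 powr (real j / 2)"
    and disj: "\<And>j r r' x. J0 \<le> j \<Longrightarrow> r \<noteq> r' \<Longrightarrow> interior_wavelet N \<psi> j r x * interior_wavelet N \<psi> j r' x = 0"
    using interior_wavelets[OF cdv] by blast
  have N: "N > 0" using cdv unfolding cdv_basis_def daubechies_def by auto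
  define p where "p = 1 + 2 * s"
  have p: "p > 1" using s by (simp add: p_def)
  \<comment> \<open>The level is chosen with \<open>2 ^ j\<close> at least \<open>A * x\<close>. The
    dilation by \<open>A1\<close> brings the full-data information down to 8, the dilation by
    \<open>A2\<close> absorbs the constants of the communication term.\<close>
  define A1 where "A1 = (L\<^sup>2 / (16 * \<sigma>\<^sup>2)) powr (1 / p)"
  define A2 where "A2 = (24 * real N * L\<^sup>2 / \<sigma>\<^sup>2) powr (1 / (1 + p))"
  define A where "A = max 1 (max A1 A2)"
  have A: "A \<ge> 1" "A1 \<le> A" "A2 \<le> A" by (auto simp: A_def)
  \<comment> \<open>\<open>c1\<close> bounds \<open>(a / \<sigma>)^2 * b^2\<close>, and
    \<open>c2\<close> is such that \<open>q / b^2\<close> is at least \<open>c2 * (ln n)^2\<close>,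
    with \<open>b\<close> the sup bound of the wavelets.\<close>
  define c1 where "c1 = L\<^sup>2 * C\<^sup>2 / (2 * \<sigma>\<^sup>2)"
  have c1: "c1 \<ge> 0" using L \<sigma> by (simp add: c1_def)
  define c2 where "c2 = 1 / (2 * A * K * C\<^sup>2)"
  have c2: "c2 > 0" using A K C by (simp add: c2_def)
  \<comment> \<open>In this order the entries provide \<open>J0 \<le> j\<close>, enough interior
    wavelets, and room for the cost of the empty string.\<close>
  define x0 where "x0 = max 1 (max (2 ^ J0) (max (8 * real N) (24 * real N * L\<^sup>2 / \<sigma>\<^sup>2)))"
  \<comment> \<open>\<open>800 = 2 * 4 * 100\<close> comes from the \<open>1 / 2\<close> in
    \<open>a^2\<close>, the \<open>1 / (4 * N)\<close> in the count and the \<open>1 / 100\<close>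
    in the risk; \<open>2 * A\<close> accounts for the dilation and the rounding to a power of
    two.\<close>
  define c where "c = L\<^sup>2 / (800 * real N) * (2 * A) powr (- (2 * s))"
  have cpos: "c > 0" using L N A by (simp add: c_def)
  have ev: "\<forall>\<^sub>F n :: nat in sequentially. 12 * (1 + c1) * real n \<le> exp (c2 * (ln (real n))\<^sup>2)"
    using c1 c2 by (intro eventually_log_square_beats) auto
  have "\<forall>\<^sub>F n in sequentially. \<forall>(m::nat) (B::real) (x::real).
    m dvd n \<and> m > 0 \<and> real m \<le> K * (real n powr (2 * s / (1 + 2 * s)) / (ln (real n))\<^sup>2) \<and> B > 0 \<and> x \<ge> x0 \<and>
    (real n \<le> x powr (1 + 2 * s) \<or> real n * B * log 2 (real n) \<le> x powr (2 + 2 * s) \<and> x \<le> real n powr (1 / (1 + 2 * s))) \<longrightarrow>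
    ennreal (c * x powr (- (2 * s))) \<le> minimax_risk \<sigma> n m (\<lambda>_. B) (besov_ball s J0 \<psi> L)"
    using ev eventually_ge_at_top[of "4 :: nat"]
  proof eventually_elim
    case (elim n)
    show ?case
    proof (intro allI impI)
      fix m :: nat and B x :: real
      assume *: "m dvd n \<and> m > 0 \<and> real m \<le> K * (real n powr (2 * s / (1 + 2 * s)) / (ln (real n))\<^sup>2) \<and> B > 0 \<and> x \<ge> x0 \<and>
        (real n \<le> x powr (1 + 2 * s) \<or> real n * B * log 2 (real n) \<le> x powr (2 + 2 * s) \<and> x \<le> real n powr (1 / (1 + 2 * s)))"
      define q where "q = n div m"
      have n: "real n \<ge> 4" using elim(2) by simp
      have mn: "m dvd n" "m > 0" using * by auto
      have nmq: "real n = real m * real q" "q > 0"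
        using mn n by (auto simp: q_def of_nat_mult[symmetric] dvd_imp_le div_greater_zero_iff simp del: of_nat_mult)
      have x: "x \<ge> 1" "x \<ge> 2 ^ J0" "x \<ge> 8 * real N" "x \<ge> 24 * real N * L\<^sup>2 / \<sigma>\<^sup>2"
        using * by (auto simp: x0_def)
      have xA: "x \<le> A * x" using A x mult_right_mono[of 1 A x] by simp
      have "A * x \<ge> 1" using xA x by linarith
      then obtain j where j: "A * x \<le> 2 ^ j" "2 ^ j \<le> 2 * (A * x)" using exists_dyadic_scale by blast
      define M :: real where "M = 2 ^ j"
      have M: "A * x \<le> M" "M \<le> 2 * (A * x)" "M > 0" "x \<le> M" using j xA by (auto simp: M_def)
      have Mp: "M = 2 powr real j" by (simp add: M_def powr_realpow)
      have "2 ^ J0 \<le> (2 ^ j :: real)" using x(2) M(4) unfolding M_def by linarith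
      then have J: "J0 \<le> j" by simp
      have "8 * real N \<le> 2 ^ j" using x(3) M(4) unfolding M_def by linarith
      then have "real (8 * N) \<le> real (2 ^ j)" by simp
      then have N8: "8 * N \<le> 2 ^ j" by (simp only: of_nat_le_iff)
      define d where "d = interior_count N j"
      note ic = interior_count_bounds[OF N N8]
      have d: "d > 0" "M / (4 * real N) \<le> real d" "d \<le> 2 ^ j" using ic by (auto simp: d_def M_def)
      define a where "a = sqrt (L\<^sup>2 / 2 * M powr (- p))"
      have apos: "a > 0" using L M by (simp add: a_def)
      have a2: "a\<^sup>2 = L\<^sup>2 / 2 * M powr (- p)" using L M by (simp add: a_def)
      have a2': "a\<^sup>2 = L\<^sup>2 / 2 * 2 powr (- real j * (1 + 2 * s))"
        unfolding a2 Mp powr_powr p_def by (simp add: algebra_simps)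
      have Mp1: "M powr (- p) \<le> 1 / M"
      proof -
        have "M powr (- p) \<le> M powr (- 1)" using M x p by (intro powr_mono) auto
        also have "\<dots> = 1 / M" using M by (simp add: powr_minus_divide)
        finally show ?thesis .
      qed
      have aM: "a\<^sup>2 * M \<le> L\<^sup>2 / 2"
      proof -
        have "a\<^sup>2 * M \<le> L\<^sup>2 / 2 * (1 / M) * M" unfolding a2 using Mp1 M by (intro mult_right_mono mult_left_mono) auto
        then show ?thesis using M by simp
      qed
      have b2: "(C * 2 powr (real j / 2))\<^sup>2 = C\<^sup>2 * M"
        by (simp add: power_mult_distrib Mp powr_power)
      have alt: "real m * (real (n div m) * (a / \<sigma>)\<^sup>2) \<le> 8 \<or>
        (\<exists>\<eta>>0. \<eta> \<le> 1 / 2 \<and>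
          real m * (real (n div m) * (a / \<sigma>)\<^sup>2) * (2 * \<eta> + B * (ln (1 / \<eta>) + ln 4)) / 4
          + 2 * real m * real (interior_count N j) *
            ((1 + (a / \<sigma>)\<^sup>2 * (real (n div m) * (C * 2 powr (real j / 2))\<^sup>2)) / 2
               * exp (- real (n div m) / (C * 2 powr (real j / 2))\<^sup>2))
          \<le> real (interior_count N j) / 3)"
      proof (cases "real n \<le> x powr (1 + 2 * s)")
        case True
        have "real n * (L\<^sup>2 / (16 * \<sigma>\<^sup>2)) \<le> x powr p * A powr p"
        proof (rule mult_mono)
          show "real n \<le> x powr p" using True by (simp add: p_def)
          have "L\<^sup>2 / (16 * \<sigma>\<^sup>2) = A1 powr p" using L \<sigma> p by (simp add: A1_def powr_powr)
          also have "\<dots> \<le> A powr p" using A p by (intro powr_mono2) (auto simp: A1_def)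
          finally show "L\<^sup>2 / (16 * \<sigma>\<^sup>2) \<le> A powr p" .
        qed auto
        also have "\<dots> = (A * x) powr p" using A x by (simp add: powr_mult)
        also have "\<dots> \<le> M powr p" using M A x p by (intro powr_mono2) auto
        finally have "real n * (L\<^sup>2 / (16 * \<sigma>\<^sup>2)) \<le> M powr p" .
        then have "real n * (L\<^sup>2 / (16 * \<sigma>\<^sup>2)) * M powr (- p) \<le> M powr p * M powr (- p)"
          by (rule mult_right_mono) simp
        also have "M powr p * M powr (- p) = 1" using M by (simp add: powr_minus)
        finally have "real n * (a / \<sigma>)\<^sup>2 \<le> 8" using \<sigma> by (simp add: power_divide a2 field_simps)
        then show ?thesis unfolding q_def[symmetric] nmq(1) by (simp add: mult.assoc)
      next
        case False
        then have h: "real n * B * log 2 (real n) \<le> x powr (1 + p)" "x \<le> real n powr (1 / p)"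
          using * by (auto simp: p_def)
        have B: "B > 0" using * by simp
        have lnn: "ln (real n) > 0" "ln 4 \<le> ln (real n)" using n by (auto intro: ln_gt_zero)
        \<comment> \<open>With this choice the empty string contributes \<open>2 / n\<close> per
          machine, hence \<open>G / 2\<close> in all, which is \<open>part1\<close>; and
          \<open>ln (1 / \<eta>)\<close> is the logarithm in the communication condition.\<close>
        define \<eta> where "\<eta> = 1 / real n"
        have \<eta>: "\<eta> > 0" "\<eta> \<le> 1 / 2" using n by (auto simp: \<eta>_def field_simps)
        define G where "G = (a / \<sigma>)\<^sup>2"
        have G: "G = a\<^sup>2 / \<sigma>\<^sup>2" "G \<ge> 0" by (auto simp: G_def power_divide)
        have part1: "G / 2 \<le> M / (48 * real N)"
        proof -
          have "G / 2 * (48 * real N) = 24 * real N * a\<^sup>2 / \<sigma>\<^sup>2" by (simp add: G)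
          also have "\<dots> \<le> 24 * real N * L\<^sup>2 / \<sigma>\<^sup>2"
          proof -
            have "a\<^sup>2 * 1 \<le> a\<^sup>2 * M" using M x by (intro mult_left_mono) auto
            also have "\<dots> \<le> L\<^sup>2" using aM zero_le_power2[of L] by linarith
            finally show ?thesis by (intro divide_right_mono mult_left_mono) auto
          qed
          also have "\<dots> \<le> M" using x M by linarith
          finally show ?thesis using N by (simp add: pos_le_divide_eq)
        qed
        \<comment> \<open>Dividing the communication condition by \<open>M powr p\<close> brings in
          the squared amplitude \<open>a^2\<close>.\<close>
        have part2: "real n * G * (B * ln (real n)) / 2 \<le> M / (48 * real N)"
        proof -
          have "real n * B * ln (real n) \<le> real n * B * log 2 (real n)"
            using log2_ge_ln[of "real n"] n B by (intro mult_left_mono) auto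
          also note h(1)
          finally have "real n * B * ln (real n) * (24 * real N * L\<^sup>2 / \<sigma>\<^sup>2) \<le> x powr (1 + p) * A powr (1 + p)"
          proof (rule mult_mono)
            have "24 * real N * L\<^sup>2 / \<sigma>\<^sup>2 = A2 powr (1 + p)" using L \<sigma> p N by (simp add: A2_def powr_powr)
            also have "\<dots> \<le> A powr (1 + p)" using A p by (intro powr_mono2) (auto simp: A2_def)
            finally show "24 * real N * L\<^sup>2 / \<sigma>\<^sup>2 \<le> A powr (1 + p)" .
          qed auto
          also have "\<dots> = (A * x) powr (1 + p)" using A x by (simp add: powr_mult)
          also have "\<dots> \<le> M powr (1 + p)" using M A x p by (intro powr_mono2) auto
          finally have "real n * B * ln (real n) * (24 * real N * L\<^sup>2 / \<sigma>\<^sup>2) * M powr (- p) \<le> M powr (1 + p) * M powr (- p)"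
            by (rule mult_right_mono) simp
          also have "M powr (1 + p) * M powr (- p) = M" using M by (simp add: powr_add[symmetric])
          finally have main: "real n * B * ln (real n) * (24 * real N * L\<^sup>2 / \<sigma>\<^sup>2) * M powr (- p) \<le> M" .
          have "real n * G * (B * ln (real n)) / 2 * (48 * real N)
             = real n * B * ln (real n) * (24 * real N * L\<^sup>2 / \<sigma>\<^sup>2) * M powr (- p) / 2"
            unfolding G(1) a2 by simp
          also have "\<dots> \<le> M"
          proof -
            have "u / 2 \<le> M" if "u \<le> M" for u using that M(3) by linarith
            from this[OF main] show ?thesis .
          qed
          finally have "real n * G * (B * ln (real n)) / 2 * (48 * real N) \<le> M" .
          moreover have "0 < 48 * real N" using N by simp
          ultimately show ?thesis by (simp only: pos_le_divide_eq)
        qed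
        have "ln (1 / \<eta>) + ln 4 \<le> 2 * ln (real n)" using lnn by (simp add: \<eta>_def)
        then have "B * (ln (1 / \<eta>) + ln 4) \<le> B * (2 * ln (real n))" using B by (intro mult_left_mono) auto
        then have "2 * \<eta> + B * (ln (1 / \<eta>) + ln 4) \<le> 2 / real n + B * (2 * ln (real n))"
          by (simp add: \<eta>_def)
        then have "real m * (real q * G) * (2 * \<eta> + B * (ln (1 / \<eta>) + ln 4)) / 4
          \<le> real m * (real q * G) * (2 / real n + B * (2 * ln (real n))) / 4"
          using G(2) by (intro divide_right_mono mult_left_mono) auto
        also have "\<dots> = real n * G * (2 / real n + B * (2 * ln (real n))) / 4" by (simp add: nmq(1))
        also have "\<dots> = G / 2 + real n * G * (B * ln (real n)) / 2" using n by (simp add: field_simps)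
        \<comment> \<open>The two parts of \<open>M / (48 * N)\<close> add up to
          \<open>M / (24 * N)\<close>, one sixth of the lower bound for \<open>d\<close>.
          Information and tail thus get half of \<open>d / 3\<close> each.\<close>
        also have "\<dots> \<le> M / (4 * real N) / 6"
          using part1 part2 by simp
        also have "\<dots> \<le> real d / 6" using d(2) by (rule divide_right_mono) simp
        finally have first: "real m * (real q * G) * (2 * \<eta> + B * (ln (1 / \<eta>) + ln 4)) / 4 \<le> real d / 6" .
        \<comment> \<open>The bound on \<open>m\<close> times
          \<open>M \<le> 2 * A * n powr (1 / p)\<close> gives
          \<open>m * M \<le> 2 * A * K * n / (ln n)^2\<close>; dividing by \<open>m\<close> leaves
          the ratio of the local sample size to \<open>2 ^ j\<close>.\<close>
        have expo: "c2 * (ln (real n))\<^sup>2 \<le> real q / (C\<^sup>2 * M)"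
        proof -
          have "real m * M \<le> (K * (real n powr (2 * s / p) / (ln (real n))\<^sup>2)) * (2 * A * real n powr (1 / p))"
          proof (rule mult_mono)
            show "real m \<le> K * (real n powr (2 * s / p) / (ln (real n))\<^sup>2)" using * by (simp add: p_def)
            have "A * x \<le> A * real n powr (1 / p)" using h(2) A by (intro mult_left_mono) auto
            then show "M \<le> 2 * A * real n powr (1 / p)" using M by simp
          qed (use M K in auto)
          also have "\<dots> = 2 * A * K * (real n powr (2 * s / p) * real n powr (1 / p)) / (ln (real n))\<^sup>2"
            by simp
          also have "real n powr (2 * s / p) * real n powr (1 / p) = real n"
          proof -
            have "2 * s / p + 1 / p = 1" using p by (simp add: p_def field_simps)
            then show ?thesis using n by (simp add: powr_add[symmetric])
          qed
          finally have "real m * M * (ln (real n))\<^sup>2 \<le> 2 * A * K * (real m * real q)"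
            using lnn nmq(1) by (simp add: pos_le_divide_eq)
          then have "real m * (M * (ln (real n))\<^sup>2) \<le> real m * (2 * A * K * real q)"
            by (simp only: mult_ac)
          then have "M * (ln (real n))\<^sup>2 \<le> 2 * A * K * real q"
            using mn(2) by (simp only: mult_le_cancel_left_pos of_nat_0_less_iff)
          then have "M * (ln (real n))\<^sup>2 / (2 * A * K * C\<^sup>2 * M) \<le> 2 * A * K * real q / (2 * A * K * C\<^sup>2 * M)"
            using A K M by (intro divide_right_mono) auto
          then show ?thesis using A K M C by (simp add: c2_def)
        qed
        have tail: "2 * real m * real d * ((1 + G * (real q * (C\<^sup>2 * M))) / 2 * exp (- real q / (C\<^sup>2 * M))) \<le> real d / 6"
        proof -
          have "G * (C\<^sup>2 * M) \<le> c1"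
          proof -
            have "G * (C\<^sup>2 * M) = C\<^sup>2 / \<sigma>\<^sup>2 * (a\<^sup>2 * M)" by (simp add: G)
            also have "\<dots> \<le> C\<^sup>2 / \<sigma>\<^sup>2 * (L\<^sup>2 / 2)" using aM by (rule mult_left_mono) simp
            finally show ?thesis by (simp add: c1_def mult_ac)
          qed
          then have "real q * (G * (C\<^sup>2 * M)) \<le> real q * c1" by (rule mult_left_mono) simp
          then have "real m * (1 + G * (real q * (C\<^sup>2 * M))) \<le> real m * (1 + real q * c1)"
            by (intro mult_left_mono) (auto simp: mult_ac)
          also have "\<dots> = real m + c1 * real n" by (simp add: nmq(1) algebra_simps)
          also have "\<dots> \<le> (1 + c1) * real n"
            using dvd_imp_le[OF mn(1)] n by (simp add: algebra_simps)
          finally have 1: "real m * (1 + G * (real q * (C\<^sup>2 * M))) \<le> (1 + c1) * real n" .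
          have "12 * (1 + c1) * real n \<le> exp (real q / (C\<^sup>2 * M))"
            using elim(1) expo by (meson exp_le_cancel_iff order_trans)
          then have 2: "(1 + c1) * real n * exp (- real q / (C\<^sup>2 * M)) \<le> 1 / 12"
            by (simp add: exp_minus field_simps)
          have "real m * (1 + G * (real q * (C\<^sup>2 * M))) * exp (- real q / (C\<^sup>2 * M)) \<le> (1 + c1) * real n * exp (- real q / (C\<^sup>2 * M))"
            using 1 by (rule mult_right_mono) simp
          from order_trans[OF this 2]
          have "real d * (real m * (1 + G * (real q * (C\<^sup>2 * M))) * exp (- real q / (C\<^sup>2 * M))) \<le> real d * (1 / 12)"
            by (rule mult_left_mono) simp
          then show ?thesis by (simp add: mult_ac)
        qed
        from first tail have "real m * (real q * G) * (2 * \<eta> + B * (ln (1 / \<eta>) + ln 4)) / 4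
          + 2 * real m * real d * ((1 + G * (real q * (C\<^sup>2 * M))) / 2 * exp (- real q / (C\<^sup>2 * M))) \<le> real d / 3"
          by linarith
        with \<eta> show ?thesis unfolding b2 q_def[symmetric] d_def[symmetric] G_def by blast
      qed
      have core: "ennreal (a\<^sup>2 * real d / 100) \<le> minimax_risk \<sigma> n m (\<lambda>_. B) (besov_ball s J0 \<psi> L)"
        unfolding d_def
        by (rule minimax_core_bound[OF cdv \<sigma> L C _ Cb[OF J] disj[OF J] J _ _ _ apos a2' alt])
           (use * d nmq in \<open>auto simp: d_def q_def\<close>)
      have "c * x powr (- (2 * s)) \<le> a\<^sup>2 * real d / 100"
      proof -
        have "c * x powr (- (2 * s)) = L\<^sup>2 / (800 * real N) * (2 * A * x) powr (- (2 * s))"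
          using A x by (simp add: c_def powr_mult)
        also have "\<dots> \<le> L\<^sup>2 / (800 * real N) * M powr (- (2 * s))"
          using M A x s by (intro mult_left_mono powr_mono2') auto
        also have "M powr (- (2 * s)) = M powr (- p) * M"
        proof -
          have "M powr (- p) * M = M powr (- p) * M powr 1" using M by simp
          also have "\<dots> = M powr (- (2 * s))" unfolding powr_add[symmetric] by (simp add: p_def)
          finally show ?thesis ..
        qed
        also have "L\<^sup>2 / (800 * real N) * (M powr (- p) * M) = a\<^sup>2 * (M / (4 * real N)) / 100"
          unfolding a2 by simp
        also have "\<dots> \<le> a\<^sup>2 * real d / 100"
          using d(2) by (intro divide_right_mono mult_left_mono) auto
        finally show ?thesis .
      qed
      then show "ennreal (c * x powr (- (2 * s))) \<le> minimax_risk \<sigma> n m (\<lambda>_. B) (besov_ball s J0 \<psi> L)"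
        using core by (meson ennreal_leI order_trans)
    qed
  qed
  with cpos show ?thesis by blast
qed

section \<open>The three regimes\<close>

theorem corollary2p2:
  fixes s L \<sigma> :: real and N J0 :: nat and \<psi> :: "cdv_index \<Rightarrow> real \<Rightarrow> real"
  assumes "s > 0" and "L > 0" and "\<sigma> > 0"
    and "cdv_basis N J0 \<psi>" and "real N > s"
  shows "\<forall>K>0. \<exists>C>0. \<forall>\<^sub>F n in sequentially. \<forall>(m::nat) (B::real).
    m dvd n \<and> log 2 (real n) \<le> real m \<and>
    real m \<le> K * (real n powr (2 * s / (1 + 2 * s)) / (ln (real n))\<^sup>2) \<and> B > 0 \<longrightarrow>
    (let R = minimax_risk \<sigma> n m (\<lambda>_. B) (besov_ball s J0 \<psi> L);
         b1 = (real n * log 2 (real n) / real m powr (2 + 2 * s)) powr (1 / (1 + 2 * s));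
         b2 = real n powr (1 / (1 + 2 * s)) / log 2 (real n)
     in
      (b2 \<le> B \<longrightarrow>
        ennreal (C * (L powr (2 / (1 + 2 * s)) * real n powr (- (2 * s / (1 + 2 * s))))) \<le> R) \<and>
      (b1 \<le> B \<and> B < b2 \<longrightarrow>
        ennreal (C * (L powr (2 / (1 + 2 * s)) *
          (real n powr (1 / (1 + 2 * s)) / (B * log 2 (real n))) powr (2 * s / (2 + 2 * s)) *
          real n powr (- (2 * s / (1 + 2 * s))))) \<le> R) \<and>
      (b1 > B \<longrightarrow>
        ennreal (C * (L powr (2 / (1 + 2 * s)) *
          (real n * log 2 (real n) / real m) powr (- (2 * s / (1 + 2 * s))))) \<le> R))"
proof (intro allI impI)
  fix K :: real assume K: "K > 0"
  define p where "p = 1 + 2 * s"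
  have s: "s > 0" and p: "p > 1" and p1: "1 + p = 2 + 2 * s" using \<open>s > 0\<close> by (auto simp: p_def)
  from minimax_lower_bound_at_scale[OF assms(1-4) K] obtain c x0 where c: "c > 0"
    and ev: "\<forall>\<^sub>F n in sequentially. \<forall>(m::nat) (B::real) (x::real).
      m dvd n \<and> m > 0 \<and> real m \<le> K * (real n powr (2 * s / (1 + 2 * s)) / (ln (real n))\<^sup>2) \<and> B > 0 \<and> x \<ge> x0 \<and>
      (real n \<le> x powr (1 + 2 * s) \<or> real n * B * log 2 (real n) \<le> x powr (2 + 2 * s) \<and> x \<le> real n powr (1 / (1 + 2 * s))) \<longrightarrow>
      ennreal (c * x powr (- (2 * s))) \<le> minimax_risk \<sigma> n m (\<lambda>_. B) (besov_ball s J0 \<psi> L)"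
    by blast
  \<comment> \<open>\<open>L\<close> is fixed, so its power in the claimed rates is absorbed into
    the constant.\<close>
  define C where "C = c / L powr (2 / p)"
  have C: "C > 0" using c \<open>L > 0\<close> by (simp add: C_def)
  have CL: "C * (L powr (2 / p) * y) = c * y" for y using \<open>L > 0\<close> by (simp add: C_def)
  define x1 where "x1 = max 1 x0"
  have x1: "x1 \<ge> 1" "x1 \<ge> x0" by (auto simp: x1_def)
  \<comment> \<open>This is the inequality \<open>x1 \<le> z\<close> below, taken at the largest
    admissible \<open>m\<close>.\<close>
  have grow: "\<forall>\<^sub>F n :: nat in sequentially. K * x1 powr p \<le> real n powr (1 / p) * (log 2 (real n) * (ln (real n))\<^sup>2)"
    using p by real_asymp
  show "\<exists>C>0. \<forall>\<^sub>F n in sequentially. \<forall>(m::nat) (B::real).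
    m dvd n \<and> log 2 (real n) \<le> real m \<and>
    real m \<le> K * (real n powr (2 * s / (1 + 2 * s)) / (ln (real n))\<^sup>2) \<and> B > 0 \<longrightarrow>
    (let R = minimax_risk \<sigma> n m (\<lambda>_. B) (besov_ball s J0 \<psi> L);
         b1 = (real n * log 2 (real n) / real m powr (2 + 2 * s)) powr (1 / (1 + 2 * s));
         b2 = real n powr (1 / (1 + 2 * s)) / log 2 (real n)
     in
      (b2 \<le> B \<longrightarrow>
        ennreal (C * (L powr (2 / (1 + 2 * s)) * real n powr (- (2 * s / (1 + 2 * s))))) \<le> R) \<and>
      (b1 \<le> B \<and> B < b2 \<longrightarrow>
        ennreal (C * (L powr (2 / (1 + 2 * s)) *
          (real n powr (1 / (1 + 2 * s)) / (B * log 2 (real n))) powr (2 * s / (2 + 2 * s)) *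
          real n powr (- (2 * s / (1 + 2 * s))))) \<le> R) \<and>
      (b1 > B \<longrightarrow>
        ennreal (C * (L powr (2 / (1 + 2 * s)) *
          (real n * log 2 (real n) / real m) powr (- (2 * s / (1 + 2 * s))))) \<le> R))"
  proof (intro exI[of _ C] conjI C, use ev grow eventually_ge_at_top[of "4 :: nat"] in eventually_elim)
    case (elim n)
    note scale = elim(1)[rule_format]
    have n: "real n \<ge> 4" using elim(3) by simp
    define l where "l = log 2 (real n)"
    have lnn: "ln (real n) > 0" using n by simp
    have l: "l \<ge> 1" using n by (simp add: l_def le_log_iff)
    show ?case
    proof (intro allI impI)
      fix m :: nat and B :: real
      assume *: "m dvd n \<and> log 2 (real n) \<le> real m \<and>
        real m \<le> K * (real n powr (2 * s / (1 + 2 * s)) / (ln (real n))\<^sup>2) \<and> B > 0"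
      then have B: "B > 0" and ml: "l \<le> real m" and mK: "real m \<le> K * (real n powr (2 * s / p) / (ln (real n))\<^sup>2)"
        by (auto simp: l_def p_def)
      have m: "real m > 0" using ml l by linarith
      define R where "R = minimax_risk \<sigma> n m (\<lambda>_. B) (besov_ball s J0 \<psi> L)"
      have lower: "ennreal (c * x powr (- (2 * s))) \<le> R"
        if "x1 \<le> x" "real n \<le> x powr p \<or> real n * B * l \<le> x powr (1 + p) \<and> x \<le> real n powr (1 / p)" for x
        unfolding R_def using that x1 * m by (intro scale) (auto simp: l_def p_def)
      \<comment> \<open>\<open>z\<close> is the scale of the third regime:
        \<open>z powr (- 2 * s)\<close> is the rate claimed there. It also marks the border to the
        second one, since by \<open>zb\<close> the communication condition at \<open>x = z\<close>
        reads \<open>B \<le> b1\<close>.\<close>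
      define z where "z = (real n * l / real m) powr (1 / p)"
      have nlm: "real n * l / real m > 0" using n l m by simp
      \<comment> \<open>The upper bound on \<open>m\<close> keeps \<open>z\<close> above the
        threshold \<open>x1\<close>, and \<open>log 2 n \<le> m\<close> keeps it below
        \<open>n powr (1 / p)\<close>.\<close>
      have z: "x1 \<le> z" "z \<le> real n powr (1 / p)" "z > 0"
      proof -
        have nn: "real n = real n powr (2 * s / p) * real n powr (1 / p)"
        proof -
          have "2 * s / p + 1 / p = 1" using p by (simp add: p_def field_simps)
          then show ?thesis using n by (simp add: powr_add[symmetric])
        qed
        have "real m * x1 powr p \<le> K * (real n powr (2 * s / p) / (ln (real n))\<^sup>2) * x1 powr p"
          using mK by (rule mult_right_mono) simp
        also have "\<dots> = real n powr (2 * s / p) / (ln (real n))\<^sup>2 * (K * x1 powr p)" by simp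
        also have "\<dots> \<le> real n powr (2 * s / p) / (ln (real n))\<^sup>2 * (real n powr (1 / p) * (l * (ln (real n))\<^sup>2))"
          using elim(2) by (intro mult_left_mono) (auto simp: l_def)
        also have "\<dots> = (real n powr (2 * s / p) * real n powr (1 / p)) * l" using lnn by simp
        also have "\<dots> = real n * l" using nn by simp
        finally have "x1 powr p \<le> real n * l / real m" using m by (simp add: pos_le_divide_eq mult.commute)
        then have "(x1 powr p) powr (1 / p) \<le> z" unfolding z_def using p by (intro powr_mono2) auto
        then show "x1 \<le> z" using x1 p by (simp add: powr_powr)
        show "z > 0" using n l m by (simp add: z_def)
        have "real n * l / real m \<le> real n" using ml m n by (simp add: pos_divide_le_eq mult_left_mono)
        then show "z \<le> real n powr (1 / p)" unfolding z_def using nlm p by (intro powr_mono2) auto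
      qed
      define b1 where "b1 = (real n * l / real m powr (1 + p)) powr (1 / p)"
      define b2 where "b2 = real n powr (1 / p) / l"
      have zb: "z powr (1 + p) = real n * l * b1"
      proof -
        have pos: "real n * l > 0" using n l by simp
        have "real n * l * b1 = (real n * l) powr 1 * ((real n * l) powr (1 / p) / real m powr ((1 + p) / p))"
          using pos m p by (simp add: b1_def powr_divide powr_powr)
        also have "\<dots> = (real n * l) powr ((1 + p) / p) / real m powr ((1 + p) / p)"
        proof -
          have "(1 + p) / p = 1 + 1 / p" using p by (simp add: field_simps)
          then show ?thesis by (simp only: powr_add) simp
        qed
        also have "\<dots> = z powr (1 + p)" using pos m by (simp add: z_def powr_powr powr_divide)
        finally show ?thesis ..
      qed
      \<comment> \<open>The scale is \<open>n powr (1 / p)\<close>, where the full-data alternative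
        holds with equality.\<close>
      have bound1: "ennreal (c * real n powr (- (2 * s / p))) \<le> R" if "b2 \<le> B"
      proof -
        have "ennreal (c * (real n powr (1 / p)) powr (- (2 * s))) \<le> R"
        proof (rule lower)
          show "x1 \<le> real n powr (1 / p)" using z by linarith
          show "real n \<le> (real n powr (1 / p)) powr p \<or> real n * B * l \<le> (real n powr (1 / p)) powr (1 + p) \<and> real n powr (1 / p) \<le> real n powr (1 / p)"
            using p n by (simp add: powr_powr)
        qed
        then show ?thesis by (simp add: powr_powr)
      qed
      have bound2: "ennreal (c * ((real n powr (1 / p) / (B * l)) powr (2 * s / (1 + p)) * real n powr (- (2 * s / p)))) \<le> R"
        if b: "b1 \<le> B" "B < b2"
      proof -
        \<comment> \<open>\<open>y\<close> is the scale at which the communication condition holds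
          with equality. The bound \<open>b1 \<le> B\<close> places it above \<open>z\<close>, hence
          above the threshold \<open>x1\<close>, and \<open>B < b2\<close> places it below
          \<open>n powr (1 / p)\<close>.\<close>
        define y where "y = (real n * B * l) powr (1 / (1 + p))"
        have pos: "real n * B * l > 0" using n B l by simp
        have yp: "y powr (1 + p) = real n * B * l" using pos p by (simp add: y_def powr_powr)
        have "z powr (1 + p) \<le> y powr (1 + p)"
          unfolding zb yp using b(1) n l by (simp add: mult_ac mult_left_mono)
        then have zy: "z \<le> y" using z(3) p pos powr_less_mono2[of "1 + p" y z] by (force simp: y_def not_le[symmetric])
        have "B * l < real n powr (1 / p)" using b(2) l by (simp add: b2_def pos_less_divide_eq)
        then have "real n * B * l \<le> real n powr 1 * real n powr (1 / p)"
          using n by (simp add: mult.assoc mult_left_mono)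
        also have "\<dots> = (real n powr (1 / p)) powr (1 + p)"
          unfolding powr_add[symmetric] powr_powr using p by (simp add: field_simps)
        finally have "(real n * B * l) powr (1 / (1 + p)) \<le> ((real n powr (1 / p)) powr (1 + p)) powr (1 / (1 + p))"
          using pos p by (intro powr_mono2) auto
        then have yn: "y \<le> real n powr (1 / p)" using p n by (simp add: y_def powr_powr)
        have "ennreal (c * y powr (- (2 * s))) \<le> R"
          by (rule lower) (use zy z yn yp in auto)
        also have "y powr (- (2 * s)) = (real n powr (1 / p) / (B * l)) powr (2 * s / (1 + p)) * real n powr (- (2 * s / p))"
        proof -
          have "(real n powr (1 / p) / (B * l)) powr (2 * s / (1 + p)) * real n powr (- (2 * s / p))
              = real n powr (1 / p * (2 * s / (1 + p))) * real n powr (- (2 * s / p)) / (B * l) powr (2 * s / (1 + p))"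
            using B l n by (simp add: powr_divide powr_powr)
          also have "real n powr (1 / p * (2 * s / (1 + p))) * real n powr (- (2 * s / p)) = real n powr (- (2 * s / (1 + p)))"
          proof -
            have "p \<noteq> 0" "1 + p \<noteq> 0" using p by auto
            then have "1 / p * (2 * s / (1 + p)) + - (2 * s / p) = - (2 * s / (1 + p))"
              by (simp add: divide_simps) (simp add: algebra_simps)
            then show ?thesis by (simp only: powr_add[symmetric])
          qed
          also have "real n powr (- (2 * s / (1 + p))) / (B * l) powr (2 * s / (1 + p)) = (real n * (B * l)) powr (- (2 * s / (1 + p)))"
            using B l n by (simp add: powr_mult powr_minus_divide)
          also have "\<dots> = y powr (- (2 * s))"
            by (simp add: y_def powr_powr mult.assoc)
          finally show ?thesis ..
        qed
        finally show ?thesis .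
      qed
      have bound3: "ennreal (c * (real n * l / real m) powr (- (2 * s / p))) \<le> R" if "B < b1"
      proof -
        have "real n * l * B \<le> real n * l * b1" using that n l by (intro mult_left_mono) auto
        then have "real n * B * l \<le> z powr (1 + p)" unfolding zb by (simp add: mult_ac)
        then have "ennreal (c * z powr (- (2 * s))) \<le> R"
          using z by (intro lower) auto
        then show ?thesis by (simp add: z_def powr_powr)
      qed
      show "let R = minimax_risk \<sigma> n m (\<lambda>_. B) (besov_ball s J0 \<psi> L);
          b1 = (real n * log 2 (real n) / real m powr (2 + 2 * s)) powr (1 / (1 + 2 * s));
          b2 = real n powr (1 / (1 + 2 * s)) / log 2 (real n)
        in
        (b2 \<le> B \<longrightarrow>
          ennreal (C * (L powr (2 / (1 + 2 * s)) * real n powr (- (2 * s / (1 + 2 * s))))) \<le> R) \<and>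
        (b1 \<le> B \<and> B < b2 \<longrightarrow>
          ennreal (C * (L powr (2 / (1 + 2 * s)) *
            (real n powr (1 / (1 + 2 * s)) / (B * log 2 (real n))) powr (2 * s / (2 + 2 * s)) *
            real n powr (- (2 * s / (1 + 2 * s))))) \<le> R) \<and>
        (b1 > B \<longrightarrow>
          ennreal (C * (L powr (2 / (1 + 2 * s)) *
            (real n * log 2 (real n) / real m) powr (- (2 * s / (1 + 2 * s))))) \<le> R)"
        unfolding Let_def l_def[symmetric] R_def[symmetric] p1[symmetric] unfolding p_def[symmetric]
        unfolding b1_def[symmetric] b2_def[symmetric] mult.assoc[of "L powr (2 / p)"] CL
        using bound1 bound2 bound3 by blast
    qed
  qed
qed

end
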